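(* Let $d\ge1$, $\alpha\in(-\tfrac12,\infty)^d$ and $0<\lambda<\beta<1$. Then the Bessel Laguerre fractional derivative $\mathcal{D}_\lambda^\alpha$ is bounded from $Lip_\beta(\mu_\alpha)$ into $Lip_{\beta-\lambda}(\mu_\alpha)$; that is, there is a constant $C$ such that for every $f\in Lip_\beta(\mu_\alpha)$ one has $\mathcal{D}_\lambda^\alpha f\in Lip_{\beta-\lambda}(\mu_\alpha)$ and $\|\mathcal{D}_\lambda^\alpha f\|_{Lip_{\beta-\lambda}(\mu_\alpha)}\le C\|f\|_{Lip_\beta(\mu_\alpha)}$.
   Context: Let $\mathbb{R}_+^d=(0,\infty)^d$ and, for $\alpha=(\alpha_1,\dots,\alpha_d)\in(-1,\infty)^d$, let $\mathrm{d}\mu_\alpha(x)=\prod_{i=1}^d\frac{x_i^{\alpha_i}e^{-x_i}}{\Gamma(\alpha_i+1)}\,\mathrm{d}x$ be the Laguerre measure on $\mathbb{R}_+^d$. The Laguerre operator $\mathcal{L}^\alpha=-\sum_{i=1}^d\big[x_i\partial_{x_i}^2+(\alpha_i+1-x_i)\partial_{x_i}\big]$ is positive and self-adjoint (after closure) in $L^2(\mathbb{R}_+^d,\mathrm{d}\mu_\alpha)$. Laguerre semigroup: $T_t^\alpha=e^{-t\mathcal{L}^\alpha}$, given for $t>0$ by $T_t^\alpha f(x)=\int_{\mathbb{R}_+^d}G_t^\alpha(x,y)f(y)\,\mathrm{d}\mu_\alpha(y)$ with $$G_t^\alpha(x,y)=\prod_{j=1}^d\frac{\Gamma(\alpha_j+1)}{1-e^{-t}}\,e^{-\frac{e^{-t}}{1-e^{-t}}(x_j+y_j)}\big(\sqrt{e^{-t}x_jy_j}\big)^{-\alpha_j}I_{\alpha_j}\Big(\frac{2\sqrt{e^{-t}x_jy_j}}{1-e^{-t}}\Big),$$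 where $I_\nu$ is the modified Bessel function of the first kind of order $\nu$. Poisson-Laguerre semigroup: $P_t^\alpha=e^{-t\sqrt{\mathcal{L}^\alpha}}$, given for $t>0$ by $$P_t^\alpha f(x)=\int_0^\infty T_s^\alpha f(x)\,\frac{t}{2\sqrt\pi}\,\frac{e^{-t^2/(4s)}}{s^{3/2}}\,\mathrm{d}s .$$ Laguerre Lipschitz space: for $\beta>0$ let $n$ be the smallest integer greater than $\beta$. A function $f\in L^\infty(\mathbb{R}_+^d)$ belongs to $Lip_\beta(\mu_\alpha)$ if there is a constant $A_\beta(f)$ with $\big\|\frac{\partial^nP_t^\alpha f}{\partial t^n}\big\|_\infty\le A_\beta(f)t^{-n+\beta}$ for all $t>0$. The norm is $\|f\|_{Lip_\beta(\mu_\alpha)}=\|f\|_\infty+A_\beta(f)$, with $A_\beta(f)$ the smallest such constant. Bessel Laguerre fractional derivative of order $\lambda$: formally $\mathcal{D}_\lambda^\alpha=(I+\sqrt{\mathcal{L}^\alpha})^\lambda$. For $0<\lambda<1$ it is given by $$\mathcal{D}_\lambda^\alpha f=\frac1{c_\lambda}\int_0^\infty t^{-\lambda-1}(e^{-t}P_t^\alpha-I)f\,\mathrm{d}t,\qquad c_\lambda=\int_0^\infty u^{-\lambda-1}(e^{-u}-1)\,\mathrm{d}u .$$ *)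

theory Defs
  imports "HOL-Probability.Probability"
begin

definition orthant :: "(real ^ 'd) set" where
  "orthant = {x. \<forall>i. 0 < x $ i}"

text \<open>The space of the measure is the open orthant itself, so almost-everywhere and
  measurability statements say nothing about values outside it.\<close>

definition laguerre_measure :: "real ^ 'd \<Rightarrow> (real ^ 'd) measure" where
  "laguerre_measure \<alpha> = density (restrict_space lborel orthant)
     (\<lambda>x. ennreal (\<Prod>i\<in>UNIV. (x $ i) powr (\<alpha> $ i) * exp (- (x $ i)) / Gamma (\<alpha> $ i + 1)))"

text \<open>Modified Bessel function of the first kind, by its power series; only used for
  positive arguments and orders above -1, where no value of Gamma is taken at a pole.\<close>

definition bessel_I :: "real \<Rightarrow> real \<Rightarrow> real" where
  "bessel_I \<nu> z = (\<Sum>k. (z / 2) powr (2 * real k + \<nu>) / (fact k * Gamma (real k + \<nu> + 1)))"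

definition laguerre_kernel :: "real ^ 'd \<Rightarrow> real \<Rightarrow> real ^ 'd \<Rightarrow> real ^ 'd \<Rightarrow> real" where
  "laguerre_kernel \<alpha> t x y = (\<Prod>j\<in>UNIV.
      Gamma (\<alpha> $ j + 1) / (1 - exp (- t))
      * exp (- (exp (- t) / (1 - exp (- t))) * (x $ j + y $ j))
      * sqrt (exp (- t) * x $ j * y $ j) powr (- (\<alpha> $ j))
      * bessel_I (\<alpha> $ j) (2 * sqrt (exp (- t) * x $ j * y $ j) / (1 - exp (- t))))"

definition laguerre_semigroup ::
    "real ^ 'd \<Rightarrow> real \<Rightarrow> (real ^ 'd \<Rightarrow> real) \<Rightarrow> real ^ 'd \<Rightarrow> real" where
  "laguerre_semigroup \<alpha> t f x = (LINT y|laguerre_measure \<alpha>. laguerre_kernel \<alpha> t x y * f y)"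

definition poisson_laguerre ::
    "real ^ 'd \<Rightarrow> real \<Rightarrow> (real ^ 'd \<Rightarrow> real) \<Rightarrow> real ^ 'd \<Rightarrow> real" where
  "poisson_laguerre \<alpha> t f x = (LINT s:{0<..}|lborel.
     laguerre_semigroup \<alpha> s f x * (t / (2 * sqrt pi)) * (exp (- t\<^sup>2 / (4 * s)) / s powr (3 / 2)))"

text \<open>The essential supremum of a function that is not measurable is the top element.\<close>

definition Linf_norm :: "'a measure \<Rightarrow> ('a \<Rightarrow> real) \<Rightarrow> ereal" where
  "Linf_norm M f = esssup M (\<lambda>x. ereal \<bar>f x\<bar>)"

definition Linf :: "'a measure \<Rightarrow> ('a \<Rightarrow> real) set" where
  "Linf M = {f \<in> borel_measurable M. Linf_norm M f < \<infinity>}"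

definition lip_order :: "real \<Rightarrow> nat" where
  "lip_order \<beta> = (LEAST n. \<beta> < real n)"

definition poisson_deriv ::
    "real ^ 'd \<Rightarrow> nat \<Rightarrow> real \<Rightarrow> (real ^ 'd \<Rightarrow> real) \<Rightarrow> real ^ 'd \<Rightarrow> real" where
  "poisson_deriv \<alpha> n t f x = (deriv ^^ n) (\<lambda>s. poisson_laguerre \<alpha> s f x) t"

definition lip_bound :: "real ^ 'd \<Rightarrow> real \<Rightarrow> (real ^ 'd \<Rightarrow> real) \<Rightarrow> real \<Rightarrow> bool" where
  "lip_bound \<alpha> \<beta> f A \<longleftrightarrow> (\<forall>t>0.
     Linf_norm (laguerre_measure \<alpha>) (poisson_deriv \<alpha> (lip_order \<beta>) t f)
       \<le> ereal (A * t powr (- real (lip_order \<beta>) + \<beta>)))"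

text \<open>Since \<open>deriv\<close> is total, the existence of the derivatives up to the order in question
  is stated explicitly.\<close>

definition laguerre_Lip :: "real ^ 'd \<Rightarrow> real \<Rightarrow> (real ^ 'd \<Rightarrow> real) set" where
  "laguerre_Lip \<alpha> \<beta> = {f \<in> Linf (laguerre_measure \<alpha>).
     (\<forall>x\<in>orthant. \<forall>k<lip_order \<beta>. \<forall>t>0.
        (\<lambda>s. poisson_deriv \<alpha> k s f x) differentiable (at t)) \<and>
     (\<exists>A. lip_bound \<alpha> \<beta> f A)}"

definition laguerre_Lip_const :: "real ^ 'd \<Rightarrow> real \<Rightarrow> (real ^ 'd \<Rightarrow> real) \<Rightarrow> real" where
  "laguerre_Lip_const \<alpha> \<beta> f = Inf {A. lip_bound \<alpha> \<beta> f A}"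

definition laguerre_Lip_norm :: "real ^ 'd \<Rightarrow> real \<Rightarrow> (real ^ 'd \<Rightarrow> real) \<Rightarrow> real" where
  "laguerre_Lip_norm \<alpha> \<beta> f =
     real_of_ereal (Linf_norm (laguerre_measure \<alpha>) f) + laguerre_Lip_const \<alpha> \<beta> f"

definition bessel_const :: "real \<Rightarrow> real" where
  "bessel_const l = (LINT u:{0<..}|lborel. u powr (- l - 1) * (exp (- u) - 1))"

definition bessel_deriv_integrand ::
    "real ^ 'd \<Rightarrow> real \<Rightarrow> (real ^ 'd \<Rightarrow> real) \<Rightarrow> real ^ 'd \<Rightarrow> real \<Rightarrow> real" where
  "bessel_deriv_integrand \<alpha> l f x t =
     t powr (- l - 1) * (exp (- t) * poisson_laguerre \<alpha> t f x - f x)"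

definition bessel_deriv ::
    "real ^ 'd \<Rightarrow> real \<Rightarrow> (real ^ 'd \<Rightarrow> real) \<Rightarrow> real ^ 'd \<Rightarrow> real" where
  "bessel_deriv \<alpha> l f x =
     1 / bessel_const l * (LINT t:{0<..}|lborel. bessel_deriv_integrand \<alpha> l f x t)"

end

theory Submission
  imports Defs
begin

text \<open>
  The semigroup law \<open>P (a + b) = P a (P b)\<close> gives \<open>P' (a + b) f = P a (P' b f)\<close>. Hence the Lipschitz bound
  \<open>\<bar>P' t f\<bar> \<le> A t powr (\<beta> - 1)\<close>, assumed almost everywhere, holds at every point up to a factor, and a
  second time derivative costs another factor \<open>1 / t\<close>. Integrating the first bound yields
  \<open>\<bar>P t f - f\<bar> \<le> K t powr \<beta>\<close>, so the integral defining the fractional derivative \<open>g\<close> converges and \<open>g\<close> is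
  bounded. Applying \<open>P s\<close> under that integral,
  \<open>P' s g\<close> is controlled by the integral of \<open>t powr (- l - 1) \<bar>exp (- t) P' (s + t) f - P' s f\<bar>\<close>, and splitting
  at \<open>t = s\<close> gives the bound \<open>s powr (\<beta> - l - 1)\<close> for \<open>s \<le> 1\<close>. For \<open>s \<ge> 1\<close> the trivial bound
  \<open>\<bar>P' s g\<bar> \<le> 8 \<bar>g\<bar> / s\<close> suffices.

  The semigroup law rests on two explicit integrals: the densities of the one-sided stable law of order
  one half form a convolution semigroup, and the Laguerre kernel satisfies the Chapman-Kolmogorov equation,
  which on the level of power series is Vandermonde's identity.
\<close>

text \<open>The analysis is carried out for a symmetric conservative kernel on a probability space;
  explicit Laguerre formulas enter only to interpret that locale. The obstacle is that the Lipschitz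
  bound holds off a null set depending on the time, and that \<open>f\<close> is merely bounded, so
  convergence of \<open>P t f\<close> to \<open>f\<close> at time zero cannot come from continuity.
  The derivative bound makes \<open>P t f x\<close> Cauchy as \<open>t\<close> tends to zero at
  every \<open>x\<close>; the limit is identified with \<open>f\<close> weakly, by integrating over
  boxes, where symmetry moves the semigroup onto the indicator. After that one null set serves all
  times. The outer time derivative is not taken under the fractional integral: \<open>P s g\<close>
  is shown to be Lipschitz to the right of \<open>s\<close>, which bounds a derivative already known
  to exist. The trivial bound suffices for \<open>s \<ge> 1\<close> because
  \<open>\<beta> - l - 1\<close> exceeds \<open>-1\<close>. Integrals stay extended nonnegative for
  as long as possible, so that exchanging them needs no integrability; functions of both signs are
  reached by adding their bound.\<close>

section \<open>The one-sided stable density of order one half\<close>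

text \<open>The subordinator of the Poisson semigroup, extended by zero so that integrals run over the whole
  line and the values of the heat semigroup at nonpositive times never matter.\<close>

definition levy :: "real \<Rightarrow> real \<Rightarrow> real" where
  "levy t s = (if 0 < s then t / (2 * sqrt pi) * (exp (- t\<^sup>2 / (4 * s)) / s powr (3 / 2)) else 0)"

lemma powr_three_halves: "0 < s \<Longrightarrow> s powr (3 / 2) = s * sqrt s" for s :: real
proof -
  assume s: "0 < s"
  have "s powr (3 / 2) = s powr (1 + 1/2)" by simp
  also have "\<dots> = s * sqrt s" using s by (simp only: powr_add powr_half_sqrt) simp
  finally show ?thesis .
qed

lemma levy_eq: "0 < s \<Longrightarrow> levy t s = t / (2 * sqrt pi) * exp (- t\<^sup>2 / (4 * s)) / (s * sqrt s)"
  by (simp add: levy_def powr_three_halves)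

lemma levy_nonneg: "0 \<le> t \<Longrightarrow> 0 \<le> levy t s"
  by (simp add: levy_def)

lemma levy_nonpos[simp]: "s \<le> 0 \<Longrightarrow> levy t s = 0"
  by (simp add: levy_def)

lemma measurable_levy[measurable (raw)]:
  assumes [measurable]: "f \<in> borel_measurable N" "g \<in> borel_measurable N"
  shows "(\<lambda>x. levy (f x) (g x)) \<in> borel_measurable N"
  unfolding levy_def by measurable

text \<open>Injectivity takes the place of monotonicity, so decreasing substitutions fit as well.
  Since \<open>f\<close> vanishes off the image, the result is an integral over the whole line, and
  the Jacobian integrand only has to agree on \<open>S\<close> with a function \<open>h\<close>
  whose integral is known.\<close>

lemma nn_integral_substitution_image:
  fixes f g g' :: "real \<Rightarrow> real"
  assumes S: "S \<in> sets lebesgue"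
    and der: "\<And>x. x \<in> S \<Longrightarrow> (g has_field_derivative g' x) (at x within S)"
    and inj: "inj_on g S"
    and f: "f \<in> borel_measurable borel" "\<And>x. 0 \<le> f x" "\<And>x. x \<notin> g ` S \<Longrightarrow> f x = 0"
    and h: "has_bochner_integral lborel h b" "\<And>x. x \<in> S \<Longrightarrow> \<bar>g' x\<bar> * f (g x) = h x"
           "\<And>x. x \<notin> S \<Longrightarrow> h x = 0"
  shows "(\<integral>\<^sup>+x. ennreal (f x) \<partial>lborel) = ennreal b"
proof -
  have hl: "has_bochner_integral lebesgue h b"
    using h(1) borel_measurable_integrable[of lborel h]
    by (auto simp: has_bochner_integral_iff integrable_completion integral_completion)
  have eq: "(\<lambda>x. indicator S x *\<^sub>R (\<bar>g' x\<bar> * f (g x))) = h"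
    using h(2,3) by (auto simp: indicator_def fun_eq_iff)
  have ai: "(\<lambda>x. \<bar>g' x\<bar> * f (g x)) absolutely_integrable_on S"
    unfolding set_integrable_def eq using hl by (simp add: has_bochner_integral_iff)
  have "integral S (\<lambda>x. \<bar>g' x\<bar> * f (g x)) = (LINT x:S|lebesgue. \<bar>g' x\<bar> * f (g x))"
    using set_lebesgue_integral_eq_integral(2)[OF ai] by simp
  also have "\<dots> = b"
    unfolding set_lebesgue_integral_def eq using hl by (simp add: has_bochner_integral_iff)
  finally have "f absolutely_integrable_on g ` S" "integral (g ` S) f = b"
    using has_absolute_integral_change_of_variables_1'[OF S der inj, of f b] ai by auto
  then have "(f has_integral b) (g ` S)"
    by (meson absolutely_integrable_on_def has_integral_integrable_integral)
  then have "((\<lambda>x. if x \<in> g ` S then f x else 0) has_integral b) UNIV"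
    by (simp add: has_integral_restrict_UNIV)
  also have "(\<lambda>x. if x \<in> g ` S then f x else 0) = f" using f(3) by auto
  finally show ?thesis
    using nn_integral_has_integral_lborel[of f b] f by simp
qed

text \<open>The substitution \<open>s = t\<^sup>2 / (4 * w\<^sup>2)\<close> turns the exponent into
  \<open>- w\<^sup>2\<close>, and its Jacobian absorbs the power of \<open>s\<close>; what remains
  is half a Gaussian integral.\<close>

lemma nn_integral_levy:
  assumes t: "0 < t"
  shows "(\<integral>\<^sup>+s. ennreal (levy t s) \<partial>lborel) = 1"
proof -
  define g where "g = (\<lambda>w::real. t\<^sup>2 / (4 * w\<^sup>2))"
  define h where "h = (\<lambda>w::real. 2 / sqrt pi * (indicator {0<..} w *\<^sub>R exp (- w\<^sup>2)))"
  have im: "g ` {0<..} = {0<..}"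
  proof (intro set_eqI iffI)
    fix s :: real assume "s \<in> {0<..}"
    then have "s = g (t / (2 * sqrt s))" "t / (2 * sqrt s) > 0"
      using t by (auto simp: g_def power_divide power_mult_distrib)
    then show "s \<in> g ` {0<..}" by blast
  qed (use t in \<open>auto simp: g_def\<close>)
  have "has_bochner_integral lborel (\<lambda>w::real. indicator {0..} w *\<^sub>R exp (- w\<^sup>2)) (sqrt pi / 2)"
    by (rule gaussian_moment_0)
  moreover have "AE w in lborel. indicator {0..} w *\<^sub>R exp (- w\<^sup>2) = indicator {0<..} w *\<^sub>R exp (- w\<^sup>2 :: real)"
    using AE_lborel_singleton[of "0::real"] by eventually_elim (auto simp: indicator_def)
  ultimately have "has_bochner_integral lborel (\<lambda>w::real. indicator {0<..} w *\<^sub>R exp (- w\<^sup>2)) (sqrt pi / 2)"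
    by (subst (asm) has_bochner_integral_cong_AE) auto
  then have hb: "has_bochner_integral lborel h (2 / sqrt pi * (sqrt pi / 2))"
    unfolding h_def by (rule has_bochner_integral_mult_right)
  have "(\<integral>\<^sup>+s. ennreal (levy t s) \<partial>lborel) = ennreal (2 / sqrt pi * (sqrt pi / 2))"
  proof (rule nn_integral_substitution_image[OF _ _ _ _ _ _ hb, of "{0<..}" g "\<lambda>w. - t\<^sup>2 / (2 * w^3)"])
    show "(g has_field_derivative - t\<^sup>2 / (2 * x ^ 3)) (at x within {0<..})" if "x \<in> {0<..}" for x
      unfolding g_def using that
      by (auto intro!: derivative_eq_intros simp: field_simps power2_eq_square power3_eq_cube)
    show "inj_on g {0<..}" using t by (auto simp: inj_on_def g_def divide_simps)
    show "levy t x = 0" if "x \<notin> g ` {0<..}" for x using that by (simp add: im)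
    show "\<bar>- t\<^sup>2 / (2 * x ^ 3)\<bar> * levy t (g x) = h x" if "x \<in> {0<..}" for x
    proof -
      have x: "x > 0" using that by simp
      have g: "g x > 0" "sqrt (g x) = t / (2 * x)"
        using t x by (auto simp: g_def real_sqrt_divide real_sqrt_mult)
      show ?thesis using x t g(1)
        by (simp add: levy_eq g(2) h_def, simp add: g_def field_simps power2_eq_square power3_eq_cube)
    qed
  qed (use t in \<open>auto simp: levy_nonneg h_def\<close>)
  then show ?thesis by simp
qed

text \<open>Substituting \<open>a = c / (1 + z\<^sup>2)\<close> and then \<open>w = s z - t / z\<close> turns the integrand into a centred Gaussian
  density in \<open>w\<close> times a constant plus an odd function.\<close>

lemma nn_integral_levy_convolution:
  assumes s: "0 < s" and t: "0 < t" and c: "0 < c"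
  shows "(\<integral>\<^sup>+a. ennreal (levy s a * levy t (c - a)) \<partial>lborel) = ennreal (levy (s + t) c)"
proof -
  define R where "R = (\<lambda>w::real. sqrt (w\<^sup>2 + 4 * s * t))"
  \<comment> \<open>The positive root of \<open>s * z\<^sup>2 - w * z - t = 0\<close>.
    \<open>R w\<close> is the square root of the discriminant and equals
    \<open>s * z + t / z\<close>.\<close>
  define z where "z = (\<lambda>w. (w + R w) / (2 * s))"
  define g where "g = (\<lambda>w. c / (1 + (z w)\<^sup>2))"
  define g' where "g' = (\<lambda>w. - (2 * c * (z w)\<^sup>2 / (R w * (1 + (z w)\<^sup>2)\<^sup>2)))"
  define \<phi> where "\<phi> = normal_density 0 (sqrt (2 * c))"
  \<comment> \<open>The transformed integrand carries the factor \<open>(z + 1 / z) / R\<close>.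
    Since \<open>z = (R + w) / (2 * s)\<close> and \<open>1 / z = (R - w) / (2 * t)\<close>, this
    factor is a constant plus a multiple of \<open>w / R\<close>; that is where the coefficient
    \<open>(t - s) / (s + t)\<close> comes from.\<close>
  define h where "h = (\<lambda>w. levy (s + t) c * (\<phi> w + (t - s) / (s + t) * (\<phi> w * (w / R w))))"
  have Rpos: "R w > 0" and Rsq: "R w * R w = w\<^sup>2 + 4 * s * t" for w
    using s t by (auto simp: R_def intro!: add_nonneg_pos)
  have Rabs: "\<bar>w\<bar> < R w" for w
    unfolding R_def by (rule real_less_rsqrt) (use s t in auto)
  have zpos: "z w > 0" for w
    using Rabs[of w] s by (auto simp: z_def intro!: divide_pos_pos)
  have zw: "w = s * z w - t / z w" for w
  proof -
    have "s * (z w * z w) - t = w * z w"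
      using s Rsq[of w] by (simp add: z_def field_simps power2_eq_square)
    then show ?thesis using zpos[of w] by (simp add: field_simps)
  qed
  have Rz: "R w = s * z w + t / z w" for w
    using zw[of w] s by (simp add: z_def field_simps)
  have derz: "(z has_field_derivative (z w / R w)) (at w)" for w
  proof -
    have "w\<^sup>2 + 4 * s * t > 0" using s t by (auto intro!: add_nonneg_pos)
    then show ?thesis
      unfolding z_def[abs_def] R_def[abs_def] using s
      by (auto intro!: derivative_eq_intros simp: field_simps)
  qed
  have one: "1 + (z w)\<^sup>2 \<noteq> 0" for w by (smt (verit) zero_le_power2)
  have derg: "(g has_field_derivative g' w) (at w within UNIV)" for w
    unfolding g_def[abs_def] g'_def using one[of w] Rpos[of w]
    by (auto intro!: derivative_eq_intros derz simp: field_simps power2_eq_square)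
  have injg: "inj_on g UNIV"
  proof
    fix v w assume "g v = g w"
    then have "(z v)\<^sup>2 = (z w)\<^sup>2" using c one[of v] one[of w] by (simp add: g_def divide_simps)
    then have "z v = z w" using zpos[of v] zpos[of w] by (simp add: power2_eq_iff)
    then show "v = w" using zw[of v] zw[of w] by simp
  qed
  have img: "a \<in> range g" if a: "0 < a" "a < c" for a
  proof -
    define y where "y = sqrt ((c - a) / a)"
    have y: "y > 0" "y\<^sup>2 = (c - a) / a" using a by (auto simp: y_def)
    have "R (s * y - t / y) = s * y + t / y"
    proof -
      have "(s * y - t / y)\<^sup>2 + 4 * s * t = (s * y + t / y)\<^sup>2"
        using y(1) by (simp add: field_simps power2_eq_square)
      then show ?thesis using y(1) s t by (simp add: R_def)
    qed
    then have "z (s * y - t / y) = y" using s by (simp add: z_def)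
    moreover have "1 + y\<^sup>2 = c / a" using y(2) a by (simp add: field_simps)
    ultimately have "g (s * y - t / y) = a" using a by (simp add: g_def)
    then show ?thesis by blast
  qed
  have odd: "has_bochner_integral lborel (\<lambda>w. \<phi> w * (w / R w)) 0"
  proof -
    have int: "integrable lborel (\<lambda>w. \<phi> w * (w / R w))"
    proof (rule Bochner_Integration.integrable_bound)
      show "integrable lborel \<phi>" unfolding \<phi>_def using c by (intro integrable_normal_density) auto
      show "(\<lambda>w. \<phi> w * (w / R w)) \<in> borel_measurable lborel"
        unfolding \<phi>_def R_def by measurable
      have "\<bar>w / R w\<bar> \<le> 1" for w using Rabs[of w] Rpos[of w] by (simp add: field_simps)
      then show "AE w in lborel. norm (\<phi> w * (w / R w)) \<le> norm (\<phi> w)"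
        unfolding real_norm_def abs_mult by (intro AE_I2 mult_left_le) auto
    qed
    have "(\<integral>w. \<phi> w * (w / R w) \<partial>lborel) = (\<integral>w. \<phi> (- w) * (- w / R (- w)) \<partial>lborel)"
      using lborel_integral_real_affine[of "-1" "\<lambda>w. \<phi> w * (w / R w)" 0] by simp
    also have "\<dots> = - (\<integral>w. \<phi> w * (w / R w) \<partial>lborel)"
      by (simp add: \<phi>_def normal_density_def R_def)
    finally show ?thesis using int by (simp add: has_bochner_integral_iff)
  qed
  have hb: "has_bochner_integral lborel h (levy (s + t) c * (1 + (t - s) / (s + t) * 0))"
    unfolding h_def
  proof (intro has_bochner_integral_mult_right has_bochner_integral_add odd)
    show "has_bochner_integral lborel \<phi> 1"
      unfolding \<phi>_def using c
      by (auto simp: has_bochner_integral_iff intro!: integrable_normal_density integral_normal_density)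
  qed
  have eq: "\<bar>g' w\<bar> * (levy s (g w) * levy t (c - g w)) = h w" for w
  proof -
    define y q where "y = z w" and "q = sqrt (1 + y\<^sup>2)"
    have y: "y > 0" by (simp add: y_def zpos)
    have q: "q > 0" and q2: "q\<^sup>2 = 1 + y\<^sup>2" by (auto simp: q_def intro!: add_pos_nonneg)
    have R: "R w = s * y + t / y" and w: "w = s * y - t / y" using Rz zw by (auto simp: y_def)
    have gw: "g w = c / q\<^sup>2" by (simp add: g_def y_def[symmetric] q2)
    moreover have "c = c / q\<^sup>2 + c * y\<^sup>2 / q\<^sup>2"
    proof -
      have "c + c * y\<^sup>2 = c * q\<^sup>2" unfolding q2 by (simp add: distrib_left)
      then show ?thesis unfolding add_divide_distrib[symmetric] using q by simp
    qed
    ultimately have gw: "g w = c / q\<^sup>2" "c - g w = c * y\<^sup>2 / q\<^sup>2" by auto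
    have gpos: "g w > 0" "c - g w > 0" using gw c q y by auto
    have sq: "sqrt (g w) = sqrt c / q" "sqrt (c - g w) = sqrt c * y / q"
      unfolding gw(2) unfolding gw(1) using q y by (auto simp: real_sqrt_divide real_sqrt_mult)
    have cc: "sqrt c * sqrt c = c" "sqrt c > 0" using c by auto
    have ex: "exp (- s\<^sup>2 / (4 * g w)) * exp (- t\<^sup>2 / (4 * (c - g w)))
       = exp (- (s + t)\<^sup>2 / (4 * c)) * exp (- w\<^sup>2 / (4 * c))"
      unfolding exp_add[symmetric] gw(2) unfolding gw(1) unfolding w
    proof (rule arg_cong[where f=exp])
      \<comment> \<open>Completing the square: with \<open>q\<^sup>2 = 1 + y\<^sup>2\<close> the
        mixed terms \<open>2 * s * t\<close> of the two squares cancel. This is why the parameters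
        of the two densities add.\<close>
      have "s\<^sup>2 * q\<^sup>2 + t\<^sup>2 * q\<^sup>2 / y\<^sup>2 = (s + t)\<^sup>2 + (s * y - t / y)\<^sup>2"
        unfolding q2 using y by (simp add: field_simps power2_eq_square)
      then have "(s\<^sup>2 * q\<^sup>2 + t\<^sup>2 * q\<^sup>2 / y\<^sup>2) / (4 * c) = ((s + t)\<^sup>2 + (s * y - t / y)\<^sup>2) / (4 * c)"
        by simp
      then show "- s\<^sup>2 / (4 * (c / q\<^sup>2)) + - t\<^sup>2 / (4 * (c * y\<^sup>2 / q\<^sup>2)) =
          - (s + t)\<^sup>2 / (4 * c) + - (s * y - t / y)\<^sup>2 / (4 * c)"
        using y q c by (simp add: add_divide_distrib mult_ac)
    qed
    have wt: "g w * sqrt (g w) * ((c - g w) * sqrt (c - g w)) = c ^ 3 * y ^ 3 / q ^ 6"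
      unfolding sq unfolding gw(2) unfolding gw(1) using cc y q
      by (simp add: field_simps power2_eq_square power3_eq_cube eval_nat_numeral)
    have g'w: "\<bar>g' w\<bar> = 2 * c * y\<^sup>2 / (R w * q ^ 4)"
    proof -
      have "g' w = - (2 * c * y\<^sup>2 / (R w * (q\<^sup>2)\<^sup>2))"
        by (simp only: g'_def y_def q2)
      then have "g' w = - (2 * c * y\<^sup>2 / (R w * q ^ 4))" by (simp add: power_mult[symmetric])
      then show ?thesis using c Rpos[of w] by simp
    qed
    have "levy s (g w) * levy t (c - g w)
       = s * t / (4 * pi) * (exp (- s\<^sup>2 / (4 * g w)) * exp (- t\<^sup>2 / (4 * (c - g w))))
           / (g w * sqrt (g w) * ((c - g w) * sqrt (c - g w)))"
    proof -
      have *: "a / (2 * p) * d / m * (b / (2 * p) * e / n) = a * b / (4 * (p * p)) * (d * e) / (m * n)"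
        for a b d e m n p :: real by (simp add: mult_ac)
      show ?thesis unfolding levy_eq[OF gpos(1)] levy_eq[OF gpos(2)] * by (simp only: real_sqrt_mult_self abs_of_pos[OF pi_gt_zero])
    qed
    also have "\<dots> = s * t / (4 * pi) * (exp (- (s + t)\<^sup>2 / (4 * c)) * exp (- w\<^sup>2 / (4 * c))) / (c ^ 3 * y ^ 3 / q ^ 6)"
      by (simp only: ex wt)
    finally have 1: "\<bar>g' w\<bar> * (levy s (g w) * levy t (c - g w))
       = exp (- (s + t)\<^sup>2 / (4 * c)) * exp (- w\<^sup>2 / (4 * c)) * (s * t / (2 * pi * c\<^sup>2) * (q\<^sup>2 / (y * R w)))"
      unfolding g'w using y q c Rpos[of w] by (simp add: field_simps eval_nat_numeral)
    have \<phi>w: "\<phi> w = 1 / sqrt (4 * pi * c) * exp (- w\<^sup>2 / (4 * c))"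
      using c by (simp add: \<phi>_def normal_density_def mult_ac)
    define k where "k = 1 + (t - s) / (s + t) * (w / R w)"
    have "h w = levy (s + t) c * (\<phi> w * k)"
      unfolding h_def k_def by (simp only: distrib_left mult_1_right mult.left_commute)
    also have "\<dots> = (s + t) / (2 * sqrt pi * (c * sqrt c) * sqrt (4 * pi * c))
        * (exp (- (s + t)\<^sup>2 / (4 * c)) * exp (- w\<^sup>2 / (4 * c))) * k"
      unfolding levy_eq[OF c] \<phi>w by simp
    also have "2 * sqrt pi * (c * sqrt c) * sqrt (4 * pi * c) = 4 * pi * c\<^sup>2"
    proof -
      have "2 * sqrt pi * (c * sqrt c) * sqrt (4 * pi * c) = 4 * c * (sqrt pi * sqrt pi) * (sqrt c * sqrt c)"
        by (simp add: real_sqrt_mult mult_ac)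
      then show ?thesis using c by (simp add: power2_eq_square)
    qed
    also have "(s + t) / (4 * pi * c\<^sup>2) * (exp (- (s + t)\<^sup>2 / (4 * c)) * exp (- w\<^sup>2 / (4 * c))) * k
       = exp (- (s + t)\<^sup>2 / (4 * c)) * exp (- w\<^sup>2 / (4 * c)) *
         ((s + t) / (4 * pi * c\<^sup>2)  * (1 + (t - s) / (s + t) * (w / R w)))"
      unfolding k_def[symmetric] by (simp only: mult_ac)
    also have "(s + t) / (4 * pi * c\<^sup>2)  * (1 + (t - s) / (s + t) * (w / R w))
        = s * t / (2 * pi * c\<^sup>2) * (q\<^sup>2 / (y * R w))"
    proof -
      have "(s + t)  * (1 + (t - s) / (s + t) * (w / R w)) = ((s + t) * R w + (t - s) * w) / R w"
      proof -
        have "(s + t) * (1 + (t - s) / (s + t) * (w / R w)) = (s + t) + (t - s) * (w / R w)"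
          using s t by (simp add: distrib_left)
        then show ?thesis using Rpos[of w] by (simp add: field_simps)
      qed
      also have "(s + t) * R w + (t - s) * w = 2 * s * t * (q\<^sup>2 / y)"
        unfolding R q2 unfolding w using y by (simp add: field_simps power2_eq_square)
      finally have "(s + t) * (1 + (t - s) / (s + t) * (w / R w)) / (4 * pi * c\<^sup>2)
          = 2 * s * t * (q\<^sup>2 / y) / R w / (4 * pi * c\<^sup>2)" by (rule arg_cong)
      then show ?thesis by (simp add: mult_ac)
    qed
    finally show ?thesis using 1 by simp
  qed
  have "(\<integral>\<^sup>+a. ennreal (levy s a * levy t (c - a)) \<partial>lborel) = ennreal (levy (s + t) c * (1 + (t - s) / (s + t) * 0))"
  proof (rule nn_integral_substitution_image[OF _ _ _ _ _ _ hb, of UNIV g g'])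
    show "levy s x * levy t (c - x) = 0" if "x \<notin> range g" for x
      using that img[of x] by (cases "0 < x \<and> x < c") (auto simp: not_less)
  qed (use s t derg injg eq in \<open>auto simp: levy_nonneg\<close>)
  then show ?thesis by simp
qed

section \<open>Time derivative, domination and tails of the stable density\<close>

definition levy_dt :: "real \<Rightarrow> real \<Rightarrow> real" where
  "levy_dt t s = (1 / t - t / (2 * s)) * levy t s"

lemma measurable_levy_dt[measurable (raw)]:
  assumes [measurable]: "f \<in> borel_measurable N" "g \<in> borel_measurable N"
  shows "(\<lambda>x. levy_dt (f x) (g x)) \<in> borel_measurable N"
  unfolding levy_dt_def by measurable

lemma has_field_derivative_levy:
  assumes "t \<noteq> 0"
  shows "((\<lambda>t. levy t s) has_field_derivative levy_dt t s) (at t)"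
proof (cases "0 < s")
  case True
  then show ?thesis
    unfolding levy_eq[OF True] levy_dt_def using assms
    by (auto intro!: derivative_eq_intros simp: field_simps power2_eq_square)
qed (simp add: levy_dt_def)

text \<open>With \<open>x = t\<^sup>2 / (4 * s)\<close> the factor \<open>1 + 2 * x\<close> is
  absorbed by three quarters of the exponent, and the remaining quarter is exactly the exponent at
  time \<open>t / 2\<close>. As that density has mass one, the derivative kernel has total variation
  at most \<open>8 / t\<close>, the source of every later factor 8.\<close>

lemma abs_levy_dt_le:
  assumes t: "0 < t"
  shows "\<bar>levy_dt t s\<bar> \<le> 8 / t * levy (t / 2) s"
proof (cases "0 < s")
  case s: True
  define x where "x = t\<^sup>2 / (4 * s)"
  have x: "x > 0" using s t by (simp add: x_def)
  have "(1 + 2 * x) \<le> 4 * (1 + 3 / 4 * x)" using x by simp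
  also have "\<dots> \<le> 4 * exp (3 / 4 * x)" by (intro mult_left_mono exp_ge_add_one_self) simp
  finally have "(1 + 2 * x) * exp (- x) \<le> 4 * exp (3 / 4 * x) * exp (- x)"
    by (rule mult_right_mono) simp
  also have "\<dots> = 4 * exp (- x / 4)" by (simp flip: exp_add)
  finally have *: "(1 + 2 * x) * exp (- x) \<le> 4 * exp (- x / 4)" .
  have "\<bar>1 / t - t / (2 * s)\<bar> \<le> 1 / t + t / (2 * s)" using s t by (simp add: abs_le_iff)
  also have "\<dots> = (1 + 2 * x) / t" using s t by (simp add: x_def field_simps power2_eq_square)
  finally have "\<bar>levy_dt t s\<bar> \<le> (1 + 2 * x) / t * levy t s"
    unfolding levy_dt_def abs_mult using t by (intro mult_mono) (auto simp: levy_nonneg)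
  also have "\<dots> = ((1 + 2 * x) * exp (- x)) * (1 / (2 * sqrt pi * (s * sqrt s)))"
    using s t by (simp add: levy_eq x_def)
  also have "\<dots> \<le> (4 * exp (- x / 4)) * (1 / (2 * sqrt pi * (s * sqrt s)))"
    using * by (rule mult_right_mono) (use s in auto)
  also have "\<dots> = 8 / t * levy (t / 2) s"
    using s t by (simp add: levy_eq x_def power_divide)
  finally show ?thesis .
qed (simp add: levy_dt_def)

text \<open>A majorant uniform over a window of times, as needed for differentiating under the
  integral: the exponential decreases with the time, and the linear prefactor grows at most by
  \<open>q / r\<close>.\<close>

lemma levy_mono_scale:
  assumes "0 < r" "r \<le> t" "t \<le> q"
  shows "levy t s \<le> q / r * levy r s"
proof (cases "0 < s")
  case s: True
  have "r\<^sup>2 \<le> t\<^sup>2" using assms by (intro power_mono) auto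
  then have "exp (- t\<^sup>2 / (4 * s)) \<le> exp (- r\<^sup>2 / (4 * s))" using s by (simp add: divide_right_mono)
  then have "t * exp (- t\<^sup>2 / (4 * s)) \<le> q * exp (- r\<^sup>2 / (4 * s))"
    using assms by (intro mult_mono) auto
  then have "t * exp (- t\<^sup>2 / (4 * s)) / (2 * sqrt pi * (s * sqrt s)) \<le> q * exp (- r\<^sup>2 / (4 * s)) / (2 * sqrt pi * (s * sqrt s))"
    by (rule divide_right_mono) (use s in auto)
  then show ?thesis using s assms by (simp add: levy_eq)
qed simp

text \<open>Bounding the exponential by one leaves the integral of \<open>s powr (-3/2)\<close>. For
  fixed \<open>d\<close> the mass beyond \<open>d\<close> vanishes as \<open>t\<close> tends to
  zero, which is how the subordinator is seen to concentrate at time zero.\<close>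

lemma nn_integral_levy_tail:
  assumes t: "0 < t" and d: "0 < d"
  shows "(\<integral>\<^sup>+s\<in>{d..}. ennreal (levy t s) \<partial>lborel) \<le> ennreal (t / sqrt (pi * d))"
proof -
  have i: "((\<lambda>s. s powr (-3/2)) has_integral -(d powr (-3/2 + 1)) / (-3/2 + 1)) {d..}"
    by (rule has_integral_powr_to_inf) (use d in auto)
  have "-(d powr (-3/2 + 1)) / (-3/2 + 1) = 2 / sqrt d"
    using d by (simp add: powr_minus powr_half_sqrt field_simps)
  then have i: "((\<lambda>s. if s \<in> {d..} then s powr (-3/2) else 0) has_integral 2 / sqrt d) UNIV"
    using i by (subst has_integral_restrict_UNIV) simp
  have "(\<integral>\<^sup>+s\<in>{d..}. ennreal (levy t s) \<partial>lborel)
      \<le> (\<integral>\<^sup>+s. ennreal (t / (2 * sqrt pi)) * ennreal (if s \<in> {d..} then s powr (-3/2) else 0) \<partial>lborel)"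
  proof (intro nn_integral_mono)
    fix s :: real
    show "ennreal (levy t s) * indicator {d..} s \<le> ennreal (t / (2 * sqrt pi)) * ennreal (if s \<in> {d..} then s powr (-3/2) else 0)"
    proof (cases "d \<le> s")
      case True
      then have s: "0 < s" using d by simp
      have "exp (- t\<^sup>2 / (4 * s)) \<le> 1" using s by simp
      then have "t / (2 * sqrt pi) * (exp (- t\<^sup>2 / (4 * s)) * s powr (-3/2)) \<le> t / (2 * sqrt pi) * (1 * s powr (-3/2))"
        using t by (intro mult_left_mono mult_right_mono) auto
      then show ?thesis using True s t
        by (simp add: levy_def powr_minus_divide ennreal_mult[symmetric] ennreal_leI)
    qed simp
  qed
  also have "\<dots> = ennreal (t / (2 * sqrt pi)) * (\<integral>\<^sup>+s. ennreal (if s \<in> {d..} then s powr (-3/2) else 0) \<partial>lborel)"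
    by (rule nn_integral_cmult) simp
  also have "(\<integral>\<^sup>+s. ennreal (if s \<in> {d..} then s powr (-3/2) else 0) \<partial>lborel) = ennreal (2 / sqrt d)"
    using i by (intro nn_integral_has_integral_lborel) auto
  finally show ?thesis using t d by (simp add: ennreal_mult[symmetric] real_sqrt_mult)
qed

text \<open>The mean value inequality bounds the difference quotients by \<open>w\<close>, so
  dominated convergence applies along every sequence tending to \<open>t\<close>. All hypotheses are
  local in \<open>s\<close>, because the Poisson kernels have no majorant uniform down to time
  zero.\<close>

lemma has_real_derivative_lebesgue_integral:
  fixes f f' :: "real \<Rightarrow> 'b \<Rightarrow> real"
  assumes e: "0 < e"
    and int: "\<And>s. \<bar>s - t\<bar> < e \<Longrightarrow> integrable N (f s)"
    and der: "\<And>s y. \<bar>s - t\<bar> < e \<Longrightarrow> y \<in> space N \<Longrightarrow> ((\<lambda>s. f s y) has_real_derivative f' s y) (at s)"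
    and bound: "\<And>s y. \<bar>s - t\<bar> < e \<Longrightarrow> y \<in> space N \<Longrightarrow> \<bar>f' s y\<bar> \<le> w y"
    and w: "integrable N w"
  shows "((\<lambda>s. \<integral>y. f s y \<partial>N) has_real_derivative (\<integral>y. f' t y \<partial>N)) (at t)"
  unfolding has_field_derivative_iff tendsto_at_iff_sequentially
proof (intro allI impI)
  fix X :: "nat \<Rightarrow> real" assume X: "\<forall>i. X i \<in> UNIV - {t}" "X \<longlonglongrightarrow> t"
  from X(2) e obtain n0 where n0: "\<And>n. n0 \<le> n \<Longrightarrow> \<bar>X n - t\<bar> < e"
    by (auto simp: lim_sequentially dist_real_def)
  \<comment> \<open>Dropping finitely many terms puts the whole sequence inside the window, so that
    the bounds hold for every index; \<open>LIMSEQ_offset\<close> restores the original sequence at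
    the end.\<close>
  define Y where "Y n = X (n + n0)" for n
  have Y: "\<bar>Y n - t\<bar> < e" "Y n \<noteq> t" for n using n0 X(1) by (auto simp: Y_def)
  have Ylim: "Y \<longlonglongrightarrow> t" unfolding Y_def using X(2) by (rule LIMSEQ_ignore_initial_segment)
  define q where "q n y = (f (Y n) y - f t y) / (Y n - t)" for n y
  have qi: "integrable N (q n)" for n
    unfolding q_def using int[OF Y(1)[of n]] int[of t] e by auto
  have lim: "(\<lambda>n. q n y) \<longlonglongrightarrow> f' t y" if "y \<in> space N" for y
    using der[of t y] that e Y(2) Ylim
    unfolding has_field_derivative_iff tendsto_at_iff_sequentially q_def by (auto simp: o_def)
  have qb: "\<bar>q n y\<bar> \<le> w y" if y: "y \<in> space N" for n y
  proof -
    have *: "\<bar>s - t\<bar> < e" if "s \<in> closed_segment t (Y n)" for s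
      using that Y(1)[of n] by (auto simp: closed_segment_eq_real_ivl split: if_splits)
    have "norm (f (Y n) y - f t y) \<le> w y * norm (Y n - t)"
    proof (rule field_differentiable_bound[of "closed_segment t (Y n)" "\<lambda>s. f s y" "\<lambda>s. f' s y"])
      show "((\<lambda>s. f s y) has_field_derivative f' s y) (at s within closed_segment t (Y n))"
        if "s \<in> closed_segment t (Y n)" for s
        using der[OF *[OF that] y] by (rule has_field_derivative_at_within)
    qed (use bound[OF * y] in auto)
    then show ?thesis using Y(2)[of n] by (simp add: q_def divide_simps)
  qed
  have "(\<lambda>n. \<integral>y. q n y \<partial>N) \<longlonglongrightarrow> (\<integral>y. f' t y \<partial>N)"
  proof (rule integral_dominated_convergence[where w=w])
    show "f' t \<in> borel_measurable N"
      by (rule borel_measurable_LIMSEQ_real[of _ q]) (use lim qi in auto)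
  qed (use qi lim qb w in auto)
  also have "(\<lambda>n. \<integral>y. q n y \<partial>N) = (\<lambda>n. ((\<integral>y. f (Y n) y \<partial>N) - (\<integral>y. f t y \<partial>N)) / (Y n - t))"
    unfolding q_def using int[OF Y(1)] int[of t] e by auto
  finally have "(\<lambda>n. ((\<lambda>s. ((\<integral>y. f s y \<partial>N) - (\<integral>y. f t y \<partial>N)) / (s - t)) \<circ> X) (n + n0)) \<longlonglongrightarrow> (\<integral>y. f' t y \<partial>N)"
    by (simp add: Y_def)
  then show "((\<lambda>s. ((\<integral>y. f s y \<partial>N) - (\<integral>y. f t y \<partial>N)) / (s - t)) \<circ> X) \<longlonglongrightarrow> (\<integral>y. f' t y \<partial>N)"
    by (rule LIMSEQ_offset)
qed

text \<open>Translating \<open>b = c - a\<close> and exchanging the integrals isolates the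
  convolution. In the Chapman-Kolmogorov equation \<open>F\<close> is the heat kernel, which depends
  on the two times only through their sum.\<close>

lemma nn_integral_levy_convolution_add:
  assumes [measurable]: "F \<in> borel_measurable borel" and s: "0 < s" and t: "0 < t"
  shows "(\<integral>\<^sup>+a. \<integral>\<^sup>+b. ennreal (levy s a) * (ennreal (levy t b) * F (a + b)) \<partial>lborel \<partial>lborel)
    = (\<integral>\<^sup>+c. ennreal (levy (s + t) c) * F c \<partial>lborel)"
proof -
  have "(\<integral>\<^sup>+b. ennreal (levy s a) * (ennreal (levy t b) * F (a + b)) \<partial>lborel)
     = (\<integral>\<^sup>+c. ennreal (levy s a * levy t (c - a)) * F c \<partial>lborel)" for a
  proof -
    have "(\<integral>\<^sup>+c. ennreal (levy s a * levy t (c - a)) * F c \<partial>lborel)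
       = ennreal \<bar>1\<bar> * (\<integral>\<^sup>+b. ennreal (levy s a * levy t ((a + 1 * b) - a)) * F (a + 1 * b) \<partial>lborel)"
      by (rule nn_integral_real_affine) auto
    also have "\<dots> = (\<integral>\<^sup>+b. ennreal (levy s a) * (ennreal (levy t b) * F (a + b)) \<partial>lborel)"
      using s t by (simp add: ennreal_mult levy_nonneg mult.assoc)
    finally show ?thesis by simp
  qed
  then have "(\<integral>\<^sup>+a. \<integral>\<^sup>+b. ennreal (levy s a) * (ennreal (levy t b) * F (a + b)) \<partial>lborel \<partial>lborel)
     = (\<integral>\<^sup>+a. \<integral>\<^sup>+c. ennreal (levy s a * levy t (c - a)) * F c \<partial>lborel \<partial>lborel)"
    by simp
  also have "\<dots> = (\<integral>\<^sup>+c. \<integral>\<^sup>+a. ennreal (levy s a * levy t (c - a)) * F c \<partial>lborel \<partial>lborel)"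
    by (rule lborel_pair.Fubini') measurable
  also have "\<dots> = (\<integral>\<^sup>+c. ennreal (levy (s + t) c) * F c \<partial>lborel)"
  proof (intro nn_integral_cong)
    fix c :: real
    have "(\<integral>\<^sup>+a. ennreal (levy s a * levy t (c - a)) * F c \<partial>lborel)
      = (\<integral>\<^sup>+a. ennreal (levy s a * levy t (c - a)) \<partial>lborel) * F c"
      by (rule nn_integral_multc) measurable
    also have "(\<integral>\<^sup>+a. ennreal (levy s a * levy t (c - a)) \<partial>lborel) = ennreal (levy (s + t) c)"
    proof (cases "0 < c")
      case False
      then have *: "levy s a * levy t (c - a) = 0" for a by (cases "0 < a") auto
      show ?thesis unfolding * using False by simp
    qed (use nn_integral_levy_convolution s t in auto)
    finally show "(\<integral>\<^sup>+a. ennreal (levy s a * levy t (c - a)) * F c \<partial>lborel) = ennreal (levy (s + t) c) * F c" .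
  qed
  finally show ?thesis .
qed

lemma integrable_levy: "0 < t \<Longrightarrow> integrable lborel (levy t)"
  and integral_levy: "0 < t \<Longrightarrow> (\<integral>s. levy t s \<partial>lborel) = 1"
proof -
  assume t: "0 < t"
  show i: "integrable lborel (levy t)"
    by (rule integrableI_nonneg) (use t in \<open>auto simp: levy_nonneg nn_integral_levy\<close>)
  show "(\<integral>s. levy t s \<partial>lborel) = 1"
    using nn_integral_eq_integral[OF i] t by (simp add: levy_nonneg nn_integral_levy)
qed

section \<open>Symmetric Markov kernels and the subordinated semigroup\<close>

text \<open>The last assumption replaces continuity at time zero: the mass that the kernel started at \<open>x\<close> carries to
  the other side of a generating set tends to zero.\<close>

locale markov_kernel = prob_space M for M :: "'a measure" +
  fixes G :: "real \<Rightarrow> 'a \<Rightarrow> 'a \<Rightarrow> real" and E :: "'a set set"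
  assumes measurable_G: "(\<lambda>(s, x, y). G s x y) \<in> borel_measurable (borel \<Otimes>\<^sub>M M \<Otimes>\<^sub>M M)"
    and G_nonneg: "\<lbrakk>0 < s; x \<in> space M; y \<in> space M\<rbrakk> \<Longrightarrow> 0 \<le> G s x y"
    and G_sym: "\<lbrakk>0 < s; x \<in> space M; y \<in> space M\<rbrakk> \<Longrightarrow> G s x y = G s y x"
    and G_mass: "\<lbrakk>0 < s; x \<in> space M\<rbrakk> \<Longrightarrow> (\<integral>\<^sup>+y. ennreal (G s x y) \<partial>M) = 1"
    and G_chapman: "\<lbrakk>0 < s; 0 < t; x \<in> space M; z \<in> space M\<rbrakk> \<Longrightarrow>
      (\<integral>\<^sup>+y. ennreal (G s x y) * ennreal (G t y z) \<partial>M) = ennreal (G (s + t) x z)"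
    and E_Int: "Int_stable E" and E_space: "E \<subseteq> Pow (space M)"
    and E_gen: "sets M = sigma_sets (space M) E"
    and E_cover: "\<exists>A :: nat \<Rightarrow> 'a set. range A \<subseteq> E \<and> (\<Union>i. A i) = space M"
    and G_concentrate: "B \<in> E \<Longrightarrow> AE x in M. ((\<lambda>s. \<integral>\<^sup>+y. ennreal (G s x y) *
      indicator {y \<in> space M. (y \<in> B) \<noteq> (x \<in> B)} y \<partial>M) \<longlongrightarrow> 0) (at_right 0)"
begin

lemma measurable_G'[measurable (raw)]:
  assumes "f \<in> borel_measurable N" "g \<in> measurable N M" "h \<in> measurable N M"
  shows "(\<lambda>x. G (f x) (g x) (h x)) \<in> borel_measurable N"
  using measurable_compose[OF measurable_Pair[OF assms(1) measurable_Pair[OF assms(2,3)]] measurable_G]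
  by simp

text \<open>Extended nonnegative values, because the locale gives no bound on \<open>G\<close> at
  individual points. Finiteness for almost every \<open>y\<close> follows from the total mass being
  one.\<close>

definition p :: "real \<Rightarrow> 'a \<Rightarrow> 'a \<Rightarrow> ennreal" where
  "p t x y = (\<integral>\<^sup>+s. ennreal (levy t s) * ennreal (G s x y) \<partial>lborel)"

definition \<kappa> :: "real \<Rightarrow> 'a \<Rightarrow> 'a measure" where
  "\<kappa> t x = density M (p t x)"

definition T :: "real \<Rightarrow> ('a \<Rightarrow> real) \<Rightarrow> 'a \<Rightarrow> real" where
  "T s f x = (\<integral>y. G s x y * f y \<partial>M)"

definition P :: "real \<Rightarrow> ('a \<Rightarrow> real) \<Rightarrow> 'a \<Rightarrow> real" where
  "P t f x = (\<integral>s. T s f x * levy t s \<partial>lborel)"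

definition P' :: "real \<Rightarrow> ('a \<Rightarrow> real) \<Rightarrow> 'a \<Rightarrow> real" where
  "P' t f x = (\<integral>s. T s f x * levy_dt t s \<partial>lborel)"

text \<open>The bound is demanded almost everywhere only, as for essentially bounded functions.
  Integration against a density turns it into a bound at every point, so \<open>T s f\<close>,
  \<open>P t f\<close> and \<open>P' t f\<close> are controlled pointwise.\<close>

definition bdd :: "real \<Rightarrow> ('a \<Rightarrow> real) \<Rightarrow> bool" where
  "bdd B f \<longleftrightarrow> f \<in> borel_measurable M \<and> 0 \<le> B \<and> (AE x in M. \<bar>f x\<bar> \<le> B)"

sublocale lM: pair_sigma_finite lborel M ..

lemma measurable_p[measurable (raw)]:
  assumes [measurable]: "f \<in> borel_measurable N" "g \<in> measurable N M" "h \<in> measurable N M"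
  shows "(\<lambda>x. p (f x) (g x) (h x)) \<in> borel_measurable N"
  unfolding p_def by measurable

lemma measurable_T[measurable (raw)]:
  assumes [measurable]: "f \<in> borel_measurable M" "g \<in> borel_measurable N" "h \<in> measurable N M"
  shows "(\<lambda>x. T (g x) f (h x)) \<in> borel_measurable N"
  unfolding T_def by measurable

lemma measurable_P[measurable (raw)]:
  assumes [measurable]: "f \<in> borel_measurable M" "g \<in> borel_measurable N" "h \<in> measurable N M"
  shows "(\<lambda>x. P (g x) f (h x)) \<in> borel_measurable N"
  unfolding P_def by measurable

lemma measurable_P'[measurable (raw)]:
  assumes [measurable]: "f \<in> borel_measurable M" "g \<in> borel_measurable N" "h \<in> measurable N M"
  shows "(\<lambda>x. P' (g x) f (h x)) \<in> borel_measurable N"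
  unfolding P'_def by measurable

lemma bdd_measurable[measurable_dest]: "bdd B f \<Longrightarrow> f \<in> borel_measurable M"
  by (simp add: bdd_def)

lemma p_sym:
  assumes "x \<in> space M" "y \<in> space M" shows "p t x y = p t y x"
  unfolding p_def
proof (intro nn_integral_cong)
  fix s show "ennreal (levy t s) * ennreal (G s x y) = ennreal (levy t s) * ennreal (G s y x)"
    by (cases "0 < s") (use assms G_sym[of s x y] in auto)
qed

lemma p_mass:
  assumes t: "0 < t" and x[measurable]: "x \<in> space M"
  shows "(\<integral>\<^sup>+y. p t x y \<partial>M) = 1"
proof -
  have "(\<integral>\<^sup>+y. p t x y \<partial>M) = (\<integral>\<^sup>+s. \<integral>\<^sup>+y. ennreal (levy t s) * ennreal (G s x y) \<partial>M \<partial>lborel)"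
    unfolding p_def by (rule lM.Fubini') measurable
  also have "\<dots> = (\<integral>\<^sup>+s. ennreal (levy t s) \<partial>lborel)"
  proof (intro nn_integral_cong)
    fix s :: real
    show "(\<integral>\<^sup>+y. ennreal (levy t s) * ennreal (G s x y) \<partial>M) = ennreal (levy t s)"
      using x by (cases "0 < s") (simp_all add: nn_integral_cmult G_mass)
  qed
  finally show ?thesis using t by (simp add: nn_integral_levy)
qed

text \<open>After exchanging integrals, the equation for \<open>G\<close> merges the two heat
  kernels into one at time \<open>a + b\<close>, and the convolution law of the subordinator merges
  the two weights.\<close>

lemma p_chapman:
  assumes s: "0 < s" and t: "0 < t" and x[measurable]: "x \<in> space M" and z[measurable]: "z \<in> space M"
  shows "(\<integral>\<^sup>+y. p s x y * p t y z \<partial>M) = p (s + t) x z"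
proof -
  let ?g = "\<lambda>a b y. ennreal (levy s a) * (ennreal (levy t b) * (ennreal (G a x y) * ennreal (G b y z)))"
  have "(\<integral>\<^sup>+y. p s x y * p t y z \<partial>M) = (\<integral>\<^sup>+y. \<integral>\<^sup>+a. \<integral>\<^sup>+b. ?g a b y \<partial>lborel \<partial>lborel \<partial>M)"
  proof (intro nn_integral_cong)
    fix y assume [measurable]: "y \<in> space M"
    show "p s x y * p t y z = (\<integral>\<^sup>+a. \<integral>\<^sup>+b. ?g a b y \<partial>lborel \<partial>lborel)"
    proof -
      have "p s x y * p t y z = (\<integral>\<^sup>+a. ennreal (levy s a) * ennreal (G a x y) * p t y z \<partial>lborel)"
        unfolding p_def[of s] by (rule nn_integral_multc[symmetric]) measurable
      also have "\<dots> = (\<integral>\<^sup>+a. \<integral>\<^sup>+b. ?g a b y \<partial>lborel \<partial>lborel)"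
        by (intro nn_integral_cong) (simp add: p_def[of t] nn_integral_cmult[symmetric] mult_ac)
      finally show ?thesis .
    qed
  qed
  also have "\<dots> = (\<integral>\<^sup>+a. \<integral>\<^sup>+y. \<integral>\<^sup>+b. ?g a b y \<partial>lborel \<partial>M \<partial>lborel)"
    by (rule lM.Fubini') measurable
  also have "\<dots> = (\<integral>\<^sup>+a. \<integral>\<^sup>+b. \<integral>\<^sup>+y. ?g a b y \<partial>M \<partial>lborel \<partial>lborel)"
    by (intro nn_integral_cong lM.Fubini') measurable
  also have "\<dots> = (\<integral>\<^sup>+a. \<integral>\<^sup>+b. ennreal (levy s a) * (ennreal (levy t b) * ennreal (G (a + b) x z)) \<partial>lborel \<partial>lborel)"
  proof (intro nn_integral_cong)
    fix a b :: real
    show "(\<integral>\<^sup>+y. ?g a b y \<partial>M) = ennreal (levy s a) * (ennreal (levy t b) * ennreal (G (a + b) x z))"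
      by (cases "0 < a \<and> 0 < b") (use x z in \<open>auto simp: nn_integral_cmult G_chapman not_less\<close>)
  qed
  also have "\<dots> = p (s + t) x z"
    unfolding p_def using s t by (intro nn_integral_levy_convolution_add) measurable
  finally show ?thesis .
qed

section \<open>Transition probabilities of the subordinated semigroup\<close>

lemma sets_\<kappa>[simp, measurable_cong]: "sets (\<kappa> t x) = sets M"
  and space_\<kappa>[simp]: "space (\<kappa> t x) = space M"
  by (simp_all add: \<kappa>_def)

lemma nn_integral_\<kappa>:
  assumes [measurable]: "x \<in> space M" "f \<in> borel_measurable M"
  shows "(\<integral>\<^sup>+y. f y \<partial>\<kappa> t x) = (\<integral>\<^sup>+y. p t x y * f y \<partial>M)"
  unfolding \<kappa>_def by (rule nn_integral_density) measurable

lemma prob_space_\<kappa>: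
  assumes "0 < t" "x \<in> space M" shows "prob_space (\<kappa> t x)"
proof
  have "emeasure (\<kappa> t x) (space M) = (\<integral>\<^sup>+y. 1 \<partial>\<kappa> t x)" by simp
  also have "\<dots> = 1" using assms by (subst nn_integral_\<kappa>) (auto simp: p_mass)
  finally show "emeasure (\<kappa> t x) (space (\<kappa> t x)) = 1" by simp
qed

lemma AE_\<kappa>:
  assumes [measurable]: "x \<in> space M" and "AE y in M. Q y" shows "AE y in \<kappa> t x. Q y"
  unfolding \<kappa>_def using assms(2) by (subst AE_density) auto

lemma nn_integral_\<kappa>_chapman:
  assumes s: "0 < s" and t: "0 < t" and x[measurable]: "x \<in> space M" and [measurable]: "f \<in> borel_measurable M"
  shows "(\<integral>\<^sup>+y. \<integral>\<^sup>+z. f z \<partial>\<kappa> t y \<partial>\<kappa> s x) = (\<integral>\<^sup>+z. f z \<partial>\<kappa> (s + t) x)"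
proof -
  interpret MM: pair_sigma_finite M M ..
  have "(\<integral>\<^sup>+y. \<integral>\<^sup>+z. f z \<partial>\<kappa> t y \<partial>\<kappa> s x) = (\<integral>\<^sup>+y. \<integral>\<^sup>+z. p t y z * f z \<partial>M \<partial>\<kappa> s x)"
    by (intro nn_integral_cong nn_integral_\<kappa>) auto
  also have "\<dots> = (\<integral>\<^sup>+y. p s x y * (\<integral>\<^sup>+z. p t y z * f z \<partial>M) \<partial>M)"
    by (rule nn_integral_\<kappa>) measurable
  also have "\<dots> = (\<integral>\<^sup>+y. (\<integral>\<^sup>+z. p s x y * (p t y z * f z) \<partial>M) \<partial>M)"
    by (intro nn_integral_cong nn_integral_cmult[symmetric]) measurable
  also have "\<dots> = (\<integral>\<^sup>+z. (\<integral>\<^sup>+y. p s x y * (p t y z * f z) \<partial>M) \<partial>M)"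
    by (rule MM.Fubini') measurable
  also have "\<dots> = (\<integral>\<^sup>+z. (\<integral>\<^sup>+y. p s x y * p t y z \<partial>M) * f z \<partial>M)"
    by (intro nn_integral_cong) (simp add: nn_integral_multc[symmetric] mult.assoc)
  also have "\<dots> = (\<integral>\<^sup>+z. p (s + t) x z * f z \<partial>M)"
    using s t x by (intro nn_integral_cong) (simp add: p_chapman)
  finally show ?thesis using x by (simp add: nn_integral_\<kappa>)
qed

section \<open>Heat and Poisson operators on bounded functions\<close>

lemma integrable_G:
  assumes s: "0 < s" and x: "x \<in> space M"
  shows "integrable M (G s x)" and "(\<integral>y. G s x y \<partial>M) = 1"
proof -
  have [measurable]: "x \<in> space M" by fact
  show i: "integrable M (G s x)"
    by (rule integrableI_nonneg) (use s x in \<open>auto simp: G_nonneg G_mass\<close>)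
  show "(\<integral>y. G s x y \<partial>M) = 1"
    using nn_integral_eq_integral[OF i] s x by (simp add: G_nonneg G_mass)
qed

lemma abs_T_le:
  assumes f: "bdd B f" and s: "0 < s" and x: "x \<in> space M"
  shows "\<bar>T s f x\<bar> \<le> B"
proof -
  have [measurable]: "x \<in> space M" by fact
  note [measurable] = bdd_measurable[OF f]
  have ae: "AE y in M. \<bar>G s x y * f y\<bar> \<le> G s x y * B"
    using f AE_space unfolding bdd_def
    by (auto elim!: eventually_elim2 simp: abs_mult G_nonneg s x intro!: mult_left_mono)
  have i: "integrable M (\<lambda>y. G s x y * B)" using integrable_G[OF s x] by auto
  have "\<bar>T s f x\<bar> \<le> (\<integral>y. G s x y * B \<partial>M)"
    unfolding T_def using ae
    by (intro order_trans[OF integral_abs_bound] integral_mono_AE[OF _ i])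
       (auto intro!: integrable_abs Bochner_Integration.integrable_bound[OF i] elim!: eventually_mono)
  then show ?thesis using integrable_G[OF s x] by simp
qed

lemma abs_T_levy_le:
  assumes f: "bdd B f" and t: "0 \<le> t" and x: "x \<in> space M"
  shows "\<bar>T s f x * levy t s\<bar> \<le> B * levy t s"
  using abs_T_le[OF f _ x, of s] t by (cases "0 < s") (auto simp: abs_mult levy_nonneg intro!: mult_right_mono)

lemma integrable_T_levy:
  assumes f: "bdd B f" and t: "0 < t" and x: "x \<in> space M"
  shows "integrable lborel (\<lambda>s. T s f x * levy t s)"
proof -
  have [measurable]: "x \<in> space M" by fact
  note [measurable] = bdd_measurable[OF f]
  show ?thesis
    by (rule Bochner_Integration.integrable_bound[of _ "\<lambda>s. B * levy t s"])
       (use integrable_levy[OF t] abs_T_levy_le[OF f _ x, of t] t f in \<open>auto simp: bdd_def levy_nonneg abs_mult\<close>)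
qed

lemma integrable_\<kappa>:
  assumes f: "bdd B f" and t: "0 < t" and x: "x \<in> space M"
  shows "integrable (\<kappa> t x) f"
proof -
  interpret \<kappa>: prob_space "\<kappa> t x" using t x by (rule prob_space_\<kappa>)
  note [measurable] = bdd_measurable[OF f]
  have "AE y in \<kappa> t x. \<bar>f y\<bar> \<le> B" using f by (intro AE_\<kappa> x) (auto simp: bdd_def)
  then show ?thesis by (intro \<kappa>.integrable_const_bound[of _ B]) auto
qed

text \<open>An exchange of the time and space integrals, legitimate because both kernels have mass
  one and \<open>f\<close> is bounded. Replacing \<open>p\<close> by its real part changes the
  density only where \<open>p\<close> is infinite, a null set.\<close>

lemma P_eq_integral_\<kappa>:
  assumes f: "bdd B f" and t: "0 < t" and x[measurable]: "x \<in> space M"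
  shows "P t f x = (\<integral>y. f y \<partial>\<kappa> t x)"
proof -
  note [measurable] = bdd_measurable[OF f]
  have fb: "AE y in M. \<bar>f y\<bar> \<le> B" using f by (simp add: bdd_def)
  have B: "0 \<le> B" using f by (simp add: bdd_def)
  have fin: "AE y in M. p t x y \<noteq> \<infinity>"
    by (rule nn_integral_PInf_AE) (use p_mass[OF t x] in auto)
  have inner: "ennreal (enn2real (p t x y)) = p t x y" if "p t x y \<noteq> \<infinity>" for y
    using that by (simp add: ennreal_enn2real_if)
  let ?h = "\<lambda>(s, y). levy t s * G s x y * f y"
  have int: "integrable (lborel \<Otimes>\<^sub>M M) ?h"
  proof (rule integrableI_bounded)
    have "(\<integral>\<^sup>+z. ennreal (norm (?h z)) \<partial>(lborel \<Otimes>\<^sub>M M))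
      = (\<integral>\<^sup>+s. \<integral>\<^sup>+y. ennreal (norm (?h (s, y))) \<partial>M \<partial>lborel)"
      by (subst nn_integral_fst[symmetric]) auto
    also have "\<dots> \<le> (\<integral>\<^sup>+s. ennreal (levy t s) * ennreal B \<partial>lborel)"
    proof (intro nn_integral_mono)
      fix s :: real
      show "(\<integral>\<^sup>+y. ennreal (norm (?h (s, y))) \<partial>M) \<le> ennreal (levy t s) * ennreal B"
      proof (cases "0 < s")
        case s: True
        have "(\<integral>\<^sup>+y. ennreal (norm (?h (s, y))) \<partial>M) \<le> (\<integral>\<^sup>+y. ennreal (levy t s) * ennreal B * ennreal (G s x y) \<partial>M)"
        proof (rule nn_integral_mono_AE)
          show "AE y in M. ennreal (norm (?h (s, y))) \<le> ennreal (levy t s) * ennreal B * ennreal (G s x y)"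
            using fb AE_space
          proof eventually_elim
            case (elim y)
            then have "\<bar>levy t s * G s x y * f y\<bar> \<le> levy t s * G s x y * B"
              using t s x by (simp add: abs_mult levy_nonneg G_nonneg mult_left_mono)
            then show ?case using t s x elim B
              by (simp add: ennreal_mult[symmetric] levy_nonneg G_nonneg ennreal_leI mult_ac)
          qed
        qed
        also have "\<dots> = ennreal (levy t s) * ennreal B"
          using s x by (subst nn_integral_cmult) (auto simp: G_mass)
        finally show ?thesis .
      qed simp
    qed
    also have "\<dots> < \<infinity>" using t by (subst nn_integral_multc) (auto simp: nn_integral_levy)
    finally show "(\<integral>\<^sup>+z. ennreal (norm (?h z)) \<partial>(lborel \<Otimes>\<^sub>M M)) < \<infinity>" .
  qed measurable
  have "P t f x = (\<integral>s. \<integral>y. levy t s * G s x y * f y \<partial>M \<partial>lborel)"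
    unfolding P_def T_def
    by (intro Bochner_Integration.integral_cong refl, subst mult.commute) (simp add: mult.assoc)
  also have "\<dots> = (\<integral>y. \<integral>s. levy t s * G s x y * f y \<partial>lborel \<partial>M)"
    using lM.Fubini_integral[OF int] by simp
  also have "\<dots> = (\<integral>y. enn2real (p t x y) * f y \<partial>M)"
  proof (intro Bochner_Integration.integral_cong refl)
    fix y assume y: "y \<in> space M"
    note [measurable] = y
    have nn: "0 \<le> levy t s * G s x y" for s
      using t x y by (cases "0 < s") (auto simp: levy_nonneg G_nonneg)
    have "(\<integral>s. levy t s * G s x y \<partial>lborel) = enn2real (\<integral>\<^sup>+s. ennreal (levy t s * G s x y) \<partial>lborel)"
      by (rule integral_eq_nn_integral) (use nn in auto)
    also have "(\<integral>\<^sup>+s. ennreal (levy t s * G s x y) \<partial>lborel) = p t x y"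
      unfolding p_def
    proof (intro nn_integral_cong)
      fix s show "ennreal (levy t s * G s x y) = ennreal (levy t s) * ennreal (G s x y)"
        using t x y by (cases "0 < s") (auto simp: levy_nonneg G_nonneg ennreal_mult)
    qed
    finally show "(\<integral>s. levy t s * G s x y * f y \<partial>lborel) = enn2real (p t x y) * f y" by simp
  qed
  also have "\<dots> = (\<integral>y. f y \<partial>density M (\<lambda>y. ennreal (enn2real (p t x y))))"
    by (subst integral_density) auto
  also have "density M (\<lambda>y. ennreal (enn2real (p t x y))) = \<kappa> t x"
    unfolding \<kappa>_def by (rule density_cong) (use fin in \<open>auto simp: inner elim!: eventually_mono\<close>)
  finally show ?thesis .
qed

lemma abs_P_le:
  assumes f: "bdd B f" and t: "0 < t" and x: "x \<in> space M"
  shows "\<bar>P t f x\<bar> \<le> B"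
proof -
  have "\<bar>P t f x\<bar> \<le> (\<integral>s. B * levy t s \<partial>lborel)"
    unfolding P_def
    using integrable_T_levy[OF f t x] integrable_levy[OF t] abs_T_levy_le[OF f _ x, of t] t
    by (intro order_trans[OF integral_abs_bound] integral_mono) auto
  then show ?thesis using t by (simp add: integral_levy)
qed

lemma bdd_P: "bdd B f \<Longrightarrow> 0 < t \<Longrightarrow> bdd B (P t f)"
  unfolding bdd_def[of B "P t f"] using abs_P_le[of B f t] by (auto simp: bdd_def[of B f])

text \<open>Adding the bound makes the integrand nonnegative almost everywhere. The identity
  \<open>nn_integral_\<kappa>_chapman\<close> for nonnegative integrals then passes to signed
  bounded functions simply by cancelling \<open>B\<close>.\<close>

lemma P_shift:
  assumes f: "bdd B f" and t: "0 < t" and x: "x \<in> space M"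
  shows "ennreal (P t f x + B) = (\<integral>\<^sup>+y. ennreal (f y + B) \<partial>\<kappa> t x)"
proof -
  interpret \<kappa>: prob_space "\<kappa> t x" using t x by (rule prob_space_\<kappa>)
  have "AE y in \<kappa> t x. \<bar>f y\<bar> \<le> B" using f by (intro AE_\<kappa> x) (auto simp: bdd_def)
  then have ae: "AE y in \<kappa> t x. 0 \<le> f y + B" by eventually_elim auto
  have "(\<integral>\<^sup>+y. ennreal (f y + B) \<partial>\<kappa> t x) = ennreal (\<integral>y. f y + B \<partial>\<kappa> t x)"
    using ae by (intro nn_integral_eq_integral) (use integrable_\<kappa>[OF f t x] in auto)
  also have "(\<integral>y. f y + B \<partial>\<kappa> t x) = P t f x + B"
    using integrable_\<kappa>[OF f t x] by (simp add: P_eq_integral_\<kappa>[OF f t x] \<kappa>.prob_space[simplified])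
  finally show ?thesis ..
qed

lemma P_semigroup:
  assumes f: "bdd B f" and s: "0 < s" and t: "0 < t" and x: "x \<in> space M"
  shows "P s (P t f) x = P (s + t) f x"
proof -
  note [measurable] = bdd_measurable[OF f]
  have "ennreal (P s (P t f) x + B) = (\<integral>\<^sup>+y. ennreal (P t f y + B) \<partial>\<kappa> s x)"
    using bdd_P[OF f t] s x by (rule P_shift)
  also have "\<dots> = (\<integral>\<^sup>+y. \<integral>\<^sup>+z. ennreal (f z + B) \<partial>\<kappa> t y \<partial>\<kappa> s x)"
    by (intro nn_integral_cong P_shift[OF f t]) simp
  also have "\<dots> = (\<integral>\<^sup>+z. ennreal (f z + B) \<partial>\<kappa> (s + t) x)"
    using s t x by (rule nn_integral_\<kappa>_chapman) measurable
  also have "\<dots> = ennreal (P (s + t) f x + B)"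
    by (rule P_shift[symmetric]) (use f s t x in auto)
  finally show ?thesis
    using abs_P_le[OF bdd_P[OF f t] s x] abs_P_le[OF f, of "s + t" x] s t x
    by (subst (asm) ennreal_inj) (auto simp: abs_le_iff)
qed

section \<open>Time derivative of the Poisson semigroup\<close>

lemma abs_T_levy_dt_le:
  assumes f: "bdd B f" and t: "0 < t" and x: "x \<in> space M"
  shows "\<bar>T s f x * levy_dt t s\<bar> \<le> 8 * B / t * levy (t / 2) s"
proof (cases "0 < s")
  case True
  have "\<bar>T s f x * levy_dt t s\<bar> \<le> B * (8 / t * levy (t / 2) s)"
    unfolding abs_mult by (intro mult_mono abs_T_le[OF f True x] abs_levy_dt_le t) (use f in \<open>auto simp: bdd_def\<close>)
  then show ?thesis by (simp add: mult_ac)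
qed (simp add: levy_dt_def)

lemma P_has_derivative:
  assumes f: "bdd B f" and t: "0 < t" and x: "x \<in> space M"
  shows "((\<lambda>t. P t f x) has_real_derivative P' t f x) (at t)"
  unfolding P_def P'_def
\<comment> \<open>For \<open>r\<close> between \<open>t / 2\<close> and \<open>3 * t / 2\<close> the
  half time \<open>r / 2\<close> lies between \<open>t / 4\<close> and \<open>3 * t / 4\<close>, so
  \<open>levy_mono_scale\<close> costs a factor 3 over the density at \<open>t / 4\<close>;
  \<open>8 * B / r\<close> is at most \<open>16 * B / t\<close>, and the product of the two
  constants is 48.\<close>
proof (rule has_real_derivative_lebesgue_integral[where e="t/2" and w="\<lambda>s. 48 * B / t * levy (t / 4) s"])
  fix r assume "\<bar>r - t\<bar> < t / 2"
  then have r: "t / 2 < r" "r < 3 * t / 2" unfolding abs_if by (auto split: if_splits)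
  then have r0: "0 < r" using t by simp
  show "integrable lborel (\<lambda>s. T s f x * levy r s)"
    by (rule integrable_T_levy[OF f r0 x])
  fix s :: real
  show "((\<lambda>r. T s f x * levy r s) has_real_derivative T s f x * levy_dt r s) (at r)"
    using r0 by (intro DERIV_cmult has_field_derivative_levy) simp
  have B: "0 \<le> B" using f by (simp add: bdd_def)
  have "\<bar>T s f x * levy_dt r s\<bar> \<le> 8 * B / r * levy (r / 2) s"
    by (rule abs_T_levy_dt_le[OF f r0 x])
  also have "\<dots> \<le> 16 * B / t * (3 * levy (t / 4) s)"
  proof (intro mult_mono)
    have "B / r \<le> B / (t / 2)" using B r t by (intro divide_left_mono) auto
    then show "8 * B / r \<le> 16 * B / t" by simp
    show "levy (r / 2) s \<le> 3 * levy (t / 4) s"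
      using levy_mono_scale[of "t/4" "r/2" "3*t/4" s] r t by simp
  qed (use B t r0 in \<open>auto simp: levy_nonneg\<close>)
  finally show "\<bar>T s f x * levy_dt r s\<bar> \<le> 48 * B / t * levy (t / 4) s" by simp
qed (use t integrable_levy[of "t/4"] in auto)

lemma abs_P'_le:
  assumes f: "bdd B f" and t: "0 < t" and x: "x \<in> space M"
  shows "\<bar>P' t f x\<bar> \<le> 8 * B / t"
proof -
  note [measurable] = bdd_measurable[OF f] x
  have i: "integrable lborel (\<lambda>s. 8 * B / t * levy (t / 2) s)"
    using integrable_levy[of "t/2"] t by auto
  have "integrable lborel (\<lambda>s. T s f x * levy_dt t s)"
    by (rule Bochner_Integration.integrable_bound[OF i])
       (use abs_T_levy_dt_le[OF f t x] in \<open>auto intro!: AE_I2 order_trans[OF _ abs_ge_self] simp del: abs_mult abs_divide\<close>)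
  then have "\<bar>P' t f x\<bar> \<le> (\<integral>s. 8 * B / t * levy (t / 2) s \<partial>lborel)"
    unfolding P'_def using abs_T_levy_dt_le[OF f t x]
    by (intro order_trans[OF integral_abs_bound] integral_mono i) auto
  then show ?thesis using t by (simp add: integral_levy)
qed

lemma bdd_P': "bdd B f \<Longrightarrow> 0 < t \<Longrightarrow> bdd (8 * B / t) (P' t f)"
  unfolding bdd_def[of _ "P' t f"] using abs_P'_le[of B f t] by (auto simp: bdd_def[of B f])

text \<open>The semigroup law is differentiated in \<open>b\<close> on both sides. On the right the
  derivative passes under the integral against \<open>\<kappa> a x\<close>: this is a probability
  measure, so a constant dominates as long as \<open>r\<close> stays above
  \<open>b / 2\<close>.\<close>

lemma P'_add:
  assumes f: "bdd B f" and a: "0 < a" and b: "0 < b" and x: "x \<in> space M"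
  shows "P' (a + b) f x = P a (P' b f) x"
proof -
  interpret \<kappa>: prob_space "\<kappa> a x" using a x by (rule prob_space_\<kappa>)
  have "((\<lambda>b. P (a + b) f x) has_real_derivative P' (a + b) f x * 1) (at b)"
    by (rule DERIV_chain'[where g="\<lambda>b. P b f x"])
       (use P_has_derivative[OF f _ x, of "a + b"] a b in \<open>auto intro!: derivative_eq_intros\<close>)
  moreover have "((\<lambda>b. \<integral>y. P b f y \<partial>\<kappa> a x) has_real_derivative (\<integral>y. P' b f y \<partial>\<kappa> a x)) (at b)"
  proof (rule has_real_derivative_lebesgue_integral[where e="b/2" and w="\<lambda>_. 16 * B / b"])
    fix r assume "\<bar>r - b\<bar> < b / 2"
    then have r: "b / 2 < r" unfolding abs_if by (auto split: if_splits)
    then have r0: "0 < r" using b by simp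
    show "integrable (\<kappa> a x) (P r f)" by (rule integrable_\<kappa>[OF bdd_P[OF f r0] a x])
    fix y assume "y \<in> space (\<kappa> a x)"
    then have y: "y \<in> space M" by simp
    show "((\<lambda>r. P r f y) has_real_derivative P' r f y) (at r)" by (rule P_has_derivative[OF f r0 y])
    have "B / r \<le> B / (b / 2)" using f r b by (intro divide_left_mono) (auto simp: bdd_def)
    then show "\<bar>P' r f y\<bar> \<le> 16 * B / b" using abs_P'_le[OF f r0 y] by simp
  qed (use b in auto)
  then have "((\<lambda>b. P (a + b) f x) has_real_derivative (\<integral>y. P' b f y \<partial>\<kappa> a x)) (at b)"
  proof (rule DERIV_cong_ev[THEN iffD1, rotated -1])
    have "eventually (\<lambda>r. 0 < r) (nhds b)" using b eventually_nhds_in_open[of "{0<..}" b] by auto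
    then show "eventually (\<lambda>r. (\<integral>y. P r f y \<partial>\<kappa> a x) = P (a + r) f x) (nhds b)"
      by eventually_elim (use P_eq_integral_\<kappa>[OF bdd_P[OF f] a x] P_semigroup[OF f a _ x] in auto)
  qed auto
  ultimately show ?thesis
    using DERIV_unique P_eq_integral_\<kappa>[OF bdd_P'[OF f b] a x] by fastforce
qed

end

section \<open>Boundary values at time zero\<close>

text \<open>The two pieces meet at \<open>t = s\<close>: near zero \<open>\<gamma> > l\<close> gives
  convergence, at infinity \<open>l > 0\<close> does. With \<open>\<gamma> = \<beta>\<close> and
  \<open>s = 1\<close> it bounds the fractional derivative itself; with \<open>\<gamma> = 1\<close>
  it bounds its increments and supplies the gain \<open>s powr (- l)\<close>.\<close>

lemma powr_min_integral:
  fixes l \<gamma> s :: real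
  assumes l: "0 < l" "l < \<gamma>" and s: "0 < s"
  shows "has_bochner_integral lborel
     (\<lambda>t. indicator {0<..} t * (t powr (- l - 1) * min 1 ((t / s) powr \<gamma>))) (s powr (- l) * (1 / (\<gamma> - l) + 1 / l))"
proof -
  let ?h = "\<lambda>t. indicator {0<..} t * (t powr (- l - 1) * min 1 ((t / s) powr \<gamma>))"
  have "((\<lambda>t. s powr (- \<gamma>) * t powr (\<gamma> - l - 1)) has_integral s powr (- \<gamma>) * (s powr (\<gamma> - l - 1 + 1) / (\<gamma> - l - 1 + 1))) {0..s}"
    using l s by (intro has_integral_mult_right has_integral_powr_from_0) auto
  moreover have "s powr (- \<gamma>) * (s powr (\<gamma> - l - 1 + 1) / (\<gamma> - l - 1 + 1)) = s powr (- l) / (\<gamma> - l)"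
    by (simp add: powr_add[symmetric])
  ultimately have 1: "((\<lambda>t. s powr (- \<gamma>) * t powr (\<gamma> - l - 1)) has_integral s powr (- l) / (\<gamma> - l)) {0..s}"
    by (simp only:)
  have 1: "(?h has_integral s powr (- l) / (\<gamma> - l)) {0..s}"
  proof (rule has_integral_eq[OF _ 1])
    fix t assume t: "t \<in> {0..s}"
    show "s powr (- \<gamma>) * t powr (\<gamma> - l - 1) = ?h t"
    proof (cases "t = 0")
      case False
      then have t0: "0 < t" "t / s \<le> 1" using t s by auto
      then have "(t / s) powr \<gamma> \<le> 1" using l s by (intro powr_le1) auto
      then have "?h t = t powr (- l - 1) * (t / s) powr \<gamma>" using t0 by simp
      also have "\<dots> = s powr (- \<gamma>) * t powr (\<gamma> - l - 1)"
      proof -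
        have "t powr (- l - 1) * t powr \<gamma> = t powr (\<gamma> - l - 1)"
          by (simp add: powr_add[symmetric] algebra_simps)
        then show ?thesis using t0 s by (simp add: powr_divide powr_minus field_simps)
      qed
      finally show ?thesis by simp
    qed simp
  qed
  have "((\<lambda>t. t powr (- l - 1)) has_integral - (s powr (- l - 1 + 1)) / (- l - 1 + 1)) {s..}"
    using l s by (intro has_integral_powr_to_inf) auto
  then have 2: "((\<lambda>t. t powr (- l - 1)) has_integral s powr (- l) / l) {s..}" by simp
  have 2: "(?h has_integral s powr (- l) / l) {s..}"
  proof (rule has_integral_eq[OF _ 2])
    fix t assume t: "t \<in> {s..}"
    then have "1 \<le> (t / s) powr \<gamma>" using s l by (intro ge_one_powr_ge_zero) auto
    then show "t powr (- l - 1) = ?h t" using t s by simp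
  qed
  have "(?h has_integral s powr (- l) / (\<gamma> - l) + s powr (- l) / l) ({0..s} \<union> {s..})"
  proof (rule has_integral_Un[OF 1 2])
    show "negligible ({0..s} \<inter> {s..})"
      using s by (intro negligible_subset[OF negligible_sing[of s]]) auto
  qed
  then have "((\<lambda>t. if t \<in> {0..s} \<union> {s..} then ?h t else 0) has_integral s powr (- l) / (\<gamma> - l) + s powr (- l) / l) UNIV"
    by (simp only: has_integral_restrict_UNIV)
  also have "(\<lambda>t. if t \<in> {0..s} \<union> {s..} then ?h t else 0) = ?h"
    using s by (auto simp: fun_eq_iff)
  finally have hi: "(?h has_integral s powr (- l) * (1 / (\<gamma> - l) + 1 / l)) UNIV"
    by (simp add: distrib_left)
  show ?thesis
    by (rule has_bochner_integral_nn_integral)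
       (use nn_integral_has_integral_lborel[OF _ _ hi] l s in \<open>auto intro!: mult_nonneg_nonneg add_nonneg_nonneg\<close>)
qed

text \<open>One-sided quotients suffice once the derivative exists. Looking only to the right of
  \<open>s\<close> means that negative powers of the time are largest at \<open>s\<close>, so a
  single constant covers all the increments.\<close>

lemma deriv_le_of_right_lipschitz:
  fixes u :: "real \<Rightarrow> real"
  assumes d: "(u has_real_derivative D) (at s)"
    and lip: "\<And>r. s < r \<Longrightarrow> \<bar>u r - u s\<bar> \<le> L * (r - s)"
  shows "\<bar>D\<bar> \<le> L"
proof -
  have "((\<lambda>r. (u r - u s) / (r - s)) \<longlongrightarrow> D) (at_right s)"
    using has_field_derivative_at_within[OF d] unfolding has_field_derivative_iff .
  then have "((\<lambda>r. \<bar>(u r - u s) / (r - s)\<bar>) \<longlongrightarrow> \<bar>D\<bar>) (at_right s)"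
    by (rule tendsto_rabs)
  then show ?thesis
  proof (rule tendsto_upperbound)
    show "\<forall>\<^sub>F r in at_right s. \<bar>(u r - u s) / (r - s)\<bar> \<le> L"
      using eventually_at_right_less[of s] by eventually_elim (use lip in \<open>auto simp: field_simps\<close>)
  qed simp
qed

lemma half_powr_le:
  fixes t \<beta> :: real
  assumes "0 < t" "0 < \<beta>" "\<beta> < 1"
  shows "(t / 2) powr (\<beta> - 1) \<le> 2 * t powr (\<beta> - 1)"
proof -
  have "(t / 2) powr (\<beta> - 1) = t powr (\<beta> - 1) * 2 powr (1 - \<beta>)"
    using assms by (simp add: powr_divide powr_diff)
  also have "\<dots> \<le> t powr (\<beta> - 1) * 2 powr 1"
    using assms by (intro mult_left_mono powr_mono) auto
  finally show ?thesis by simp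
qed

lemma one_minus_exp_le: "0 < t \<Longrightarrow> 1 - exp (- t) \<le> min 1 t" for t :: real
  using exp_ge_add_one_self[of "- t"] exp_gt_zero[of "-t"] by simp

context markov_kernel
begin

text \<open>The time integral is split at \<open>d\<close>. Before \<open>d\<close> the heat kernel
  carries little mass to \<open>D\<close> by hypothesis; after \<open>d\<close> the subordinator
  itself carries little mass, by \<open>nn_integral_levy_tail\<close>.\<close>

lemma measure_\<kappa>_tendsto:
  assumes D: "D \<in> sets M" and x: "x \<in> space M"
    and lim: "((\<lambda>s. \<integral>\<^sup>+y. ennreal (G s x y) * indicator D y \<partial>M) \<longlongrightarrow> 0) (at_right 0)"
  shows "((\<lambda>t. measure (\<kappa> t x) D) \<longlongrightarrow> 0) (at_right 0)"
proof (rule tendstoI)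
  fix e :: real assume e: "0 < e"
  note [measurable] = D x
  have "\<forall>\<^sub>F s in at_right 0. (\<integral>\<^sup>+y. ennreal (G s x y) * indicator D y \<partial>M) < ennreal (e / 4)"
    using e by (intro order_tendstoD(2)[OF lim]) simp
  then obtain d where d: "0 < d" and phi: "\<And>s. 0 < s \<Longrightarrow> s < d \<Longrightarrow>
      (\<integral>\<^sup>+y. ennreal (G s x y) * indicator D y \<partial>M) < ennreal (e / 4)"
    unfolding eventually_at_right_field by auto
  have "((\<lambda>t. t / sqrt (pi * d)) \<longlongrightarrow> 0 / sqrt (pi * d)) (at_right 0)"
    using d by (intro tendsto_intros) auto
  then have "\<forall>\<^sub>F t in at_right 0. t / sqrt (pi * d) < e / 4"
    using e by (intro order_tendstoD(2)) auto
  then show "\<forall>\<^sub>F t in at_right 0. dist (measure (\<kappa> t x) D) 0 < e"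
    using eventually_at_right_less[of "0::real"]
  proof eventually_elim
    case (elim t)
    then have t: "0 < t" by simp
    interpret \<kappa>: prob_space "\<kappa> t x" using t x by (rule prob_space_\<kappa>)
    have "emeasure (\<kappa> t x) D = (\<integral>\<^sup>+y. indicator D y \<partial>\<kappa> t x)" by simp
    also have "\<dots> = (\<integral>\<^sup>+y. p t x y * indicator D y \<partial>M)" by (rule nn_integral_\<kappa>) measurable
    also have "\<dots> = (\<integral>\<^sup>+y. \<integral>\<^sup>+s. ennreal (levy t s) * (ennreal (G s x y) * indicator D y) \<partial>lborel \<partial>M)"
      unfolding p_def
      by (intro nn_integral_cong, subst nn_integral_multc[symmetric]) (auto simp: mult_ac)
    also have "\<dots> = (\<integral>\<^sup>+s. \<integral>\<^sup>+y. ennreal (levy t s) * (ennreal (G s x y) * indicator D y) \<partial>M \<partial>lborel)"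
      by (rule lM.Fubini') measurable
    also have "\<dots> \<le> (\<integral>\<^sup>+s. ennreal (e / 4) * ennreal (levy t s) + ennreal (levy t s) * indicator {d..} s \<partial>lborel)"
    proof (intro nn_integral_mono)
      fix s :: real
      have "(\<integral>\<^sup>+y. ennreal (levy t s) * (ennreal (G s x y) * indicator D y) \<partial>M)
          = ennreal (levy t s) * (\<integral>\<^sup>+y. ennreal (G s x y) * indicator D y \<partial>M)"
        by (rule nn_integral_cmult) measurable
      also have "\<dots> \<le> ennreal (e / 4) * ennreal (levy t s) + ennreal (levy t s) * indicator {d..} s"
      proof -
        consider "s \<le> 0" | "0 < s" "s < d" | "0 < s" "d \<le> s" by linarith
        then show ?thesis
        proof cases
          case 2
          then have "ennreal (levy t s) * (\<integral>\<^sup>+y. ennreal (G s x y) * indicator D y \<partial>M) \<le> ennreal (levy t s) * ennreal (e / 4)"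
            using phi[of s] by (intro mult_left_mono) auto
          then show ?thesis using 2 by (simp add: mult.commute)
        next
          case 3
          have "(\<integral>\<^sup>+y. ennreal (G s x y) * indicator D y \<partial>M) \<le> (\<integral>\<^sup>+y. ennreal (G s x y) \<partial>M)"
            by (intro nn_integral_mono) (auto simp: indicator_def)
          also have "\<dots> = 1" using 3 x by (simp add: G_mass)
          finally have "ennreal (levy t s) * (\<integral>\<^sup>+y. ennreal (G s x y) * indicator D y \<partial>M) \<le> ennreal (levy t s) * 1"
            by (intro mult_left_mono) auto
          also have "\<dots> \<le> ennreal (e / 4) * ennreal (levy t s) + ennreal (levy t s)"
            by (simp add: add_increasing)
          finally show ?thesis using 3 by simp
        qed simp
      qed
      finally show "(\<integral>\<^sup>+y. ennreal (levy t s) * (ennreal (G s x y) * indicator D y) \<partial>M)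
         \<le> ennreal (e / 4) * ennreal (levy t s) + ennreal (levy t s) * indicator {d..} s" .
    qed
    also have "\<dots> = ennreal (e / 4) + (\<integral>\<^sup>+s\<in>{d..}. ennreal (levy t s) \<partial>lborel)"
      using t by (subst nn_integral_add) (auto simp: nn_integral_cmult nn_integral_levy)
    also have "\<dots> \<le> ennreal (e / 4) + ennreal (t / sqrt (pi * d))"
      using t d by (intro add_left_mono nn_integral_levy_tail)
    also have "\<dots> \<le> ennreal (e / 4) + ennreal (e / 4)"
      using elim by (intro add_left_mono ennreal_leI) auto
    also have "\<dots> = ennreal (e / 2)" using e by (simp flip: ennreal_plus)
    finally have "measure (\<kappa> t x) D \<le> e / 2"
      using e by (simp add: \<kappa>.emeasure_eq_measure)
    then show ?case using e by simp
  qed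
qed

lemma measure_\<kappa>_indicator:
  assumes C: "C \<in> E"
  shows "AE x in M. ((\<lambda>t. measure (\<kappa> t x) C) \<longlongrightarrow> indicator C x) (at_right 0)"
  using G_concentrate[OF C] AE_space
proof eventually_elim
  case (elim x)
  have CM[measurable]: "C \<in> sets M" using C E_gen by auto
  define D where "D = {y \<in> space M. (y \<in> C) \<noteq> (x \<in> C)}"
  have D: "D \<in> sets M" unfolding D_def by measurable
  have lim: "((\<lambda>t. measure (\<kappa> t x) D) \<longlongrightarrow> 0) (at_right 0)"
    using measure_\<kappa>_tendsto[OF D elim(2)] elim(1) by (simp add: D_def)
  show ?case
  proof (cases "x \<in> C")
    case False
    then have "D = C" using sets.sets_into_space[OF CM] by (auto simp: D_def)
    then show ?thesis using lim False by simp
  next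
    case True
    then have DC: "D = space M - C" by (auto simp: D_def)
    have "((\<lambda>t. 1 - measure (\<kappa> t x) D) \<longlongrightarrow> 1 - 0) (at_right 0)"
      by (intro tendsto_intros lim)
    moreover have "\<forall>\<^sub>F t in at_right 0. 1 - measure (\<kappa> t x) D = measure (\<kappa> t x) C"
      using eventually_at_right_less[of "0::real"]
    proof eventually_elim
      case (elim t)
      interpret \<kappa>: prob_space "\<kappa> t x" using elim \<open>x \<in> space M\<close> by (rule prob_space_\<kappa>)
      show ?case using \<kappa>.prob_compl[of C] by (simp add: DC)
    qed
    ultimately show ?thesis using True by (simp add: tendsto_cong)
  qed
qed

lemma measurable_measure_\<kappa>:
  assumes t: "0 < t" and [measurable]: "C \<in> sets M"
  shows "(\<lambda>y. measure (\<kappa> t y) C) \<in> borel_measurable M"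
proof -
  have "measure (\<kappa> t y) C = enn2real (\<integral>\<^sup>+x. p t y x * indicator C x \<partial>M)" if y: "y \<in> space M" for y
    using y nn_integral_\<kappa>[OF y, of "indicator C" t] by (simp add: measure_def)
  then show ?thesis by (subst measurable_cong) measurable
qed

text \<open>Symmetry of \<open>p\<close> moves the semigroup from \<open>f\<close> onto the
  indicator. The shift by \<open>B\<close> makes this an exchange of nonnegative integrals.\<close>

lemma integral_P_indicator:
  assumes f: "bdd B f" and t: "0 < t" and C[measurable]: "C \<in> sets M"
  shows "(\<integral>x. (P t f x + B) * indicator C x \<partial>M) = (\<integral>y. (f y + B) * measure (\<kappa> t y) C \<partial>M)"
proof -
  note [measurable] = bdd_measurable[OF f]
  have fb: "AE y in M. 0 \<le> f y + B"
    using f unfolding bdd_def by (auto elim!: eventually_mono)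
  have Pb: "0 \<le> P t f x + B" if "x \<in> space M" for x
    using abs_P_le[OF f t that] by linarith
  interpret MM: pair_sigma_finite M M ..
  have em: "ennreal (measure (\<kappa> t y) C) = (\<integral>\<^sup>+x. p t y x * indicator C x \<partial>M)" if y: "y \<in> space M" for y
  proof -
    interpret \<kappa>: prob_space "\<kappa> t y" using t y by (rule prob_space_\<kappa>)
    show ?thesis using nn_integral_\<kappa>[OF y, of "indicator C" t] by (simp add: \<kappa>.emeasure_eq_measure)
  qed
  note [measurable] = measurable_measure_\<kappa>[OF t C]
  have "(\<integral>x. (P t f x + B) * indicator C x \<partial>M) = enn2real (\<integral>\<^sup>+x. ennreal ((P t f x + B) * indicator C x) \<partial>M)"
    using Pb by (intro integral_eq_nn_integral) (auto simp: indicator_def intro!: AE_I2)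
  also have "(\<integral>\<^sup>+x. ennreal ((P t f x + B) * indicator C x) \<partial>M)
     = (\<integral>\<^sup>+x. \<integral>\<^sup>+y. p t x y * (ennreal (f y + B) * indicator C x) \<partial>M \<partial>M)"
  proof (intro nn_integral_cong)
    fix x assume x: "x \<in> space M"
    note [measurable] = x
    have "ennreal ((P t f x + B) * indicator C x) = (\<integral>\<^sup>+y. p t x y * ennreal (f y + B) \<partial>M) * indicator C x"
      using P_shift[OF f t x] by (simp add: indicator_def nn_integral_\<kappa> x)
    also have "\<dots> = (\<integral>\<^sup>+y. p t x y * ennreal (f y + B) * indicator C x \<partial>M)"
      by (rule nn_integral_multc[symmetric]) measurable
    finally show "ennreal ((P t f x + B) * indicator C x) = (\<integral>\<^sup>+y. p t x y * (ennreal (f y + B) * indicator C x) \<partial>M)"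
      by (simp add: mult.assoc)
  qed
  also have "\<dots> = (\<integral>\<^sup>+y. \<integral>\<^sup>+x. p t x y * (ennreal (f y + B) * indicator C x) \<partial>M \<partial>M)"
    by (rule MM.Fubini') measurable
  also have "\<dots> = (\<integral>\<^sup>+y. ennreal ((f y + B) * measure (\<kappa> t y) C) \<partial>M)"
  proof (rule nn_integral_cong_AE)
    show "AE y in M. (\<integral>\<^sup>+x. p t x y * (ennreal (f y + B) * indicator C x) \<partial>M) = ennreal ((f y + B) * measure (\<kappa> t y) C)"
      using fb AE_space
    proof eventually_elim
      case (elim y)
      note [measurable] = elim(2)
      have "(\<integral>\<^sup>+x. p t x y * (ennreal (f y + B) * indicator C x) \<partial>M) = (\<integral>\<^sup>+x. ennreal (f y + B) * (p t y x * indicator C x) \<partial>M)"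
        using elim by (intro nn_integral_cong) (simp add: p_sym mult_ac)
      also have "\<dots> = ennreal (f y + B) * ennreal (measure (\<kappa> t y) C)"
        unfolding em[OF elim(2)] by (rule nn_integral_cmult) measurable
      finally show ?case using elim by (simp add: ennreal_mult)
    qed
  qed
  also have "enn2real \<dots> = (\<integral>y. (f y + B) * measure (\<kappa> t y) C \<partial>M)"
    by (rule integral_eq_nn_integral[symmetric]) (use fb in \<open>auto elim!: eventually_mono\<close>)
  finally show ?thesis .
qed

text \<open>By symmetry of the kernel, integrating \<open>P t f\<close> over a generating set is the same as integrating \<open>f\<close>
  against the action of \<open>P t\<close> on its indicator, which converges almost everywhere.\<close>

lemma P_limit_AE_eq:
  assumes f: "bdd B f"
    and lim: "\<And>x. x \<in> space M \<Longrightarrow> (\<lambda>n. P (1 / real (Suc n)) f x) \<longlonglongrightarrow> v x"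
  shows "AE x in M. v x = f x"
proof -
  note [measurable] = bdd_measurable[OF f]
  have [measurable]: "v \<in> borel_measurable M"
    by (rule borel_measurable_LIMSEQ_real[OF lim]) auto
  have vb: "\<bar>v x\<bar> \<le> B" if x: "x \<in> space M" for x
    by (rule tendsto_upperbound[OF tendsto_rabs[OF lim[OF x]]]) (use abs_P_le[OF f _ x] in auto)
  have fb: "AE x in M. \<bar>f x\<bar> \<le> B" and B: "0 \<le> B" using f by (auto simp: bdd_def)
  have r: "filterlim (\<lambda>n. 1 / real (Suc n)) (at_right 0) sequentially"
    by (rule filterlim_at_withinI) (use LIMSEQ_Suc[OF lim_1_over_n] in \<open>auto simp: field_simps\<close>)
  have eq: "(\<integral>x. (v x + B) * indicator C x \<partial>M) = (\<integral>x. (f x + B) * indicator C x \<partial>M)" if C: "C \<in> E" for C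
  proof (rule LIMSEQ_unique)
    have [measurable]: "C \<in> sets M" using C E_gen by auto
    show "(\<lambda>n. \<integral>x. (P (1 / real (Suc n)) f x + B) * indicator C x \<partial>M) \<longlonglongrightarrow> (\<integral>x. (v x + B) * indicator C x \<partial>M)"
    proof (rule integral_dominated_convergence[where w="\<lambda>_. 2 * B"])
      show "AE x in M. (\<lambda>n. (P (1 / real (Suc n)) f x + B) * indicator C x) \<longlonglongrightarrow> (v x + B) * indicator C x"
        by (intro AE_I2 tendsto_intros lim)
      show "AE x in M. norm ((P (1 / real (Suc n)) f x + B) * indicator C x) \<le> 2 * B" for n
      proof (rule AE_I2)
        fix x assume "x \<in> space M"
        then have "\<bar>P (1 / real (Suc n)) f x + B\<bar> \<le> 2 * B"
          using abs_P_le[OF f, of "1 / real (Suc n)" x] B by (simp del: of_nat_Suc)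
        then show "norm ((P (1 / real (Suc n)) f x + B) * indicator C x) \<le> 2 * B"
          using B by (simp add: indicator_def)
      qed
    qed auto
    have "(\<lambda>n. \<integral>y. (f y + B) * measure (\<kappa> (1 / real (Suc n)) y) C \<partial>M) \<longlonglongrightarrow> (\<integral>x. (f x + B) * indicator C x \<partial>M)"
    proof (rule integral_dominated_convergence[where w="\<lambda>_. 2 * B"])
      show "AE x in M. (\<lambda>n. (f x + B) * measure (\<kappa> (1 / real (Suc n)) x) C) \<longlonglongrightarrow> (f x + B) * indicator C x"
        using measure_\<kappa>_indicator[OF C]
        by eventually_elim (intro tendsto_intros, rule filterlim_compose[OF _ r])
      show "(\<lambda>y. (f y + B) * measure (\<kappa> (1 / real (Suc n)) y) C) \<in> borel_measurable M" for n
        using measurable_measure_\<kappa>[of "1 / real (Suc n)" C] by measurable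
      show "AE x in M. norm ((f x + B) * measure (\<kappa> (1 / real (Suc n)) x) C) \<le> 2 * B" for n
        using fb AE_space
      proof eventually_elim
        case (elim x)
        interpret \<kappa>: prob_space "\<kappa> (1 / real (Suc n)) x" using elim by (intro prob_space_\<kappa>) auto
        have "\<bar>f x + B\<bar> * measure (\<kappa> (1 / real (Suc n)) x) C \<le> (2 * B) * 1"
          using elim B by (intro mult_mono \<kappa>.prob_le_1) auto
        then show ?case by (simp add: abs_mult)
      qed
    qed auto
    then show "(\<lambda>n. \<integral>x. (P (1 / real (Suc n)) f x + B) * indicator C x \<partial>M) \<longlonglongrightarrow> (\<integral>x. (f x + B) * indicator C x \<partial>M)"
      by (subst integral_P_indicator[OF f]) auto
  qed
  have em: "emeasure (density M (\<lambda>x. ennreal (w x + B))) C = ennreal (\<integral>x. (w x + B) * indicator C x \<partial>M)"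
    if C[measurable]: "C \<in> sets M" and w: "w \<in> borel_measurable M" "AE x in M. \<bar>w x\<bar> \<le> B" for C w
  proof -
    note [measurable] = w(1)
    have ae: "AE x in M. \<bar>(w x + B) * indicator C x\<bar> \<le> 2 * B" "AE x in M. 0 \<le> (w x + B) * indicator C x"
      using w(2) B by (auto elim!: eventually_mono simp: indicator_def)
    have "emeasure (density M (\<lambda>x. ennreal (w x + B))) C = (\<integral>\<^sup>+x. ennreal ((w x + B) * indicator C x) \<partial>M)"
      by (subst emeasure_density) (auto intro!: nn_integral_cong simp: indicator_def)
    also have "\<dots> = ennreal (\<integral>x. (w x + B) * indicator C x \<partial>M)"
      using ae by (intro nn_integral_eq_integral integrable_const_bound[of _ "2 * B"]) auto
    finally show ?thesis .
  qed
  obtain A :: "nat \<Rightarrow> 'a set" where A: "range A \<subseteq> E" "(\<Union>i. A i) = space M" using E_cover by auto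
  have EM: "C \<in> sets M" if "C \<in> E" for C using that E_gen by auto
  \<comment> \<open>The shift by \<open>B\<close> turns both functions into densities of finite
    measures; agreement on the intersection-stable generator then forces equality of the measures,
    hence of the densities almost everywhere.\<close>
  have "density M (\<lambda>x. ennreal (v x + B)) = density M (\<lambda>x. ennreal (f x + B))"
  proof (rule measure_eqI_generator_eq[OF E_Int E_space _ _ _ A])
    show "emeasure (density M (\<lambda>x. ennreal (v x + B))) C = emeasure (density M (\<lambda>x. ennreal (f x + B))) C" if "C \<in> E" for C
      using em[OF EM[OF that], of v] em[OF EM[OF that], of f] eq[OF that] vb fb by auto
    show "emeasure (density M (\<lambda>x. ennreal (v x + B))) (A i) \<noteq> \<infinity>" for i
    proof -
      have "A i \<in> E" using A by auto
      then show ?thesis using em[OF EM, of "A i" v] vb by auto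
    qed
  qed (simp_all add: E_gen)
  then have "AE x in M. ennreal (v x + B) = ennreal (f x + B)"
    by (subst (asm) density_unique_iff) auto
  then show ?thesis using fb AE_space
  proof eventually_elim
    case (elim x)
    then show ?case using vb[of x] by (subst (asm) ennreal_inj) (auto simp: abs_le_iff)
  qed
qed

text \<open>Since \<open>P (t / 2)\<close> has a density, the bound at time \<open>t / 2\<close> is needed only almost everywhere.\<close>

lemma P'_pointwise_bound:
  assumes f: "bdd B f" and A: "0 \<le> A" and b: "0 < \<beta>" "\<beta> < 1"
    and lip: "\<forall>t>0. AE x in M. \<bar>P' t f x\<bar> \<le> A * t powr (\<beta> - 1)"
    and t: "0 < t" and x: "x \<in> space M"
  shows "\<bar>P' t f x\<bar> \<le> 2 * A * t powr (\<beta> - 1)"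
proof -
  note [measurable] = bdd_measurable[OF f]
  have bd: "bdd (A * (t / 2) powr (\<beta> - 1)) (P' (t / 2) f)"
    using lip[rule_format, of "t / 2"] t A by (simp add: bdd_def)
  have "\<bar>P' t f x\<bar> \<le> A * (t / 2) powr (\<beta> - 1)"
    using abs_P_le[OF bd _ x, of "t / 2"] P'_add[OF f _ _ x, of "t / 2" "t / 2"] t by simp
  also have "\<dots> \<le> A * (2 * t powr (\<beta> - 1))"
    using A t b by (intro mult_left_mono half_powr_le) auto
  finally show ?thesis by (simp add: mult_ac)
qed

text \<open>Half of the time is spent on the first derivative: \<open>w = P' (s / 2) f\<close> is a
  bounded function, and \<open>P' r f = P (r - s / 2) w\<close> for \<open>r \<ge> s\<close>. A
  second derivative is thus a first derivative of \<open>P\<close> applied to \<open>w\<close>, and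
  the mean value inequality finishes. No second derivative of the kernel is needed.\<close>

lemma P'_difference_bound:
  assumes f: "bdd B f" and A: "0 \<le> A" and b: "0 < \<beta>" "\<beta> < 1"
    and lip: "\<forall>t>0. AE x in M. \<bar>P' t f x\<bar> \<le> A * t powr (\<beta> - 1)"
    and s: "0 < s" and t: "0 \<le> t" and x: "x \<in> space M"
  shows "\<bar>P' (s + t) f x - P' s f x\<bar> \<le> 32 * A * s powr (\<beta> - 2) * t"
proof -
  note [measurable] = bdd_measurable[OF f]
  define w where "w = P' (s / 2) f"
  define K where "K = A * (s / 2) powr (\<beta> - 1)"
  have bd: "bdd K w"
    using lip[rule_format, of "s / 2"] s A by (simp add: bdd_def w_def K_def)
  have K: "0 \<le> K" using A by (simp add: K_def)
  have eq: "P' r f x = P (r - s / 2) w x" if "s \<le> r" for r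
    using P'_add[OF f _ _ x, of "r - s / 2" "s / 2"] that s by (simp add: w_def)
  have "norm (P (s + t - s / 2) w x - P (s - s / 2) w x) \<le> 16 * K / s * norm ((s + t - s/2) - (s - s / 2))"
  proof (rule field_differentiable_bound[of "{s / 2..}" "\<lambda>r. P r w x" "\<lambda>r. P' r w x"])
    fix r assume "r \<in> {s / 2..}"
    then have r: "s / 2 \<le> r" "0 < r" using s by auto
    show "((\<lambda>r. P r w x) has_field_derivative P' r w x) (at r within {s / 2..})"
      by (rule has_field_derivative_at_within[OF P_has_derivative[OF bd r(2) x]])
    have "8 * K / r \<le> 8 * K / (s / 2)" using K r s by (intro divide_left_mono) auto
    then show "norm (P' r w x) \<le> 16 * K / s" using abs_P'_le[OF bd r(2) x] by simp
  qed (use s t in auto)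
  then have "\<bar>P' (s + t) f x - P' s f x\<bar> \<le> 16 * K / s * t"
    using t eq[of s] eq[of "s + t"] by simp
  also have "\<dots> \<le> 32 * A * s powr (\<beta> - 2) * t"
  proof (rule mult_right_mono)
    have "A * (s / 2) powr (\<beta> - 1) \<le> A * (2 * s powr (\<beta> - 1))"
      using A s b by (intro mult_left_mono half_powr_le) auto
    then have "16 * K / s \<le> 16 * (A * (2 * s powr (\<beta> - 1))) / s"
      using s by (simp add: K_def divide_right_mono)
    also have "\<dots> = 32 * A * s powr (\<beta> - 2)"
      using s powr_diff[of s "\<beta> - 1" 1] by simp
    finally show "16 * K / s \<le> 32 * A * s powr (\<beta> - 2)" .
  qed (use t in auto)
  finally show ?thesis .
qed

text \<open>The functions \<open>2 * A / \<beta> * r powr \<beta> + c * P r f x\<close> with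
  \<open>c = 1\<close> and \<open>c = -1\<close> have nonnegative derivative by the pointwise bound,
  so both are nondecreasing in \<open>r\<close>.\<close>

lemma P_holder:
  assumes f: "bdd B f" and A: "0 \<le> A" and b: "0 < \<beta>" "\<beta> < 1"
    and lip: "\<forall>t>0. AE x in M. \<bar>P' t f x\<bar> \<le> A * t powr (\<beta> - 1)"
    and s: "0 < s" "s \<le> t" and x: "x \<in> space M"
  shows "\<bar>P t f x - P s f x\<bar> \<le> 2 * A / \<beta> * (t powr \<beta> - s powr \<beta>)"
proof -
  have d: "((\<lambda>r. 2 * A / \<beta> * r powr \<beta> + c * P r f x) has_real_derivative
      2 * A * r powr (\<beta> - 1) + c * P' r f x) (at r)" if "0 < r" for r c
    using that b by (auto intro!: derivative_eq_intros P_has_derivative[OF f that x])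
  have "2 * A / \<beta> * s powr \<beta> + c * P s f x \<le> 2 * A / \<beta> * t powr \<beta> + c * P t f x" if c: "\<bar>c\<bar> = 1" for c
  proof (rule DERIV_nonneg_imp_nondecreasing[OF s(2)])
    fix r assume "s \<le> r" "r \<le> t"
    then have r: "0 < r" using s by simp
    have "\<bar>c * P' r f x\<bar> \<le> 2 * A * r powr (\<beta> - 1)"
      using P'_pointwise_bound[OF f A b lip r x] c by (simp add: abs_mult)
    then have "0 \<le> 2 * A * r powr (\<beta> - 1) + c * P' r f x" by linarith
    then show "\<exists>y. ((\<lambda>r. 2 * A / \<beta> * r powr \<beta> + c * P r f x) has_real_derivative y) (at r) \<and> 0 \<le> y"
      using d[OF r] by blast
  qed
  from this[of 1] this[of "-1"] show ?thesis by (simp add: right_diff_distrib abs_le_iff)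
qed

text \<open>Along the times \<open>1 / (n + 1)\<close> the values of \<open>P\<close> are Cauchy at
  every point, and their limit equals \<open>f\<close> off one null set. Letting the smaller time
  tend to zero in \<open>P_holder\<close> keeps that null set, so the estimate holds for all
  \<open>t\<close> simultaneously, as integration in \<open>t\<close> requires.\<close>

lemma AE_P_minus_le:
  assumes f: "bdd B f" and A: "0 \<le> A" and b: "0 < \<beta>" "\<beta> < 1"
    and lip: "\<forall>t>0. AE x in M. \<bar>P' t f x\<bar> \<le> A * t powr (\<beta> - 1)"
  shows "AE x in M. \<forall>t>0. \<bar>P t f x - f x\<bar> \<le> 2 * A / \<beta> * t powr \<beta>"
proof -
  define \<tau> where "\<tau> n = 1 / real (Suc n)" for n
  define K where "K = 2 * A / \<beta>"
  have K: "0 \<le> K" using A b by (simp add: K_def)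
  have \<tau>: "0 < \<tau> n" for n by (simp add: \<tau>_def)
  have \<tau>0: "\<tau> \<longlonglongrightarrow> 0" unfolding \<tau>_def by (rule LIMSEQ_Suc[OF lim_1_over_n])
  then have "(\<lambda>n. \<tau> n powr \<beta>) \<longlonglongrightarrow> 0 powr \<beta>"
    using b \<tau> by (intro tendsto_powr') (auto intro!: always_eventually simp: less_imp_le)
  then have \<tau>\<beta>: "(\<lambda>n. \<tau> n powr \<beta>) \<longlonglongrightarrow> 0" by simp
  have hold: "\<bar>P t f x - P s f x\<bar> \<le> K * t powr \<beta>" if "0 < s" "s \<le> t" "x \<in> space M" for s t x
  proof -
    have "\<bar>P t f x - P s f x\<bar> \<le> K * (t powr \<beta> - s powr \<beta>)"
      unfolding K_def by (rule P_holder[OF f A b lip that])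
    also have "\<dots> \<le> K * t powr \<beta>" using K by (intro mult_left_mono) auto
    finally show ?thesis .
  qed
  define v where "v x = lim (\<lambda>n. P (\<tau> n) f x)" for x
  have v: "(\<lambda>n. P (\<tau> n) f x) \<longlonglongrightarrow> v x" if x: "x \<in> space M" for x
    unfolding v_def convergent_LIMSEQ_iff[symmetric]
  proof (rule Cauchy_convergent, rule metric_CauchyI)
    fix e :: real assume e: "0 < e"
    have "(\<lambda>n. K * \<tau> n powr \<beta>) \<longlonglongrightarrow> K * 0" by (intro tendsto_intros \<tau>\<beta>)
    then obtain n0 where n0: "\<And>n. n0 \<le> n \<Longrightarrow> K * \<tau> n powr \<beta> < e"
      using order_tendstoD(2)[of _ "K * 0" sequentially e] e by (auto simp: eventually_sequentially)
    have *: "dist (P (\<tau> m) f x) (P (\<tau> n) f x) < e" if "n0 \<le> m" "m \<le> n" for m n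
    proof -
      have "\<tau> n \<le> \<tau> m" using that(2) by (simp add: \<tau>_def frac_le)
      then show ?thesis using hold[OF \<tau> _ x, of n "\<tau> m"] n0[OF that(1)] by (simp add: dist_real_def)
    qed
    show "\<exists>N. \<forall>m\<ge>N. \<forall>n\<ge>N. dist (P (\<tau> m) f x) (P (\<tau> n) f x) < e"
      by (intro exI[of _ n0] allI impI) (metis * dist_commute linorder_le_cases)
  qed
  have "AE x in M. v x = f x"
    by (rule P_limit_AE_eq[OF f]) (use v in \<open>simp add: \<tau>_def\<close>)
  then show ?thesis using AE_space
  proof (eventually_elim, intro allI impI)
    fix x and t :: real assume vx: "v x = f x" and x: "x \<in> space M" and t: "0 < t"
    have "(\<lambda>n. \<bar>P t f x - P (\<tau> n) f x\<bar>) \<longlonglongrightarrow> \<bar>P t f x - f x\<bar>"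
      unfolding vx[symmetric] by (intro tendsto_intros v x)
    then show "\<bar>P t f x - f x\<bar> \<le> 2 * A / \<beta> * t powr \<beta>"
      unfolding K_def[symmetric]
    proof (rule tendsto_upperbound)
      have "\<forall>\<^sub>F n in sequentially. \<tau> n < t" using order_tendstoD(2)[OF \<tau>0 t] .
      then show "\<forall>\<^sub>F n in sequentially. \<bar>P t f x - P (\<tau> n) f x\<bar> \<le> K * t powr \<beta>"
        by eventually_elim (use hold[OF \<tau> _ x] in auto)
    qed simp
  qed
qed

section \<open>The fractional derivative of a Markov semigroup\<close>

definition bessel_integrand :: "real \<Rightarrow> ('a \<Rightarrow> real) \<Rightarrow> 'a \<Rightarrow> real \<Rightarrow> real" where
  "bessel_integrand l f x t = t powr (- l - 1) * (exp (- t) * P t f x - f x)"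

text \<open>The fractional derivative without its normalisation; the factor
  \<open>1 / bessel_const l\<close> is put back as a scalar in the final proof.\<close>

definition bessel :: "real \<Rightarrow> ('a \<Rightarrow> real) \<Rightarrow> 'a \<Rightarrow> real" where
  "bessel l f x = (LINT t:{0<..}|lborel. bessel_integrand l f x t)"

lemma measurable_bessel_integrand[measurable (raw)]:
  assumes [measurable]: "f \<in> borel_measurable M" "g \<in> measurable N M" "h \<in> borel_measurable N"
  shows "(\<lambda>x. bessel_integrand l f (g x) (h x)) \<in> borel_measurable N"
  unfolding bessel_integrand_def by measurable

lemma measurable_bessel[measurable (raw)]:
  assumes [measurable]: "f \<in> borel_measurable M" "g \<in> measurable N M"
  shows "(\<lambda>x. bessel l f (g x)) \<in> borel_measurable N"
  unfolding bessel_def set_lebesgue_integral_def by measurable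

text \<open>The bracket is written as \<open>(P t f x - f x) - (1 - exp (- t)) * P t f x\<close>.
  The first term is of order \<open>t powr \<beta>\<close> for small \<open>t\<close> and at most
  \<open>2 * B\<close> always; for the second, \<open>min 1 t \<le> min 1 (t powr \<beta>)\<close>
  because \<open>\<beta> < 1\<close>.\<close>

lemma AE_bessel_integrand_le:
  assumes f: "bdd B f" and A: "0 \<le> A" and b: "0 < \<beta>" "\<beta> < 1"
    and lip: "\<forall>t>0. AE x in M. \<bar>P' t f x\<bar> \<le> A * t powr (\<beta> - 1)"
  shows "AE x in M. \<forall>t>0. \<bar>bessel_integrand l f x t\<bar> \<le>
     (2 * A / \<beta> + 3 * B) * (t powr (- l - 1) * min 1 (t powr \<beta>))"
proof -
  have fb: "AE x in M. \<bar>f x\<bar> \<le> B" and B: "0 \<le> B" using f by (auto simp: bdd_def)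
  show ?thesis
    using AE_P_minus_le[OF f A b lip] fb AE_space
  proof (eventually_elim, intro allI impI)
    fix x and t :: real
    assume h: "\<forall>t>0. \<bar>P t f x - f x\<bar> \<le> 2 * A / \<beta> * t powr \<beta>" and fx: "\<bar>f x\<bar> \<le> B"
      and x: "x \<in> space M" and t: "0 < t"
    have Pt: "\<bar>P t f x\<bar> \<le> B" by (rule abs_P_le[OF f t x])
    have 1: "\<bar>P t f x - f x\<bar> \<le> (2 * A / \<beta> + 2 * B) * min 1 (t powr \<beta>)"
    proof (cases "t powr \<beta> \<le> 1")
      case True
      then show ?thesis using h t B by (simp add: distrib_right add_increasing2)
    next
      case False
      then show ?thesis using Pt fx A b by (simp add: add_increasing)
    qed
    have 2: "(1 - exp (- t)) * \<bar>P t f x\<bar> \<le> min 1 (t powr \<beta>) * B"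
    proof (intro mult_mono Pt)
      have "min 1 t \<le> min 1 (t powr \<beta>)"
        using powr_mono'[of \<beta> 1 t] ge_one_powr_ge_zero[of t \<beta>] t b by (cases "t \<le> 1") auto
      then show "1 - exp (- t) \<le> min 1 (t powr \<beta>)" using one_minus_exp_le[OF t] by linarith
    qed (use t in auto)
    have "\<bar>exp (- t) * P t f x - f x\<bar> \<le> \<bar>P t f x - f x\<bar> + \<bar>(1 - exp (- t)) * P t f x\<bar>"
      by (simp add: left_diff_distrib)
    also have "\<bar>(1 - exp (- t)) * P t f x\<bar> = (1 - exp (- t)) * \<bar>P t f x\<bar>"
      using t by (simp add: abs_mult)
    finally have "\<bar>exp (- t) * P t f x - f x\<bar> \<le> (2 * A / \<beta> + 3 * B) * min 1 (t powr \<beta>)"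
      using 1 2 by (simp add: algebra_simps)
    then show "\<bar>bessel_integrand l f x t\<bar> \<le> (2 * A / \<beta> + 3 * B) * (t powr (- l - 1) * min 1 (t powr \<beta>))"
      unfolding bessel_integrand_def abs_mult
      by (simp add: mult.left_commute[of "2 * A / \<beta> + 3 * B"] mult_left_mono)
  qed
qed

lemma set_integrable_bessel_integrand:
  assumes f: "bdd B f" and K: "0 \<le> K" and l: "0 < l" "l < \<beta>" and x: "x \<in> space M"
    and bd: "\<forall>t>0. \<bar>bessel_integrand l f x t\<bar> \<le> K * (t powr (- l - 1) * min 1 (t powr \<beta>))"
  shows "set_integrable lborel {0<..} (bessel_integrand l f x)"
    and "(LINT t|lborel. \<bar>indicator {0<..} t * bessel_integrand l f x t\<bar>) \<le> K * (1 / (\<beta> - l) + 1 / l)"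
proof -
  note [measurable] = bdd_measurable[OF f] x
  define w where "w t = K * (indicator {0<..} t * (t powr (- l - 1) * min 1 ((t / 1) powr \<beta>)))" for t :: real
  have "has_bochner_integral lborel w (K * (1 powr (- l) * (1 / (\<beta> - l) + 1 / l)))"
    unfolding w_def using l by (intro has_bochner_integral_mult_right powr_min_integral) auto
  then have w: "integrable lborel w" "(LINT t|lborel. w t) = K * (1 / (\<beta> - l) + 1 / l)"
    by (auto simp: has_bochner_integral_iff)
  have le: "\<bar>indicator {0<..} t * bessel_integrand l f x t\<bar> \<le> w t" for t
    using bd by (auto simp: w_def indicator_def)
  have i: "integrable lborel (\<lambda>t. indicator {0<..} t * bessel_integrand l f x t)"
    by (rule Bochner_Integration.integrable_bound[OF w(1)])
       (use le in \<open>auto intro!: AE_I2 order_trans[OF _ abs_ge_self]\<close>)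
  then show "set_integrable lborel {0<..} (bessel_integrand l f x)"
    by (simp add: set_integrable_def)
  show "(LINT t|lborel. \<bar>indicator {0<..} t * bessel_integrand l f x t\<bar>) \<le> K * (1 / (\<beta> - l) + 1 / l)"
    unfolding w(2)[symmetric] by (intro integral_mono le w integrable_abs i)
qed

text \<open>The integrand is controlled for almost every point of \<open>M\<close>, hence for almost
  every point of \<open>\<kappa> s x\<close>, which has a density; this justifies Fubini. The
  resulting formula involves \<open>P\<close> at positive times only and so holds at every
  \<open>x\<close>, whereas the integral defining \<open>bessel l f\<close> is controlled only
  almost everywhere.\<close>

lemma P_bessel:
  assumes f: "bdd B f" and A: "0 \<le> A" and l: "0 < l" "l < \<beta>" and b: "0 < \<beta>" "\<beta> < 1"
    and lip: "\<forall>t>0. AE x in M. \<bar>P' t f x\<bar> \<le> A * t powr (\<beta> - 1)"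
  shows "bdd ((2 * A / \<beta> + 3 * B) * (1 / (\<beta> - l) + 1 / l)) (bessel l f)"
    and "\<lbrakk>0 < s; x \<in> space M\<rbrakk> \<Longrightarrow> P s (bessel l f) x =
      (LINT t:{0<..}|lborel. t powr (- l - 1) * (exp (- t) * P (s + t) f x - P s f x))"
    and "AE x in M. set_integrable lborel {0<..} (bessel_integrand l f x)"
    and "\<lbrakk>0 < s; x \<in> space M\<rbrakk> \<Longrightarrow> set_integrable lborel {0<..} (\<lambda>t. t powr (- l - 1) * (exp (- t) * P (s + t) f x - P s f x))"
proof -
  note [measurable] = bdd_measurable[OF f]
  define K where "K = 2 * A / \<beta> + 3 * B"
  define J where "J = 1 / (\<beta> - l) + 1 / l"
  have B: "0 \<le> B" using f by (auto simp: bdd_def)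
  have K: "0 \<le> K" using A b B by (simp add: K_def)
  have J: "0 \<le> J" using l by (simp add: J_def)
  have ae: "AE x in M. set_integrable lborel {0<..} (bessel_integrand l f x) \<and>
     (LINT t|lborel. \<bar>indicator {0<..} t * bessel_integrand l f x t\<bar>) \<le> K * J"
    using AE_bessel_integrand_le[OF f A b lip, of l] AE_space
    by eventually_elim (use set_integrable_bessel_integrand[OF f K l] in \<open>auto simp: K_def J_def\<close>)
  then show "AE x in M. set_integrable lborel {0<..} (bessel_integrand l f x)" by auto
  have "AE x in M. \<bar>bessel l f x\<bar> \<le> K * J"
    using ae
  proof eventually_elim
    case (elim x)
    have "\<bar>bessel l f x\<bar> \<le> (LINT t|lborel. \<bar>indicator {0<..} t * bessel_integrand l f x t\<bar>)"
      unfolding bessel_def set_lebesgue_integral_def by simp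
    then show ?case using elim by simp
  qed
  then show bdd: "bdd ((2 * A / \<beta> + 3 * B) * (1 / (\<beta> - l) + 1 / l)) (bessel l f)"
    using K J unfolding bdd_def K_def J_def by auto
  assume s: "0 < s" and x: "x \<in> space M"
  interpret \<kappa>: prob_space "\<kappa> s x" using s x by (rule prob_space_\<kappa>)
  interpret \<kappa>l: pair_sigma_finite "\<kappa> s x" lborel ..
  let ?h = "\<lambda>y t. indicator {0<..} t * bessel_integrand l f y t"
  have ae\<kappa>: "AE y in \<kappa> s x. set_integrable lborel {0<..} (bessel_integrand l f y) \<and>
     (LINT t|lborel. \<bar>?h y t\<bar>) \<le> K * J"
    using ae by (rule AE_\<kappa>[OF x])
  have int: "integrable (\<kappa> s x \<Otimes>\<^sub>M lborel) (case_prod ?h)"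
  proof (rule \<kappa>l.Fubini_integrable)
    show "case_prod ?h \<in> borel_measurable (\<kappa> s x \<Otimes>\<^sub>M lborel)" by measurable
    show "integrable (\<kappa> s x) (\<lambda>y. LINT t|lborel. norm (case (y, t) of (y, t) \<Rightarrow> ?h y t))"
    proof (rule \<kappa>.integrable_const_bound[of _ "K * J"])
      show "AE y in \<kappa> s x. norm (LINT t|lborel. norm (case (y, t) of (y, t) \<Rightarrow> ?h y t)) \<le> K * J"
        using ae\<kappa> by eventually_elim auto
    qed measurable
    show "AE y in \<kappa> s x. integrable lborel (\<lambda>t. case (y, t) of (y, t) \<Rightarrow> ?h y t)"
      using ae\<kappa> by eventually_elim (simp add: set_integrable_def)
  qed
  have inner: "(\<integral>y. ?h y t \<partial>\<kappa> s x) =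
    indicator {0<..} t *\<^sub>R (t powr (- l - 1) * (exp (- t) * P (s + t) f x - P s f x))" for t
  proof (cases "0 < t")
    case t: True
    have i1: "integrable (\<kappa> s x) (P t f)" by (rule integrable_\<kappa>[OF bdd_P[OF f t] s x])
    have i2: "integrable (\<kappa> s x) f" by (rule integrable_\<kappa>[OF f s x])
    have "(\<integral>y. ?h y t \<partial>\<kappa> s x) = t powr (- l - 1) * (exp (- t) * (\<integral>y. P t f y \<partial>\<kappa> s x) - (\<integral>y. f y \<partial>\<kappa> s x))"
      using t i1 i2 by (simp add: bessel_integrand_def)
    also have "(\<integral>y. P t f y \<partial>\<kappa> s x) = P (s + t) f x"
      by (simp add: P_eq_integral_\<kappa>[OF bdd_P[OF f t] s x, symmetric] P_semigroup[OF f s t x])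
    also have "(\<integral>y. f y \<partial>\<kappa> s x) = P s f x" by (rule P_eq_integral_\<kappa>[OF f s x, symmetric])
    finally show ?thesis using t by simp
  qed simp
  have "P s (bessel l f) x = (\<integral>y. \<integral>t. ?h y t \<partial>lborel \<partial>\<kappa> s x)"
    by (subst P_eq_integral_\<kappa>[OF bdd s x]) (simp add: bessel_def[abs_def] set_lebesgue_integral_def)
  also have "\<dots> = (\<integral>t. \<integral>y. ?h y t \<partial>\<kappa> s x \<partial>lborel)"
    by (rule \<kappa>l.Fubini_integral[OF int, symmetric])
  finally show "P s (bessel l f) x =
      (LINT t:{0<..}|lborel. t powr (- l - 1) * (exp (- t) * P (s + t) f x - P s f x))"
    unfolding inner set_lebesgue_integral_def .
  show "set_integrable lborel {0<..} (\<lambda>t. t powr (- l - 1) * (exp (- t) * P (s + t) f x - P s f x))"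
    using \<kappa>l.integrable_snd[OF int] unfolding inner set_integrable_def .
qed

text \<open>Increments in the outer time are estimated under the integral with the weight
  \<open>min 1 (t / s)\<close>. For \<open>t \<le> s\<close> the time difference of
  \<open>P'\<close> contributes 32 and the damping \<open>1 - exp (- t)\<close> contributes 2; for
  \<open>t > s\<close> two pointwise bounds contribute only 4. The case \<open>\<gamma> = 1\<close>
  of \<open>powr_min_integral\<close> then produces \<open>s powr (- l)\<close>.\<close>

lemma P'_bessel_small:
  assumes f: "bdd B f" and A: "0 \<le> A" and l: "0 < l" "l < \<beta>" and b: "0 < \<beta>" "\<beta> < 1"
    and lip: "\<forall>t>0. AE x in M. \<bar>P' t f x\<bar> \<le> A * t powr (\<beta> - 1)"
    and s: "0 < s" "s \<le> 1" and x: "x \<in> space M"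
  shows "\<bar>P' s (bessel l f) x\<bar> \<le> 34 * A * (1 / (1 - l) + 1 / l) * s powr (\<beta> - l - 1)"
proof (rule deriv_le_of_right_lipschitz[OF P_has_derivative[OF P_bessel(1)[OF f A l b lip] s(1) x]])
  fix r assume r: "s < r"
  define k where "k q t = t powr (- l - 1) * (exp (- t) * P (q + t) f x - P q f x)" for q t
  define w where "w t = (r - s) * (34 * A * s powr (\<beta> - 1)) *
     (indicator {0<..} t * (t powr (- l - 1) * min 1 ((t / s) powr 1)))" for t :: real
  have "has_bochner_integral lborel w ((r - s) * (34 * A * s powr (\<beta> - 1)) * (s powr (- l) * (1 / (1 - l) + 1 / l)))"
    unfolding w_def using l b s by (intro has_bochner_integral_mult_right powr_min_integral) auto
  moreover have "(r - s) * (34 * A * s powr (\<beta> - 1)) * (s powr (- l) * (1 / (1 - l) + 1 / l)) =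
    34 * A * (1 / (1 - l) + 1 / l) * s powr (\<beta> - l - 1) * (r - s)"
  proof -
    have "s powr (\<beta> - l - 1) = s powr (\<beta> - 1) * s powr (- l)"
      by (simp add: powr_add[symmetric] algebra_simps)
    then show ?thesis by (simp only: mult_ac)
  qed
  ultimately have w: "integrable lborel w"
     "(LINT t|lborel. w t) = 34 * A * (1 / (1 - l) + 1 / l) * s powr (\<beta> - l - 1) * (r - s)"
    by (auto simp: has_bochner_integral_iff)
  have mono: "s powr (\<beta> - 1) \<ge> q powr (\<beta> - 1)" "s powr (\<beta> - 2) \<ge> q powr (\<beta> - 2)" if "s \<le> q" for q
    using powr_mono2'[of "\<beta> - 1" s q] powr_mono2'[of "\<beta> - 2" s q] that b s by auto
  have der: "\<bar>exp (- t) * P' (q + t) f x - P' q f x\<bar> \<le> 34 * A * s powr (\<beta> - 1) * min 1 (t / s)"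
    if q: "s \<le> q" and t: "0 < t" for q t
  proof -
    have q0: "0 < q" using q s by simp
    have Pq: "\<bar>P' u f x\<bar> \<le> 2 * A * s powr (\<beta> - 1)" if "s \<le> u" for u
    proof -
      have "\<bar>P' u f x\<bar> \<le> 2 * A * u powr (\<beta> - 1)"
        using s that by (intro P'_pointwise_bound[OF f A b lip _ x]) auto
      also have "\<dots> \<le> 2 * A * s powr (\<beta> - 1)" using A by (intro mult_left_mono mono that) auto
      finally show ?thesis .
    qed
    show ?thesis
    proof (cases "t \<le> s")
      case True
      have "\<bar>P' (q + t) f x - P' q f x\<bar> \<le> 32 * A * q powr (\<beta> - 2) * t"
        using t by (intro P'_difference_bound[OF f A b lip q0 _ x]) auto
      also have "\<dots> \<le> 32 * A * s powr (\<beta> - 2) * t"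
        using A t by (intro mult_right_mono mult_left_mono mono q) auto
      also have "\<dots> = 32 * A * s powr (\<beta> - 1) * (t / s)"
        using s powr_diff[of s "\<beta> - 1" 1] by simp
      finally have 1: "\<bar>P' (q + t) f x - P' q f x\<bar> \<le> 32 * A * s powr (\<beta> - 1) * (t / s)" .
      have "(1 - exp (- t)) * \<bar>P' (q + t) f x\<bar> \<le> (t / s) * (2 * A * s powr (\<beta> - 1))"
      proof (intro mult_mono Pq)
        \<comment> \<open>Here \<open>s \<le> 1\<close> enters: the damping is of order
          \<open>t\<close> and has to be absorbed into the scale-invariant weight
          \<open>t / s\<close>.\<close>
        have "t \<le> t / s" using s t by (simp add: field_simps)
        then show "1 - exp (- t) \<le> t / s" using one_minus_exp_le[OF t] by linarith
      qed (use s q t in auto)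
      then have 2: "\<bar>(1 - exp (- t)) * P' (q + t) f x\<bar> \<le> 2 * A * s powr (\<beta> - 1) * (t / s)"
        using t by (simp add: abs_mult mult_ac)
      have "\<bar>exp (- t) * P' (q + t) f x - P' q f x\<bar>
          \<le> \<bar>P' (q + t) f x - P' q f x\<bar> + \<bar>(1 - exp (- t)) * P' (q + t) f x\<bar>"
        by (simp add: left_diff_distrib)
      also have "\<dots> \<le> 34 * A * s powr (\<beta> - 1) * (t / s)" using 1 2 by simp
      finally show ?thesis using True s by simp
    next
      case False
      have "\<bar>exp (- t) * P' (q + t) f x\<bar> \<le> 1 * (2 * A * s powr (\<beta> - 1))"
        unfolding abs_mult using t q by (intro mult_mono Pq) auto
      then have "\<bar>exp (- t) * P' (q + t) f x - P' q f x\<bar> \<le> 4 * (A * s powr (\<beta> - 1))"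
        using Pq[OF q] by linarith
      also have "\<dots> \<le> 34 * (A * s powr (\<beta> - 1))" using A by (intro mult_right_mono) auto
      finally show ?thesis using False s by simp
    qed
  qed
  have le: "\<bar>indicator {0<..} t * (k r t - k s t)\<bar> \<le> w t" for t
  proof (cases "0 < t")
    case t: True
    have "norm ((exp (- t) * P (r + t) f x - P r f x) - (exp (- t) * P (s + t) f x - P s f x))
       \<le> 34 * A * s powr (\<beta> - 1) * min 1 (t / s) * norm (r - s)"
    proof (rule field_differentiable_bound[of "{s..}" "\<lambda>q. exp (- t) * P (q + t) f x - P q f x"
          "\<lambda>q. exp (- t) * P' (q + t) f x - P' q f x"])
      fix q assume "q \<in> {s..}"
      then have q: "s \<le> q" "0 < q" "0 < q + t" using s t by auto
      have "((\<lambda>q. P (q + t) f x) has_real_derivative P' (q + t) f x * 1) (at q)"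
        by (rule DERIV_chain'[where g="\<lambda>b. P b f x"])
           (use P_has_derivative[OF f q(3) x] in \<open>auto intro!: derivative_eq_intros\<close>)
      then show "((\<lambda>q. exp (- t) * P (q + t) f x - P q f x) has_field_derivative
         exp (- t) * P' (q + t) f x - P' q f x) (at q within {s..})"
        using P_has_derivative[OF f q(2) x]
        by (intro has_field_derivative_at_within[OF DERIV_diff[OF DERIV_cmult]]) auto
      show "norm (exp (- t) * P' (q + t) f x - P' q f x) \<le> 34 * A * s powr (\<beta> - 1) * min 1 (t / s)"
        using der[OF q(1) t] by simp
    qed (use r in auto)
    then have "t powr (- l - 1) * \<bar>(exp (- t) * P (r + t) f x - P r f x) - (exp (- t) * P (s + t) f x - P s f x)\<bar>
       \<le> t powr (- l - 1) * (34 * A * s powr (\<beta> - 1) * min 1 (t / s) * (r - s))"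
      using r by (intro mult_left_mono) auto
    moreover have "k r t - k s t = t powr (- l - 1) * ((exp (- t) * P (r + t) f x - P r f x) - (exp (- t) * P (s + t) f x - P s f x))"
      by (simp add: k_def right_diff_distrib)
    ultimately show ?thesis using t s unfolding w_def by (simp add: abs_mult mult_ac)
  qed (simp add: w_def)
  have i: "integrable lborel (\<lambda>t. indicator {0<..} t * k r t)" "integrable lborel (\<lambda>t. indicator {0<..} t * k s t)"
    using P_bessel(4)[OF f A l b lip _ x, of r] P_bessel(4)[OF f A l b lip s(1) x] r s
    unfolding k_def set_integrable_def by auto
  have "P r (bessel l f) x - P s (bessel l f) x = (LINT t|lborel. indicator {0<..} t * (k r t - k s t))"
  proof -
    have Pk: "P q (bessel l f) x = (LINT t|lborel. indicator {0<..} t * k q t)" if "0 < q" for q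
      unfolding P_bessel(2)[OF f A l b lip that x] set_lebesgue_integral_def k_def real_scaleR_def ..
    show ?thesis
      using Pk[of r] Pk[OF s(1)] r s i by (simp add: right_diff_distrib)
  qed
  also have "\<bar>\<dots>\<bar> \<le> (LINT t|lborel. w t)"
  proof -
    have i': "integrable lborel (\<lambda>t. indicator {0<..} t * (k r t - k s t))"
      unfolding right_diff_distrib using i by (rule Bochner_Integration.integrable_diff)
    show ?thesis
      by (rule order_trans[OF integral_abs_bound]) (intro integral_mono le w integrable_abs i')
  qed
  finally show "\<bar>P r (bessel l f) x - P s (bessel l f) x\<bar> \<le> 34 * A * (1 / (1 - l) + 1 / l) * s powr (\<beta> - l - 1) * (r - s)"
    unfolding w(2) .
qed

text \<open>The constant gathers 34 from short times and eight times the coefficients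
  \<open>2 / \<beta>\<close> and \<open>3\<close> of the sup bound, the eight coming from
  \<open>abs_P'_le\<close>. That estimate decays like \<open>s powr (- 1)\<close>, which for
  \<open>s > 1\<close> is below \<open>s powr (\<beta> - l - 1)\<close> because
  \<open>l < \<beta>\<close>. The bound is kept linear in \<open>A + B\<close> so that an infimum
  over \<open>A\<close> can be taken at the end.\<close>

lemma bessel_bounded:
  assumes f: "bdd B f" and A: "0 \<le> A" and l: "0 < l" "l < \<beta>" and b: "\<beta> < 1"
    and lip: "\<forall>t>0. AE x in M. \<bar>P' t f x\<bar> \<le> A * t powr (\<beta> - 1)"
  defines "C \<equiv> (34 + 16 / \<beta> + 24) * (1 / (1 - l) + 1 / (\<beta> - l) + 1 / l)"
  shows "bdd (C * (A + B)) (bessel l f)"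
    and "\<lbrakk>0 < s; x \<in> space M\<rbrakk> \<Longrightarrow> \<bar>P' s (bessel l f) x\<bar> \<le> C * (A + B) * s powr (\<beta> - l - 1)"
proof -
  have b0: "0 < \<beta>" using l by simp
  have B: "0 \<le> B" using f by (auto simp: bdd_def)
  define K where "K = (2 * A / \<beta> + 3 * B) * (1 / (\<beta> - l) + 1 / l)"
  define H where "H = 1 / (1 - l) + 1 / (\<beta> - l) + 1 / l"
  have H: "0 \<le> H" "1 / (\<beta> - l) + 1 / l \<le> H" "1 / (1 - l) + 1 / l \<le> H" using l b by (auto simp: H_def)
  define q where "q = 16 / \<beta>"
  have q: "0 \<le> q * A" "0 \<le> q * B" using A B b0 by (auto simp: q_def)
  have K0: "0 \<le> K" using A B b0 l by (simp add: K_def)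
  have "8 * K \<le> 8 * ((2 * A / \<beta> + 3 * B) * H)"
    unfolding K_def using A B b0 H by (intro mult_left_mono) auto
  also have "\<dots> = (q * A + 24 * B) * H" by (simp add: q_def algebra_simps)
  also have "\<dots> \<le> ((34 + q + 24) * (A + B)) * H"
    using A B q H(1) by (intro mult_right_mono) (auto simp: algebra_simps)
  also have "\<dots> = C * (A + B)" by (simp add: C_def H_def q_def mult_ac)
  finally have KC: "8 * K \<le> C * (A + B)" .
  have AC: "34 * A * (1 / (1 - l) + 1 / l) \<le> C * (A + B)"
  proof -
    have "34 * A * (1 / (1 - l) + 1 / l) \<le> 34 * A * H" using A H by (intro mult_left_mono) auto
    also have "\<dots> \<le> ((34 + q + 24) * (A + B)) * H"
      using A B q H(1) by (intro mult_right_mono) (auto simp: algebra_simps)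
    also have "\<dots> = C * (A + B)" by (simp add: C_def H_def q_def mult_ac)
    finally show ?thesis .
  qed
  have bd: "bdd K (bessel l f)" unfolding K_def by (rule P_bessel(1)[OF f A l b0 b lip])
  then show "bdd (C * (A + B)) (bessel l f)"
    using KC K0 unfolding bdd_def by (auto elim!: eventually_mono)
  assume s: "0 < s" and x: "x \<in> space M"
  show "\<bar>P' s (bessel l f) x\<bar> \<le> C * (A + B) * s powr (\<beta> - l - 1)"
  proof (cases "s \<le> 1")
    case True
    show ?thesis
      by (rule order_trans[OF P'_bessel_small[OF f A l b0 b lip s True x]])
         (use AC in \<open>auto intro!: mult_right_mono\<close>)
  next
    case False
    have "\<bar>P' s (bessel l f) x\<bar> \<le> 8 * K / s" by (rule abs_P'_le[OF bd s x])
    also have "\<dots> = 8 * K * s powr (- 1)" using s by (simp add: powr_minus_divide)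
    also have "\<dots> \<le> 8 * K * s powr (\<beta> - l - 1)"
      using K0 False l by (intro mult_left_mono powr_mono) auto
    also have "\<dots> \<le> C * (A + B) * s powr (\<beta> - l - 1)"
      using KC by (intro mult_right_mono) auto
    finally show ?thesis .
  qed
qed

end

section \<open>The Bessel-Clifford series\<close>

text \<open>Up to a power of the argument this is the modified Bessel function: \<open>I\<^sub>a(2 x) = x powr a * clifford a (x\<^sup>2)\<close>.\<close>

definition clifford :: "real \<Rightarrow> real \<Rightarrow> real" where
  "clifford a c = (\<Sum>k. c ^ k / (fact k * Gamma (real k + a + 1)))"

lemma Gamma_shift_pos: "-1 < a \<Longrightarrow> 0 < Gamma (real k + a + 1)"
  by (intro Gamma_real_pos) auto

text \<open>A lower bound uniform in \<open>k\<close>, giving convergence of the series by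
  comparison with the exponential. In the recursion only the first factor \<open>a + 1\<close> can
  be smaller than one; all later factors exceed one.\<close>

lemma Gamma_shift_ge:
  assumes a: "-1 < a"
  shows "min 1 (a + 1) * Gamma (a + 1) \<le> Gamma (real k + a + 1)"
proof (cases k)
  case 0
  have "min 1 (a + 1) * Gamma (a + 1) \<le> 1 * Gamma (a + 1)"
    using a by (intro mult_right_mono) (auto intro: less_imp_le)
  then show ?thesis using 0 by simp
next
  case (Suc n)
  have "(a + 1) * Gamma (a + 1) \<le> Gamma (real (Suc n) + a + 1)" for n
  proof (induction n)
    case 0
    have "Gamma (a + 1 + 1) = (a + 1) * Gamma (a + 1)"
      by (rule Gamma_plus1) (use a in \<open>auto elim!: nonpos_Ints_cases\<close>)
    then show ?case by (simp add: add.commute)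
  next
    case (Suc n)
    have "Gamma (real (Suc n) + a + 1 + 1) = (real (Suc n) + a + 1) * Gamma (real (Suc n) + a + 1)"
      by (rule Gamma_plus1) (use a in \<open>auto elim!: nonpos_Ints_cases\<close>)
    then have "Gamma (real (Suc (Suc n)) + a + 1) = (real (Suc n) + a + 1) * Gamma (real (Suc n) + a + 1)"
      by (simp add: add_ac)
    moreover have "1 * Gamma (real (Suc n) + a + 1) \<le> (real (Suc n) + a + 1) * Gamma (real (Suc n) + a + 1)"
      using a Gamma_shift_pos[OF a, of "Suc n"] by (intro mult_right_mono) auto
    ultimately show ?case using Suc by simp
  qed
  note this[of n]
  moreover have "min 1 (a + 1) * Gamma (a + 1) \<le> (a + 1) * Gamma (a + 1)"
    using a by (intro mult_right_mono) (auto intro: less_imp_le)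
  ultimately show ?thesis using Suc by simp
qed

lemma summable_clifford:
  assumes a: "-1 < a"
  shows "summable (\<lambda>k. c ^ k / (fact k * Gamma (real k + a + 1)))"
proof (rule summable_comparison_test')
  let ?m = "min 1 (a + 1) * Gamma (a + 1)"
  have m: "0 < ?m" using a by simp
  show "summable (\<lambda>k. inverse ?m * (inverse (fact k) * \<bar>c\<bar> ^ k))"
    by (intro summable_mult summable_exp)
  fix k :: nat
  have "1 / Gamma (real k + a + 1) \<le> 1 / ?m"
    using Gamma_shift_ge[OF a, of k] m by (intro divide_left_mono) (auto intro: mult_pos_pos Gamma_shift_pos[OF a])
  then have "\<bar>c\<bar> ^ k / fact k * (1 / Gamma (real k + a + 1)) \<le> \<bar>c\<bar> ^ k / fact k * (1 / ?m)"
    by (intro mult_left_mono) auto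
  then show "norm (c ^ k / (fact k * Gamma (real k + a + 1))) \<le> inverse ?m * (inverse (fact k) * \<bar>c\<bar> ^ k)"
    using Gamma_shift_pos[OF a, of k] by (simp add: abs_mult power_abs divide_inverse mult_ac)
qed

lemma ennreal_clifford:
  assumes "-1 < a" "0 \<le> c"
  shows "ennreal (clifford a c) = (\<Sum>k. ennreal (c ^ k / (fact k * Gamma (real k + a + 1))))"
  unfolding clifford_def using assms Gamma_shift_pos[OF assms(1)]
  by (intro suminf_ennreal2[symmetric] summable_clifford) (auto intro!: divide_nonneg_nonneg less_imp_le[OF mult_pos_pos])

lemma clifford_nonneg: "-1 < a \<Longrightarrow> 0 \<le> c \<Longrightarrow> 0 \<le> clifford a c"
  unfolding clifford_def using Gamma_shift_pos[of a]
  by (intro suminf_nonneg summable_clifford) (auto intro!: divide_nonneg_nonneg less_imp_le[OF mult_pos_pos])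

lemma clifford_0: "clifford a 0 = 1 / Gamma (a + 1)"
  unfolding clifford_def by (subst suminf_finite[of "{0}"]) auto

lemma measurable_clifford[measurable]: "clifford a \<in> borel_measurable borel"
  unfolding clifford_def[abs_def] by measurable

text \<open>The power of \<open>sqrt u\<close> in front of the Bessel function cancels against its
  leading power, so the kernel becomes an entire power series in \<open>u / v\<^sup>2\<close> times
  a power of \<open>v\<close>.\<close>

lemma bessel_I_eq_clifford:
  assumes a: "-1 < a" and u: "0 < u" and v: "0 < v"
  shows "sqrt u powr (- a) * bessel_I a (2 * sqrt u / v) = v powr (- a) * clifford a (u / v\<^sup>2)"
proof -
  have *: "(2 * sqrt u / v / 2) powr (2 * real k + a) / (fact k * Gamma (real k + a + 1))
     = (sqrt u / v) powr a * ((u / v\<^sup>2) ^ k / (fact k * Gamma (real k + a + 1)))" for k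
  proof -
    have "(sqrt u / v) powr (2 * real k) = ((sqrt u / v)\<^sup>2) ^ k"
      using u v powr_realpow[of "sqrt u / v" "2 * k"] by (simp add: power_mult)
    also have "(sqrt u / v)\<^sup>2 = u / v\<^sup>2" using u by (simp add: power_divide)
    finally show ?thesis by (simp add: powr_add)
  qed
  have "bessel_I a (2 * sqrt u / v) = (sqrt u / v) powr a * clifford a (u / v\<^sup>2)"
    by (simp only: bessel_I_def clifford_def * suminf_mult[OF summable_clifford[OF a]])
  moreover have "sqrt u powr (- a) * (sqrt u / v) powr a = v powr (- a)"
    using u v by (simp add: powr_divide powr_minus field_simps)
  ultimately show ?thesis by (metis mult.assoc)
qed

section \<open>Gamma integrals and the double series behind Weber's integral\<close>

lemma nn_integral_Gamma:
  assumes s: "0 < s" and B: "0 < B"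
  shows "(\<integral>\<^sup>+y. ennreal (indicator {0<..} y * (y powr (s - 1) * exp (- B * y))) \<partial>lborel) = ennreal (Gamma s / B powr s)"
proof -
  let ?f = "\<lambda>t::real. ennreal (indicator {0..} t * t powr (s - 1) / exp t)"
  have "ennreal (Gamma s) = (\<integral>\<^sup>+t. ?f t \<partial>lborel)" by (rule Gamma_conv_nn_integral_real[OF s])
  also have "\<dots> = ennreal \<bar>B\<bar> * (\<integral>\<^sup>+y. ?f (0 + B * y) \<partial>lborel)"
    by (rule nn_integral_real_affine) (use B in auto)
  also have "(\<integral>\<^sup>+y. ?f (0 + B * y) \<partial>lborel) =
     (\<integral>\<^sup>+y. ennreal (B powr (s - 1)) * ennreal (indicator {0<..} y * (y powr (s - 1) * exp (- B * y))) \<partial>lborel)"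
  proof (rule nn_integral_cong_AE)
    show "AE y in lborel. ?f (0 + B * y) = ennreal (B powr (s - 1)) * ennreal (indicator {0<..} y * (y powr (s - 1) * exp (- B * y)))"
      using AE_lborel_singleton[of "0::real"]
    proof eventually_elim
      case (elim y)
      then show ?case using B
        by (cases "0 < y") (auto simp: indicator_def ennreal_mult[symmetric] powr_mult exp_minus field_simps zero_le_mult_iff)
    qed
  qed
  also have "\<dots> = ennreal (B powr (s - 1)) * (\<integral>\<^sup>+y. ennreal (indicator {0<..} y * (y powr (s - 1) * exp (- B * y))) \<partial>lborel)"
    by (rule nn_integral_cmult) measurable
  also have "ennreal \<bar>B\<bar> * \<dots> = ennreal (B powr s) * (\<integral>\<^sup>+y. ennreal (indicator {0<..} y * (y powr (s - 1) * exp (- B * y))) \<partial>lborel)"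
    using B by (simp add: mult.assoc[symmetric] ennreal_mult[symmetric] powr_mult_base)
  finally have *: "ennreal (Gamma s) = ennreal (B powr s) * (\<integral>\<^sup>+y. ennreal (indicator {0<..} y * (y powr (s - 1) * exp (- B * y))) \<partial>lborel)" .
  have "ennreal (Gamma s / B powr s) = ennreal (1 / B powr s) * ennreal (Gamma s)"
    using s by (simp add: ennreal_mult[symmetric] less_imp_le)
  also have "\<dots> = (\<integral>\<^sup>+y. ennreal (indicator {0<..} y * (y powr (s - 1) * exp (- B * y))) \<partial>lborel)"
    unfolding * using B by (simp add: mult.assoc[symmetric] ennreal_mult[symmetric])
  finally show ?thesis ..
qed

lemma suminf_ennreal_swap: "(\<Sum>i. \<Sum>j. f i j) = (\<Sum>j. \<Sum>i. f i j)" for f :: "nat \<Rightarrow> nat \<Rightarrow> ennreal"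
  using nn_integral_suminf[of "\<lambda>i j. f i j" "count_space UNIV"]
  by (simp add: nn_integral_count_space_nat)

lemma suminf_ennreal_shift:
  fixes f :: "nat \<Rightarrow> ennreal"
  shows "(\<Sum>m. if j \<le> m then f (m - j) else 0) = (\<Sum>m. f m)"
proof -
  let ?g = "\<lambda>m. if j \<le> m then f (m - j) else 0"
  have *: "(\<Sum>i<n + j. ?g i) = (\<Sum>i<n. f i)" for n
  proof -
    have "(\<Sum>i<n + j. ?g i) = (\<Sum>i<j + n. ?g i)" by (simp add: add.commute)
    also have "\<dots> = (\<Sum>i<j. ?g i) + (\<Sum>i<n. ?g (i + j))"
      by (induction n) (simp_all add: add.commute add.assoc)
    finally show ?thesis by simp
  qed
  have "(\<lambda>n. \<Sum>i<n. f i) \<longlonglongrightarrow> (\<Sum>m. f m)" using summable_LIMSEQ summableI by blast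
  then have "(\<lambda>n. \<Sum>i<n + j. ?g i) \<longlonglongrightarrow> (\<Sum>m. f m)" by (simp only: *)
  then have "(\<lambda>n. \<Sum>i<n. ?g i) \<longlonglongrightarrow> (\<Sum>m. f m)" by (rule LIMSEQ_offset)
  then show ?thesis by (metis sums_def sums_unique)
qed

lemma gbinomial_Gamma_shift:
  assumes a: "-1 < a" and "j \<le> m"
  shows "(real m + a) gchoose (m - j) = Gamma (real m + a + 1) / (fact (m - j) * Gamma (real j + a + 1))"
proof -
  have "(real m + a) gchoose (m - j) = pochhammer (real m + a - real (m - j) + 1) (m - j) / fact (m - j)"
    by (rule gbinomial_pochhammer')
  also have "real m + a - real (m - j) + 1 = real j + a + 1" using assms by (simp add: of_nat_diff)
  also have "pochhammer (real j + a + 1) (m - j) = Gamma (real j + a + 1 + real (m - j)) / Gamma (real j + a + 1)"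
    using a by (intro pochhammer_Gamma) (auto elim!: nonpos_Ints_cases)
  also have "real j + a + 1 + real (m - j) = real m + a + 1" using assms by (simp add: of_nat_diff)
  finally show ?thesis by simp
qed

text \<open>Vandermonde for \<open>k + (m + a)\<close> choose \<open>m\<close>, rewritten in Gamma
  values. It decouples \<open>k\<close> from \<open>m\<close>, which the factor
  \<open>Gamma (real k + real m + a + 1)\<close> ties together. The condition
  \<open>j \<le> k\<close> records that the binomial coefficient of the integer \<open>k\<close>
  vanishes beyond \<open>k\<close>.\<close>

lemma clifford_coefficient_identity:
  assumes a: "-1 < a"
  shows "Gamma (real k + real m + a + 1) / (fact k * Gamma (real k + a + 1) * (fact m * Gamma (real m + a + 1)))
   = (\<Sum>j\<le>m. if j \<le> k then 1 / (fact j * Gamma (real j + a + 1) * fact (k - j) * fact (m - j)) else 0)"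
proof -
  have pos: "0 < Gamma (real i + a + 1)" for i by (rule Gamma_shift_pos[OF a])
  have "(real k + (real m + a)) gchoose m = (\<Sum>j=0..m. (real k gchoose j) * ((real m + a) gchoose (m - j)))"
    by (rule gbinomial_Vandermonde[symmetric])
  also have "\<dots> = (\<Sum>j\<le>m. if j \<le> k then fact k / (fact j * fact (k - j)) * (Gamma (real m + a + 1) / (fact (m - j) * Gamma (real j + a + 1))) else 0)"
    unfolding atMost_atLeast0
  proof (intro sum.cong refl)
    fix j assume j: "j \<in> {0..m}"
    show "(real k gchoose j) * ((real m + a) gchoose (m - j)) =
      (if j \<le> k then fact k / (fact j * fact (k - j)) * (Gamma (real m + a + 1) / (fact (m - j) * Gamma (real j + a + 1))) else 0)"
    proof (cases "j \<le> k")
      case True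
      then have "real k gchoose j = fact k / (fact j * fact (k - j))"
        by (simp add: binomial_gbinomial[symmetric] binomial_fact)
      then show ?thesis using True j gbinomial_Gamma_shift[OF a, of j m] by simp
    next
      case False
      then show ?thesis by (simp add: binomial_gbinomial[symmetric])
    qed
  qed
  finally have 1: "(real k + (real m + a)) gchoose m = (\<Sum>j\<le>m. if j \<le> k then fact k / (fact j * fact (k - j)) * (Gamma (real m + a + 1) / (fact (m - j) * Gamma (real j + a + 1))) else 0)" .
  have "(real (k + m) + a) gchoose (k + m - k) = Gamma (real (k + m) + a + 1) / (fact (k + m - k) * Gamma (real k + a + 1))"
    by (rule gbinomial_Gamma_shift[OF a]) simp
  then have 2: "(real k + (real m + a)) gchoose m = Gamma (real k + real m + a + 1) / (fact m * Gamma (real k + a + 1))"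
    by (simp add: add.assoc)
  have "Gamma (real k + real m + a + 1) / (fact k * Gamma (real k + a + 1) * (fact m * Gamma (real m + a + 1)))
     = 1 / (fact k * Gamma (real m + a + 1)) * (Gamma (real k + real m + a + 1) / (fact m * Gamma (real k + a + 1)))"
    by simp
  also have "\<dots> = (\<Sum>j\<le>m. 1 / (fact k * Gamma (real m + a + 1)) * (if j \<le> k then fact k / (fact j * fact (k - j)) * (Gamma (real m + a + 1) / (fact (m - j) * Gamma (real j + a + 1))) else 0))"
    unfolding 2[symmetric] 1 by (rule sum_distrib_left)
  also have "\<dots> = (\<Sum>j\<le>m. if j \<le> k then 1 / (fact j * Gamma (real j + a + 1) * fact (k - j) * fact (m - j)) else 0)"
    using pos[of m] by (intro sum.cong refl) (simp add: mult_ac)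
  finally show ?thesis .
qed

lemma ennreal_exp_series:
  assumes "0 \<le> c" shows "(\<Sum>k. ennreal (c ^ k / fact k)) = ennreal (exp c)"
proof -
  have "(\<lambda>k. c ^ k / fact k) sums exp c"
    using exp_converges[of c] by (simp add: divide_inverse mult.commute)
  then show ?thesis using assms by (intro suminf_ennreal_eq) auto
qed

text \<open>For fixed \<open>j\<close> the sums over \<open>k\<close> and \<open>m\<close> separate
  into exponential series started at \<open>j\<close>, encoded in \<open>e\<close> and
  \<open>h\<close> as series that are zero before \<open>j\<close>. The remaining sum over
  \<open>j\<close> is the Clifford series at \<open>c * d\<close>. All terms are nonnegative, so the
  orders of summation may be exchanged.\<close>

lemma clifford_double_series:
  assumes a: "-1 < a" and c: "0 \<le> c" and d: "0 \<le> d"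
  shows "(\<Sum>k. \<Sum>m. ennreal (c ^ k / (fact k * Gamma (real k + a + 1)) * (d ^ m / (fact m * Gamma (real m + a + 1))) * Gamma (real k + real m + a + 1)))
    = ennreal (exp (c + d) * clifford a (c * d))"
proof -
  have pos: "0 < Gamma (real i + a + 1)" for i by (rule Gamma_shift_pos[OF a])
  define b where "b j = 1 / (fact j * Gamma (real j + a + 1))" for j
  have b: "0 \<le> b j" for j using pos[of j] by (simp add: b_def)
  define e where "e j k = (if j \<le> k then ennreal (c ^ j * (c ^ (k - j) / fact (k - j))) else 0)" for j k
  define h where "h j m = (if j \<le> m then ennreal (d ^ j * (d ^ (m - j) / fact (m - j))) else 0)" for j m
  have coeff: "ennreal (c ^ k / (fact k * Gamma (real k + a + 1)) * (d ^ m / (fact m * Gamma (real m + a + 1))) * Gamma (real k + real m + a + 1))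
     = (\<Sum>j. ennreal (b j) * (e j k * h j m))" for k m
  proof -
    have "c ^ k / (fact k * Gamma (real k + a + 1)) * (d ^ m / (fact m * Gamma (real m + a + 1))) * Gamma (real k + real m + a + 1)
       = (c ^ k * d ^ m) * (Gamma (real k + real m + a + 1) / (fact k * Gamma (real k + a + 1) * (fact m * Gamma (real m + a + 1))))"
      by simp
    also have "\<dots> = (\<Sum>j\<le>m. (c ^ k * d ^ m) * (if j \<le> k then 1 / (fact j * Gamma (real j + a + 1) * fact (k - j) * fact (m - j)) else 0))"
      unfolding clifford_coefficient_identity[OF a] by (rule sum_distrib_left)
    finally have "ennreal (c ^ k / (fact k * Gamma (real k + a + 1)) * (d ^ m / (fact m * Gamma (real m + a + 1))) * Gamma (real k + real m + a + 1))
      = ennreal (\<Sum>j\<le>m. (c ^ k * d ^ m) * (if j \<le> k then 1 / (fact j * Gamma (real j + a + 1) * fact (k - j) * fact (m - j)) else 0))"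
      by (rule arg_cong)
    also have "\<dots> = (\<Sum>j\<le>m. ennreal ((c ^ k * d ^ m) * (if j \<le> k then 1 / (fact j * Gamma (real j + a + 1) * fact (k - j) * fact (m - j)) else 0)))"
    proof (rule sum_ennreal[symmetric])
      fix j
      have eq: "1 / (fact j * Gamma (real j + a + 1) * fact (k - j) * fact (m - j)) = b j * (1 / (fact (k - j) * fact (m - j)))"
        by (simp add: b_def mult.assoc)
      have "0 \<le> c ^ k * d ^ m * (b j * (1 / (fact (k - j) * fact (m - j))))"
        using b[of j] c d by (intro mult_nonneg_nonneg) auto
      then show "0 \<le> c ^ k * d ^ m * (if j \<le> k then 1 / (fact j * Gamma (real j + a + 1) * fact (k - j) * fact (m - j)) else 0)"
        by (cases "j \<le> k") (simp_all only: eq if_True if_False mult_zero_right order_refl)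
    qed
    also have "\<dots> = (\<Sum>j\<le>m. ennreal (b j) * (e j k * h j m))"
    proof (intro sum.cong refl)
      fix j assume "j \<in> {..m}"
      then have j: "j \<le> m" by simp
      show "ennreal ((c ^ k * d ^ m) * (if j \<le> k then 1 / (fact j * Gamma (real j + a + 1) * fact (k - j) * fact (m - j)) else 0)) = ennreal (b j) * (e j k * h j m)"
      proof (cases "j \<le> k")
        case True
        have p: "c ^ j * c ^ (k - j) = c ^ k" "d ^ j * d ^ (m - j) = d ^ m"
          using True j by (simp_all flip: power_add)
        have "ennreal (b j) * (e j k * h j m) = ennreal (b j * ((c ^ j * c ^ (k - j) / fact (k - j)) * (d ^ j * d ^ (m - j) / fact (m - j))))"
          using True j b c d by (simp add: e_def h_def ennreal_mult[symmetric])
        then show ?thesis using True unfolding p by (simp add: b_def mult_ac)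
      qed (simp add: e_def)
    qed
    also have "\<dots> = (\<Sum>j. ennreal (b j) * (e j k * h j m))"
      by (rule suminf_finite[symmetric]) (auto simp: h_def)
    finally show ?thesis .
  qed
  have e_sum: "(\<Sum>k. e j k) = ennreal (c ^ j * exp c)" for j
  proof -
    have "(\<Sum>k. e j k) = (\<Sum>k. ennreal (c ^ j * (c ^ k / fact k)))"
      unfolding e_def by (rule suminf_ennreal_shift)
    also have "\<dots> = (\<Sum>k. ennreal (c ^ j) * ennreal (c ^ k / fact k))"
      using c by (intro arg_cong[where f=suminf] ext ennreal_mult) auto
    finally show ?thesis
      unfolding ennreal_suminf_cmult ennreal_exp_series[OF c] using c by (simp add: ennreal_mult)
  qed
  have h_sum: "(\<Sum>k. h j k) = ennreal (d ^ j * exp d)" for j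
  proof -
    have "(\<Sum>k. h j k) = (\<Sum>k. ennreal (d ^ j * (d ^ k / fact k)))"
      unfolding h_def by (rule suminf_ennreal_shift)
    also have "\<dots> = (\<Sum>k. ennreal (d ^ j) * ennreal (d ^ k / fact k))"
      using d by (intro arg_cong[where f=suminf] ext ennreal_mult) auto
    finally show ?thesis
      unfolding ennreal_suminf_cmult ennreal_exp_series[OF d] using d by (simp add: ennreal_mult)
  qed
  have "(\<Sum>k. \<Sum>m. \<Sum>j. ennreal (b j) * (e j k * h j m)) = (\<Sum>k. \<Sum>j. \<Sum>m. ennreal (b j) * (e j k * h j m))"
    by (intro arg_cong[where f=suminf] ext suminf_ennreal_swap)
  also have "\<dots> = (\<Sum>j. \<Sum>k. \<Sum>m. ennreal (b j) * (e j k * h j m))"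
    by (rule suminf_ennreal_swap)
  also have "\<dots> = (\<Sum>j. ennreal (b j) * (ennreal (c ^ j * exp c) * ennreal (d ^ j * exp d)))"
    by (simp add: ennreal_suminf_cmult ennreal_suminf_multc e_sum h_sum)
  also have "\<dots> = (\<Sum>j. ennreal (exp (c + d)) * ennreal ((c * d) ^ j / (fact j * Gamma (real j + a + 1))))"
    using c d b pos by (intro arg_cong[where f=suminf] ext)
      (simp add: ennreal_mult[symmetric] b_def exp_add power_mult_distrib less_imp_le mult_ac)
  also have "\<dots> = ennreal (exp (c + d)) * ennreal (clifford a (c * d))"
    using a c d by (simp add: ennreal_suminf_cmult ennreal_clifford)
  finally show ?thesis unfolding coeff using a c d by (simp add: ennreal_mult clifford_nonneg)
qed

text \<open>Weber's second exponential integral; the case \<open>d = 0\<close> yields the Laplace transform of the kernel.\<close>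

lemma weber_integral:
  assumes a: "-1 < a" and c: "0 \<le> c" and d: "0 \<le> d" and B: "0 < B"
  shows "(\<integral>\<^sup>+y. ennreal (indicator {0<..} y * (y powr a * exp (- B * y) * (clifford a (c * y) * clifford a (d * y)))) \<partial>lborel)
    = ennreal (B powr (- a - 1) * exp ((c + d) / B) * clifford a (c * d / B\<^sup>2))"
proof -
  have pos: "0 < Gamma (real i + a + 1)" for i by (rule Gamma_shift_pos[OF a])
  define b where "b x k = x ^ k / (fact k * Gamma (real k + a + 1))" for x :: real and k
  have b: "0 \<le> x \<Longrightarrow> 0 \<le> b x k" for x k using pos[of k] by (simp add: b_def)
  have "(\<integral>\<^sup>+y. ennreal (indicator {0<..} y * (y powr a * exp (- B * y) * (clifford a (c * y) * clifford a (d * y)))) \<partial>lborel)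
     = (\<integral>\<^sup>+y. (\<Sum>k. \<Sum>m. ennreal (b c k * b d m) * ennreal (indicator {0<..} y * (y powr (real k + real m + a + 1 - 1) * exp (- B * y)))) \<partial>lborel)"
  proof (intro nn_integral_cong)
    fix y :: real
    show "ennreal (indicator {0<..} y * (y powr a * exp (- B * y) * (clifford a (c * y) * clifford a (d * y))))
       = (\<Sum>k. \<Sum>m. ennreal (b c k * b d m) * ennreal (indicator {0<..} y * (y powr (real k + real m + a + 1 - 1) * exp (- B * y))))"
    proof (cases "0 < y")
      case y: True
      have cy: "0 \<le> c * y" "0 \<le> d * y" using c d y by auto
      have "ennreal (indicator {0<..} y * (y powr a * exp (- B * y) * (clifford a (c * y) * clifford a (d * y))))
        = ennreal (y powr a * exp (- B * y)) * (ennreal (clifford a (c * y)) * ennreal (clifford a (d * y)))"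
        using y cy a by (simp add: ennreal_mult[symmetric] clifford_nonneg)
      also have "\<dots> = (\<Sum>k. \<Sum>m. ennreal (y powr a * exp (- B * y)) * (ennreal (b (c * y) k) * ennreal (b (d * y) m)))"
        unfolding ennreal_clifford[OF a cy(1)] ennreal_clifford[OF a cy(2)] b_def[symmetric]
        by (simp add: ennreal_suminf_cmult ennreal_suminf_multc)
      also have "\<dots> = (\<Sum>k. \<Sum>m. ennreal (b c k * b d m) * ennreal (indicator {0<..} y * (y powr (real k + real m + a + 1 - 1) * exp (- B * y))))"
      proof (intro arg_cong[where f=suminf] ext)
        fix k m
        have "y powr (real k + real m + a) = y ^ k * y ^ m * y powr a"
          using y by (simp add: powr_add powr_realpow)
        then have "y powr a * exp (- B * y) * (b (c * y) k * b (d * y) m) = b c k * b d m * (y powr (real k + real m + a) * exp (- B * y))"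
          by (simp add: b_def power_mult_distrib mult_ac)
        then show "ennreal (y powr a * exp (- B * y)) * (ennreal (b (c * y) k) * ennreal (b (d * y) m))
          = ennreal (b c k * b d m) * ennreal (indicator {0<..} y * (y powr (real k + real m + a + 1 - 1) * exp (- B * y)))"
          using y b c d cy by (simp add: ennreal_mult[symmetric])
      qed
      finally show ?thesis .
    qed simp
  qed
  also have "\<dots> = (\<Sum>k. \<Sum>m. ennreal (b c k * b d m) * ennreal (Gamma (real k + real m + a + 1) / B powr (real k + real m + a + 1)))"
  proof -
    have "(\<integral>\<^sup>+y. ennreal (indicator {0<..} y * (y powr (real k + real m + a + 1 - 1) * exp (- B * y))) \<partial>lborel)
       = ennreal (Gamma (real k + real m + a + 1) / B powr (real k + real m + a + 1))" for k m
      by (rule nn_integral_Gamma) (use a B in auto)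
    then show ?thesis by (simp add: nn_integral_suminf nn_integral_cmult)
  qed
  also have "\<dots> = (\<Sum>k. \<Sum>m. ennreal (B powr (- a - 1)) * ennreal (b (c / B) k * b (d / B) m * Gamma (real k + real m + a + 1)))"
  proof (intro arg_cong[where f=suminf] ext)
    fix k m
    have g: "0 < Gamma (real k + real m + a + 1)" using pos[of "k + m"] by simp
    have "B powr (real k + real m + a + 1) = B ^ k * B ^ m * B powr (a + 1)"
      using B by (simp add: powr_add powr_realpow)
    moreover have "B powr (- a - 1) = 1 / B powr (a + 1)"
      using B powr_minus_divide[of B "a + 1"] by simp
    ultimately have "b c k * b d m * (Gamma (real k + real m + a + 1) / B powr (real k + real m + a + 1))
      = B powr (- a - 1) * (b (c / B) k * b (d / B) m * Gamma (real k + real m + a + 1))"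
      by (simp add: b_def power_divide)
    then show "ennreal (b c k * b d m) * ennreal (Gamma (real k + real m + a + 1) / B powr (real k + real m + a + 1))
       = ennreal (B powr (- a - 1)) * ennreal (b (c / B) k * b (d / B) m * Gamma (real k + real m + a + 1))"
      using b c d B g by (simp add: ennreal_mult[symmetric] less_imp_le)
  qed
  also have "\<dots> = ennreal (B powr (- a - 1)) * ennreal (exp (c / B + d / B) * clifford a (c / B * (d / B)))"
    using clifford_double_series[OF a, of "c / B" "d / B"] c d B
    by (simp add: ennreal_suminf_cmult b_def)
  also have "\<dots> = ennreal (B powr (- a - 1) * exp ((c + d) / B) * clifford a (c * d / B\<^sup>2))"
    using a c d B by (simp add: ennreal_mult[symmetric] clifford_nonneg add_divide_distrib power2_eq_square mult.assoc)
  finally show ?thesis .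
qed

section \<open>The Laguerre kernel\<close>

definition laguerre_weight :: "real \<Rightarrow> real \<Rightarrow> real" where
  "laguerre_weight a y = y powr a * exp (- y) / Gamma (a + 1)"

definition laguerre_kernel1 :: "real \<Rightarrow> real \<Rightarrow> real \<Rightarrow> real \<Rightarrow> real" where
  "laguerre_kernel1 a t x y = Gamma (a + 1) / (1 - exp (- t))
      * exp (- (exp (- t) / (1 - exp (- t))) * (x + y))
      * sqrt (exp (- t) * x * y) powr (- a)
      * bessel_I a (2 * sqrt (exp (- t) * x * y) / (1 - exp (- t)))"

lemma laguerre_kernel_eq_prod: "laguerre_kernel \<alpha> t x y = (\<Prod>j\<in>UNIV. laguerre_kernel1 (\<alpha> $ j) t (x $ j) (y $ j))"
  by (simp add: laguerre_kernel_def laguerre_kernel1_def)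

lemma measurable_laguerre_kernel1[measurable (raw)]:
  assumes [measurable]: "f \<in> borel_measurable N" "g \<in> borel_measurable N" "h \<in> borel_measurable N"
  shows "(\<lambda>x. laguerre_kernel1 a (f x) (g x) (h x)) \<in> borel_measurable N"
  unfolding laguerre_kernel1_def bessel_I_def by measurable

lemma measurable_laguerre_weight[measurable]: "laguerre_weight a \<in> borel_measurable borel"
  unfolding laguerre_weight_def[abs_def] by measurable

lemma laguerre_weight_nonneg: "-1 < a \<Longrightarrow> 0 \<le> laguerre_weight a y"
  by (simp add: laguerre_weight_def less_imp_le)

lemma laguerre_kernel1_eq:
  assumes a: "-1 < a" and t: "0 < t" and x: "0 < x" and y: "0 < y"
  shows "laguerre_kernel1 a t x y = Gamma (a + 1) * (1 - exp (- t)) powr (- a - 1)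
     * exp (- (exp (- t) / (1 - exp (- t))) * (x + y)) * clifford a (exp (- t) * x * y / (1 - exp (- t))\<^sup>2)"
proof -
  define v where "v = 1 - exp (- t)"
  have v: "0 < v" using t by (simp add: v_def)
  have "v powr (- a - 1) = v powr (- a) / v"
    using v by (simp add: powr_diff)
  then show ?thesis
    unfolding laguerre_kernel1_def v_def[symmetric]
    using bessel_I_eq_clifford[OF a _ v, of "exp (- t) * x * y"] x y by (simp add: mult.assoc)
qed

lemma laguerre_kernel1_nonneg: "-1 < a \<Longrightarrow> 0 < t \<Longrightarrow> 0 < x \<Longrightarrow> 0 < y \<Longrightarrow> 0 \<le> laguerre_kernel1 a t x y"
  by (simp add: laguerre_kernel1_eq clifford_nonneg less_imp_le)

lemma laguerre_kernel1_sym: "laguerre_kernel1 a t x y = laguerre_kernel1 a t y x"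
  unfolding laguerre_kernel1_def by (simp add: mult_ac add.commute)

text \<open>The Laplace transform in \<open>\<sigma>\<close> of the law at time \<open>t\<close> of
  the Laguerre diffusion started at \<open>x\<close>, a scaled noncentral chi-square law.\<close>

definition laguerre_laplace :: "real \<Rightarrow> real \<Rightarrow> real \<Rightarrow> real \<Rightarrow> real" where
  "laguerre_laplace a \<sigma> t x = (1 + \<sigma> * (1 - exp (- t))) powr (- a - 1)
     * exp (- (exp (- t) * \<sigma> * x / (1 + \<sigma> * (1 - exp (- t)))))"

lemma laguerre_laplace_nonneg: "0 \<le> laguerre_laplace a \<sigma> t x"
  by (simp add: laguerre_laplace_def)

lemma laguerre_kernel1_laplace:
  assumes a: "-1 < a" and t: "0 < t" and x: "0 < x" and s: "0 \<le> \<sigma>"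
  shows "(\<integral>\<^sup>+y. ennreal (indicator {0<..} y * (laguerre_weight a y * (laguerre_kernel1 a t x y * exp (- \<sigma> * y)))) \<partial>lborel)
    = ennreal (laguerre_laplace a \<sigma> t x)"
proof -
  define r v where "r = exp (- t)" and "v = 1 - r"
  have r: "0 < r" and v: "0 < v" "r = 1 - v" using t by (auto simp: r_def v_def)
  define D where "D = 1 + \<sigma> * v"
  have D: "0 < D" using v s by (auto simp: D_def intro!: add_pos_nonneg)
  \<comment> \<open>The total rate in \<open>y\<close>: weight, kernel and test function contribute
    \<open>1 + r / v + \<sigma>\<close>, and \<open>1 + r / v = 1 / v\<close>. The Clifford factor
    missing for Weber's integral is supplied by its constant value at zero,
    \<open>1 / Gamma (a + 1)\<close>.\<close>
  define B where "B = D / v"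
  have B: "0 < B" using D v by (simp add: B_def)
  define K where "K = v powr (- a - 1) * exp (- (r / v) * x) * Gamma (a + 1)"
  have G: "0 < Gamma (a + 1)" using a by simp
  have K: "0 \<le> K" using G by (simp add: K_def)
  have "(\<integral>\<^sup>+y. ennreal (indicator {0<..} y * (laguerre_weight a y * (laguerre_kernel1 a t x y * exp (- \<sigma> * y)))) \<partial>lborel)
     = (\<integral>\<^sup>+y. ennreal K * ennreal (indicator {0<..} y * (y powr a * exp (- B * y) * (clifford a (r * x / v\<^sup>2 * y) * clifford a (0 * y)))) \<partial>lborel)"
  proof (intro nn_integral_cong)
    fix y :: real
    show "ennreal (indicator {0<..} y * (laguerre_weight a y * (laguerre_kernel1 a t x y * exp (- \<sigma> * y))))
      = ennreal K * ennreal (indicator {0<..} y * (y powr a * exp (- B * y) * (clifford a (r * x / v\<^sup>2 * y) * clifford a (0 * y))))"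
    proof (cases "0 < y")
      case y: True
      have e: "exp (- y) * (exp (- (r / v) * (x + y)) * exp (- \<sigma> * y)) = exp (- (r / v) * x) * exp (- B * y)"
        unfolding exp_add[symmetric] using v(1)
        by (intro arg_cong[where f=exp]) (simp add: B_def D_def v(2) field_simps)
      have "laguerre_weight a y * (laguerre_kernel1 a t x y * exp (- \<sigma> * y))
        = y powr a * v powr (- a - 1) * (exp (- y) * (exp (- (r / v) * (x + y)) * exp (- \<sigma> * y))) * clifford a (r * x / v\<^sup>2 * y)"
        unfolding laguerre_kernel1_eq[OF a t x y] r_def[symmetric] v_def[symmetric] laguerre_weight_def
        using G by simp
      also have "\<dots> = K * (y powr a * exp (- B * y) * (clifford a (r * x / v\<^sup>2 * y) * clifford a (0 * y)))"
        unfolding e using G by (simp add: K_def clifford_0)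
      finally show ?thesis using y K by (simp add: ennreal_mult')
    qed simp
  qed
  also have "\<dots> = ennreal K * ennreal (B powr (- a - 1) * exp ((r * x / v\<^sup>2 + 0) / B) * clifford a (r * x / v\<^sup>2 * 0 / B\<^sup>2))"
  proof -
    have "0 \<le> r * x / v\<^sup>2" using r x by simp
    from weber_integral[OF a this order_refl B] show ?thesis
      by (subst nn_integral_cmult, measurable)
  qed
  also have "\<dots> = ennreal (K * (B powr (- a - 1) * exp (r * x / v\<^sup>2 / B) / Gamma (a + 1)))"
    unfolding ennreal_mult'[OF K, symmetric] by (simp add: clifford_0)
  finally have int: "(\<integral>\<^sup>+y. ennreal (indicator {0<..} y * (laguerre_weight a y * (laguerre_kernel1 a t x y * exp (- \<sigma> * y)))) \<partial>lborel)
    = ennreal (K * (B powr (- a - 1) * exp (r * x / v\<^sup>2 / B) / Gamma (a + 1)))" .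
  have "K * (B powr (- a - 1) * exp (r * x / v\<^sup>2 / B) / Gamma (a + 1)) = laguerre_laplace a \<sigma> t x"
  proof -
    have 1: "v powr (- a - 1) * B powr (- a - 1) = D powr (- a - 1)"
      using v D by (simp add: B_def powr_divide)
    have 2: "exp (- (r / v) * x) * exp (r * x / v\<^sup>2 / B) = exp (- (r * \<sigma> * x / D))"
      unfolding exp_add[symmetric]
    proof (rule arg_cong[where f=exp])
      have "r * x / v\<^sup>2 / B = r * x / (v * D)" using v D by (simp add: B_def power2_eq_square)
      moreover have "- (r / v) * x = - (r * x * D / (v * D))" using D by simp
      ultimately have "- (r / v) * x + r * x / v\<^sup>2 / B = (r * x - r * x * D) / (v * D)"
        by (simp add: diff_divide_distrib)
      also have "r * x - r * x * D = - (r * \<sigma> * x * v)" by (simp add: D_def algebra_simps)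
      finally show "- (r / v) * x + r * x / v\<^sup>2 / B = - (r * \<sigma> * x / D)" using v by simp
    qed
    have "K * (B powr (- a - 1) * exp (r * x / v\<^sup>2 / B) / Gamma (a + 1))
       = (v powr (- a - 1) * B powr (- a - 1)) * (exp (- (r / v) * x) * exp (r * x / v\<^sup>2 / B))"
      using G by (simp add: K_def)
    then show ?thesis unfolding 1 2 by (simp add: laguerre_laplace_def r_def v_def D_def)
  qed
  then show ?thesis unfolding int by simp
qed

lemma laguerre_kernel1_chapman:
  assumes a: "-1 < a" and s: "0 < s" and t: "0 < t" and x: "0 < x" and z: "0 < z"
  shows "(\<integral>\<^sup>+y. ennreal (indicator {0<..} y * (laguerre_weight a y * (laguerre_kernel1 a s x y * laguerre_kernel1 a t y z))) \<partial>lborel)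
    = ennreal (laguerre_kernel1 a (s + t) x z)"
proof -
  define r v where "r = exp (- s)" and "v = 1 - r"
  define q w where "q = exp (- t)" and "w = 1 - q"
  have r: "0 < r" and v: "0 < v" using s by (auto simp: r_def v_def)
  have q: "0 < q" and w: "0 < w" using t by (auto simp: q_def w_def)
  define D where "D = 1 - r * q"
  have D: "0 < D" using s t by (auto simp: D_def r_def q_def simp flip: exp_add)
  have Dst: "1 - exp (- (s + t)) = D" "exp (- (s + t)) = r * q" by (simp_all add: D_def r_def q_def exp_add exp_diff exp_minus field_simps)
  \<comment> \<open>The rate \<open>1 + r / v + q / w\<close> over the common denominator
    \<open>v * w\<close>; its numerator collapses to \<open>1 - r * q\<close>, which is
    \<open>1 - exp (- (s + t))\<close>.\<close>
  define B where "B = D / (v * w)"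
  have B: "0 < B" using D v w by (simp add: B_def)
  have G: "0 < Gamma (a + 1)" using a by simp
  define K where "K = Gamma (a + 1) * (v powr (- a - 1) * w powr (- a - 1)) * (exp (- (r / v) * x) * exp (- (q / w) * z))"
  have K: "0 \<le> K" using G by (simp add: K_def)
  have "(\<integral>\<^sup>+y. ennreal (indicator {0<..} y * (laguerre_weight a y * (laguerre_kernel1 a s x y * laguerre_kernel1 a t y z))) \<partial>lborel)
     = (\<integral>\<^sup>+y. ennreal K * ennreal (indicator {0<..} y * (y powr a * exp (- B * y) * (clifford a (r * x / v\<^sup>2 * y) * clifford a (q * z / w\<^sup>2 * y)))) \<partial>lborel)"
  proof (intro nn_integral_cong)
    fix y :: real
    show "ennreal (indicator {0<..} y * (laguerre_weight a y * (laguerre_kernel1 a s x y * laguerre_kernel1 a t y z)))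
      = ennreal K * ennreal (indicator {0<..} y * (y powr a * exp (- B * y) * (clifford a (r * x / v\<^sup>2 * y) * clifford a (q * z / w\<^sup>2 * y))))"
    proof (cases "0 < y")
      case y: True
      have e: "exp (- y) * (exp (- (r / v) * (x + y)) * exp (- (q / w) * (y + z))) = (exp (- (r / v) * x) * exp (- (q / w) * z)) * exp (- B * y)"
        unfolding exp_add[symmetric]
      proof (rule arg_cong[where f=exp])
        have "B = 1 + r / v + q / w"
          using v w by (simp add: B_def D_def field_simps) (simp add: v_def w_def algebra_simps)
        then show "- y + (- (r / v) * (x + y) + - (q / w) * (y + z)) = - (r / v) * x + - (q / w) * z + - B * y"
          by (simp add: algebra_simps add_divide_distrib)
      qed
      have "laguerre_weight a y * (laguerre_kernel1 a s x y * laguerre_kernel1 a t y z)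
        = Gamma (a + 1) * (y powr a * (v powr (- a - 1) * w powr (- a - 1)) * (exp (- y) * (exp (- (r / v) * (x + y)) * exp (- (q / w) * (y + z)))) *
           (clifford a (r * x * y / v\<^sup>2) * clifford a (q * y * z / w\<^sup>2)))"
        unfolding laguerre_kernel1_eq[OF a s x y] laguerre_kernel1_eq[OF a t y z]
          r_def[symmetric] v_def[symmetric] q_def[symmetric] w_def[symmetric] laguerre_weight_def
        using G by simp
      also have "\<dots> = K * (y powr a * exp (- B * y) * (clifford a (r * x / v\<^sup>2 * y) * clifford a (q * z / w\<^sup>2 * y)))"
        unfolding e by (simp add: K_def mult_ac)
      finally show ?thesis using y K by (simp add: ennreal_mult')
    qed simp
  qed
  also have "\<dots> = ennreal K * ennreal (B powr (- a - 1) * exp ((r * x / v\<^sup>2 + q * z / w\<^sup>2) / B) * clifford a (r * x / v\<^sup>2 * (q * z / w\<^sup>2) / B\<^sup>2))"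
  proof -
    have "0 \<le> r * x / v\<^sup>2" "0 \<le> q * z / w\<^sup>2" using r x q z by simp_all
    from weber_integral[OF a this B] show ?thesis
      by (subst nn_integral_cmult, measurable)
  qed
  also have "\<dots> = ennreal (K * (B powr (- a - 1) * exp ((r * x / v\<^sup>2 + q * z / w\<^sup>2) / B) * clifford a (r * x / v\<^sup>2 * (q * z / w\<^sup>2) / B\<^sup>2)))"
    unfolding ennreal_mult'[OF K, symmetric] ..
  finally have int: "(\<integral>\<^sup>+y. ennreal (indicator {0<..} y * (laguerre_weight a y * (laguerre_kernel1 a s x y * laguerre_kernel1 a t y z))) \<partial>lborel)
    = ennreal (K * (B powr (- a - 1) * exp ((r * x / v\<^sup>2 + q * z / w\<^sup>2) / B) * clifford a (r * x / v\<^sup>2 * (q * z / w\<^sup>2) / B\<^sup>2)))" .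
  have "K * (B powr (- a - 1) * exp ((r * x / v\<^sup>2 + q * z / w\<^sup>2) / B) * clifford a (r * x / v\<^sup>2 * (q * z / w\<^sup>2) / B\<^sup>2)) = laguerre_kernel1 a (s + t) x z"
  proof -
    have 1: "(v powr (- a - 1) * w powr (- a - 1)) * B powr (- a - 1) = D powr (- a - 1)"
      using v w D by (simp add: B_def powr_divide powr_mult)
    have 2: "(exp (- (r / v) * x) * exp (- (q / w) * z)) * exp ((r * x / v\<^sup>2 + q * z / w\<^sup>2) / B) = exp (- (r * q / D) * (x + z))"
      unfolding exp_add[symmetric]
    proof (rule arg_cong[where f=exp])
      have "(r * x / v\<^sup>2 + q * z / w\<^sup>2) / B = r * x * w / (v * D) + q * z * v / (w * D)"
        using v w D by (simp add: B_def power2_eq_square field_simps)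
      moreover have "- (r / v) * x + r * x * w / (v * D) = - (r * q / D) * x"
      proof -
        have "- (r / v) * x + r * x * w / (v * D) = r * x * (w - D) / (v * D)"
          using v D by (simp add: field_simps)
        also have "w - D = - (q * v)" by (simp add: w_def D_def v_def algebra_simps)
        finally show ?thesis using v by simp
      qed
      moreover have "- (q / w) * z + q * z * v / (w * D) = - (r * q / D) * z"
      proof -
        have "- (q / w) * z + q * z * v / (w * D) = q * z * (v - D) / (w * D)"
          using w D by (simp add: field_simps)
        also have "v - D = - (r * w)" by (simp add: w_def D_def v_def algebra_simps)
        finally show ?thesis using w by simp
      qed
      ultimately show "- (r / v) * x + - (q / w) * z + (r * x / v\<^sup>2 + q * z / w\<^sup>2) / B = - (r * q / D) * (x + z)"
        unfolding distrib_left by linarith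
    qed
    have 3: "r * x / v\<^sup>2 * (q * z / w\<^sup>2) / B\<^sup>2 = r * q * x * z / D\<^sup>2"
      using v w D by (simp add: B_def power_divide power_mult_distrib)
    have "K * (B powr (- a - 1) * exp ((r * x / v\<^sup>2 + q * z / w\<^sup>2) / B) * clifford a (r * x / v\<^sup>2 * (q * z / w\<^sup>2) / B\<^sup>2))
       = Gamma (a + 1) * ((v powr (- a - 1) * w powr (- a - 1)) * B powr (- a - 1)) *
         ((exp (- (r / v) * x) * exp (- (q / w) * z)) * exp ((r * x / v\<^sup>2 + q * z / w\<^sup>2) / B)) * clifford a (r * x / v\<^sup>2 * (q * z / w\<^sup>2) / B\<^sup>2)"
      unfolding K_def by (simp only: mult_ac)
    then show ?thesis
      unfolding 1 2 3 using laguerre_kernel1_eq[OF a _ x z, of "s + t"] s t unfolding Dst(1) unfolding Dst(2) by simp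
  qed
  then show ?thesis unfolding int by simp
qed

section \<open>The Laguerre measure and kernel as products over coordinates\<close>

lemma open_orthant: "open (orthant :: (real ^ 'd) set)"
proof -
  have "orthant = (\<Inter>i. {x :: real ^ 'd. 0 < x $ i})" by (auto simp: orthant_def)
  also have "open \<dots>" by (intro open_INT) (auto intro!: open_Collect_less continuous_intros)
  finally show ?thesis .
qed

lemma orthant_sets[measurable]: "(orthant :: (real ^ 'd) set) \<in> sets borel"
  using open_orthant by (rule borel_open)

lemma sets_laguerre_measure: "sets (laguerre_measure \<alpha>) = sets (restrict_space borel orthant)"
  unfolding laguerre_measure_def by (simp add: sets_restrict_space)

lemma space_laguerre_measure[simp]: "space (laguerre_measure \<alpha>) = orthant"
  unfolding laguerre_measure_def by (simp add: space_restrict_space)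

lemma measurable_laguerre_measureI: "f \<in> borel_measurable borel \<Longrightarrow> f \<in> borel_measurable (laguerre_measure \<alpha>)"
  by (subst measurable_cong_sets[OF sets_laguerre_measure refl]) (rule measurable_restrict_space1)

lemma measurable_vec_nth_borel[measurable]: "(\<lambda>x :: real ^ 'd. x $ i) \<in> borel_measurable borel"
  by (rule borel_measurable_continuous_onI, rule continuous_on_component, rule continuous_on_id)

lemma measurable_laguerre_coordinate:
  fixes f :: "_ \<Rightarrow> real ^ 'd"
  assumes "f \<in> measurable N (laguerre_measure \<alpha>)"
  shows "(\<lambda>x. f x $ i) \<in> borel_measurable N"
  by (rule measurable_compose[OF assms measurable_laguerre_measureI[OF measurable_vec_nth_borel]])

lemma inj_axis: "inj (\<lambda>i. axis i (1::real) :: real ^ 'd)"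
  by (auto simp: inj_on_def axis_eq_axis)

lemma Basis_vec_eq_range: "(Basis :: (real ^ 'd) set) = range (\<lambda>i. axis i 1)"
  by (auto simp: Basis_vec_def)

lemma prod_Basis_vec:
  fixes f :: "'d::finite \<Rightarrow> 'b::comm_monoid_mult"
  shows "(\<Prod>b\<in>(Basis :: (real ^ 'd) set). f (the_inv (\<lambda>i. axis i (1::real)) b)) = (\<Prod>i\<in>UNIV. f i)"
  unfolding Basis_vec_eq_range prod.reindex[OF inj_axis] by (simp add: the_inv_f_f[OF inj_axis])

lemma vec_nth_the_inv_axis:
  fixes x :: "real ^ 'd"
  assumes "b \<in> Basis"
  shows "x $ the_inv (\<lambda>i. axis i (1::real)) b = x \<bullet> b"
proof -
  obtain i where "b = axis i 1" using assms unfolding Basis_vec_eq_range by blast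
  then show ?thesis using the_inv_f_f[OF inj_axis, of i] cart_eq_inner_axis[of x i] by metis
qed

text \<open>Tonelli for \<open>lborel\<close> is indexed by basis vectors; inverting
  \<open>\<lambda>i. axis i 1\<close> converts between basis vectors and coordinate indices.\<close>

lemma nn_integral_lborel_vec_prod:
  fixes f :: "'d::finite \<Rightarrow> real \<Rightarrow> ennreal"
  assumes [measurable]: "\<And>i. f i \<in> borel_measurable borel"
  shows "(\<integral>\<^sup>+x. (\<Prod>i\<in>UNIV. f i ((x :: real ^ 'd) $ i)) \<partial>lborel) = (\<Prod>i\<in>UNIV. \<integral>\<^sup>+y. f i y \<partial>lborel)"
proof -
  define g where "g = (\<lambda>b :: real ^ 'd. f (the_inv (\<lambda>i. axis i (1::real)) b))"
  have prod: "(\<Prod>i\<in>UNIV. f i (x $ i)) = (\<Prod>b\<in>Basis. g b (x \<bullet> b))" for x :: "real ^ 'd"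
    unfolding prod_Basis_vec[symmetric, of "\<lambda>i. f i (x $ i)"]
    by (intro prod.cong refl) (simp only: g_def vec_nth_the_inv_axis)
  have "(\<integral>\<^sup>+x. (\<Prod>i\<in>UNIV. f i ((x :: real ^ 'd) $ i)) \<partial>lborel) = (\<Prod>b\<in>Basis. \<integral>\<^sup>+y. g b y \<partial>lborel)"
    unfolding prod by (rule nn_integral_lborel_prod) (auto simp: g_def)
  also have "\<dots> = (\<Prod>i\<in>UNIV. \<integral>\<^sup>+y. f i y \<partial>lborel)"
    unfolding g_def by (rule prod_Basis_vec)
  finally show ?thesis .
qed

lemma nn_integral_laguerre_prod:
  fixes \<alpha> :: "real ^ 'd" and f :: "'d \<Rightarrow> real \<Rightarrow> real"
  assumes \<alpha>: "\<And>i. -1 < \<alpha> $ i" and f[measurable]: "\<And>i. f i \<in> borel_measurable borel"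
    and nn: "\<And>i y. 0 < y \<Longrightarrow> 0 \<le> f i y"
  shows "(\<integral>\<^sup>+y. ennreal (\<Prod>i\<in>UNIV. f i (y $ i)) \<partial>laguerre_measure \<alpha>)
    = (\<Prod>i\<in>UNIV. \<integral>\<^sup>+y. ennreal (indicator {0<..} y * (laguerre_weight (\<alpha> $ i) y * f i y)) \<partial>lborel)"
proof -
  let ?w = "\<lambda>x :: real ^ 'd. ennreal (\<Prod>i\<in>UNIV. laguerre_weight (\<alpha> $ i) (x $ i))"
  have M: "laguerre_measure \<alpha> = density (restrict_space lborel orthant) ?w"
    by (simp add: laguerre_measure_def laguerre_weight_def)
  have 1: "?w \<in> borel_measurable (restrict_space lborel orthant)"
    by (rule measurable_restrict_space1) measurable
  have 2: "(\<lambda>y :: real ^ 'd. ennreal (\<Prod>i\<in>UNIV. f i (y $ i))) \<in> borel_measurable (restrict_space lborel orthant)"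
    by (rule measurable_restrict_space1) measurable
  have "(\<integral>\<^sup>+y. ennreal (\<Prod>i\<in>UNIV. f i (y $ i)) \<partial>laguerre_measure \<alpha>)
     = (\<integral>\<^sup>+y. ?w y * ennreal (\<Prod>i\<in>UNIV. f i (y $ i)) * indicator orthant y \<partial>lborel)"
    unfolding M using 1 2
    by (subst nn_integral_density) (auto simp: nn_integral_restrict_space)
  also have "\<dots> = (\<integral>\<^sup>+y. (\<Prod>i\<in>UNIV. ennreal (indicator {0<..} (y $ i) * (laguerre_weight (\<alpha> $ i) (y $ i) * f i (y $ i)))) \<partial>lborel)"
  proof (intro nn_integral_cong)
    fix y :: "real ^ 'd"
    show "?w y * ennreal (\<Prod>i\<in>UNIV. f i (y $ i)) * indicator orthant y
      = (\<Prod>i\<in>UNIV. ennreal (indicator {0<..} (y $ i) * (laguerre_weight (\<alpha> $ i) (y $ i) * f i (y $ i))))"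
    proof (cases "y \<in> orthant")
      case True
      then have y: "0 < y $ i" for i by (simp add: orthant_def)
      have w: "0 \<le> laguerre_weight (\<alpha> $ i) (y $ i)" for i by (rule laguerre_weight_nonneg[OF \<alpha>])
      have "?w y * ennreal (\<Prod>i\<in>UNIV. f i (y $ i)) * indicator orthant y
         = ennreal (\<Prod>i\<in>UNIV. laguerre_weight (\<alpha> $ i) (y $ i) * f i (y $ i))"
        using True w nn[OF y] by (simp add: ennreal_mult[symmetric] prod_nonneg prod.distrib)
      also have "\<dots> = (\<Prod>i\<in>UNIV. ennreal (laguerre_weight (\<alpha> $ i) (y $ i) * f i (y $ i)))"
        using w nn[OF y] by (intro prod_ennreal[symmetric]) auto
      finally show ?thesis using y by simp
    next
      case False
      then obtain i where "\<not> 0 < y $ i" by (auto simp: orthant_def)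
      then show ?thesis using False by (auto intro!: prod_zero[symmetric] exI[of _ i])
    qed
  qed
  also have "\<dots> = (\<Prod>i\<in>UNIV. \<integral>\<^sup>+y. ennreal (indicator {0<..} y * (laguerre_weight (\<alpha> $ i) y * f i y)) \<partial>lborel)"
    by (rule nn_integral_lborel_vec_prod) measurable
  finally show ?thesis .
qed

text \<open>Only coordinate \<open>j\<close> carries the exponent \<open>\<sigma>\<close>; every
  other factor is a transform at zero, that is, one. The case \<open>\<sigma> = 0\<close> is
  conservation of mass.\<close>

lemma laguerre_kernel_laplace:
  fixes \<alpha> :: "real ^ 'd"
  assumes \<alpha>: "\<And>i. -1 < \<alpha> $ i" and t: "0 < t" and x: "x \<in> orthant" and s: "0 \<le> \<sigma>"
  shows "(\<integral>\<^sup>+y. ennreal (laguerre_kernel \<alpha> t x y * exp (- \<sigma> * y $ j)) \<partial>laguerre_measure \<alpha>)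
    = ennreal (laguerre_laplace (\<alpha> $ j) \<sigma> t (x $ j))"
proof -
  have x: "0 < x $ i" for i using x by (simp add: orthant_def)
  define \<tau> where "\<tau> i = (if i = j then \<sigma> else 0)" for i
  have \<tau>: "0 \<le> \<tau> i" for i using s by (simp add: \<tau>_def)
  have eq: "laguerre_kernel \<alpha> t x y * exp (- \<sigma> * y $ j) = (\<Prod>i\<in>UNIV. laguerre_kernel1 (\<alpha> $ i) t (x $ i) (y $ i) * exp (- \<tau> i * y $ i))" for y :: "real ^ 'd"
  proof -
    have "(\<Prod>i\<in>UNIV. exp (- \<tau> i * y $ i)) = (\<Prod>i\<in>UNIV. if i = j then exp (- \<sigma> * y $ j) else 1)"
      by (intro prod.cong) (auto simp: \<tau>_def)
    also have "\<dots> = exp (- \<sigma> * y $ j)" by (simp add: prod.delta')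
    finally show ?thesis by (simp add: laguerre_kernel_eq_prod prod.distrib)
  qed
  have "(\<integral>\<^sup>+y. ennreal (laguerre_kernel \<alpha> t x y * exp (- \<sigma> * y $ j)) \<partial>laguerre_measure \<alpha>)
    = (\<Prod>i\<in>UNIV. \<integral>\<^sup>+y. ennreal (indicator {0<..} y * (laguerre_weight (\<alpha> $ i) y * (laguerre_kernel1 (\<alpha> $ i) t (x $ i) y * exp (- \<tau> i * y)))) \<partial>lborel)"
    unfolding eq using laguerre_kernel1_nonneg[OF \<alpha> t x]
    by (intro nn_integral_laguerre_prod[OF \<alpha>, of "\<lambda>i y. laguerre_kernel1 (\<alpha> $ i) t (x $ i) y * exp (- \<tau> i * y)"]) auto
  also have "\<dots> = (\<Prod>i\<in>UNIV. ennreal (laguerre_laplace (\<alpha> $ i) (\<tau> i) t (x $ i)))"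
    by (intro prod.cong refl laguerre_kernel1_laplace \<alpha> t x \<tau>)
  also have "\<dots> = (\<Prod>i\<in>UNIV. if i = j then ennreal (laguerre_laplace (\<alpha> $ j) \<sigma> t (x $ j)) else 1)"
    by (intro prod.cong) (auto simp: \<tau>_def laguerre_laplace_def)
  also have "\<dots> = ennreal (laguerre_laplace (\<alpha> $ j) \<sigma> t (x $ j))" by (simp add: prod.delta')
  finally show ?thesis .
qed

lemma laguerre_kernel_nonneg:
  fixes \<alpha> :: "real ^ 'd"
  assumes "\<And>i. -1 < \<alpha> $ i" "0 < t" "x \<in> orthant" "y \<in> orthant"
  shows "0 \<le> laguerre_kernel \<alpha> t x y"
  unfolding laguerre_kernel_eq_prod using assms
  by (intro prod_nonneg laguerre_kernel1_nonneg) (auto simp: orthant_def)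

lemma laguerre_kernel_chapman:
  fixes \<alpha> :: "real ^ 'd"
  assumes \<alpha>: "\<And>i. -1 < \<alpha> $ i" and s: "0 < s" and t: "0 < t" and x: "x \<in> orthant" and z: "z \<in> orthant"
  shows "(\<integral>\<^sup>+y. ennreal (laguerre_kernel \<alpha> s x y) * ennreal (laguerre_kernel \<alpha> t y z) \<partial>laguerre_measure \<alpha>)
    = ennreal (laguerre_kernel \<alpha> (s + t) x z)"
proof -
  have x': "0 < x $ i" and z': "0 < z $ i" for i using x z by (simp_all add: orthant_def)
  have "(\<integral>\<^sup>+y. ennreal (laguerre_kernel \<alpha> s x y) * ennreal (laguerre_kernel \<alpha> t y z) \<partial>laguerre_measure \<alpha>)
    = (\<integral>\<^sup>+y. ennreal (\<Prod>i\<in>UNIV. laguerre_kernel1 (\<alpha> $ i) s (x $ i) (y $ i) * laguerre_kernel1 (\<alpha> $ i) t (y $ i) (z $ i)) \<partial>laguerre_measure \<alpha>)"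
    using laguerre_kernel_nonneg[OF \<alpha>] s t x z
    by (intro nn_integral_cong) (simp add: ennreal_mult[symmetric] prod.distrib flip: laguerre_kernel_eq_prod)
  also have "\<dots> = (\<Prod>i\<in>UNIV. \<integral>\<^sup>+y. ennreal (indicator {0<..} y * (laguerre_weight (\<alpha> $ i) y * (laguerre_kernel1 (\<alpha> $ i) s (x $ i) y * laguerre_kernel1 (\<alpha> $ i) t y (z $ i)))) \<partial>lborel)"
    using laguerre_kernel1_nonneg[OF \<alpha>] s t x' z'
    by (intro nn_integral_laguerre_prod[OF \<alpha>, of "\<lambda>i y. laguerre_kernel1 (\<alpha> $ i) s (x $ i) y * laguerre_kernel1 (\<alpha> $ i) t y (z $ i)"]) auto
  also have "\<dots> = (\<Prod>i\<in>UNIV. ennreal (laguerre_kernel1 (\<alpha> $ i) (s + t) (x $ i) (z $ i)))"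
    by (intro prod.cong refl laguerre_kernel1_chapman \<alpha> s t x' z')
  also have "\<dots> = ennreal (laguerre_kernel \<alpha> (s + t) x z)"
    unfolding laguerre_kernel_eq_prod using s t
    by (intro prod_ennreal laguerre_kernel1_nonneg \<alpha> x' z') auto
  finally show ?thesis .
qed

lemma prob_space_laguerre_measure:
  fixes \<alpha> :: "real ^ 'd"
  assumes \<alpha>: "\<And>i. -1 < \<alpha> $ i"
  shows "prob_space (laguerre_measure \<alpha>)"
proof
  have "emeasure (laguerre_measure \<alpha>) orthant = (\<integral>\<^sup>+y. indicator orthant y \<partial>laguerre_measure \<alpha>)"
    using sets.top[of "laguerre_measure \<alpha>"] by simp
  also have "\<dots> = (\<integral>\<^sup>+y. ennreal (\<Prod>i\<in>UNIV. (\<lambda>i y. 1) i (y $ i)) \<partial>laguerre_measure \<alpha>)"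
    by (intro nn_integral_cong) simp
  also have "\<dots> = (\<Prod>i\<in>UNIV. \<integral>\<^sup>+y. ennreal (indicator {0<..} y * (laguerre_weight (\<alpha> $ i) y * 1)) \<partial>lborel)"
    by (rule nn_integral_laguerre_prod[OF \<alpha>]) auto
  also have "\<dots> = (\<Prod>i\<in>(UNIV :: 'd set). 1)"
  proof (intro prod.cong refl)
    fix i :: 'd
    have a: "-1 < \<alpha> $ i" by (rule \<alpha>)
    then have G: "0 < Gamma (\<alpha> $ i + 1)" by simp
    have "(\<integral>\<^sup>+y. ennreal (indicator {0<..} y * (laguerre_weight (\<alpha> $ i) y * 1)) \<partial>lborel)
       = (\<integral>\<^sup>+y. ennreal (1 / Gamma (\<alpha> $ i + 1)) * ennreal (indicator {0<..} y * (y powr (\<alpha> $ i + 1 - 1) * exp (- 1 * y))) \<partial>lborel)"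
      using G by (intro nn_integral_cong) (simp add: laguerre_weight_def ennreal_mult'[symmetric] mult_ac)
    also have "\<dots> = ennreal (1 / Gamma (\<alpha> $ i + 1)) * (\<integral>\<^sup>+y. ennreal (indicator {0<..} y * (y powr (\<alpha> $ i + 1 - 1) * exp (- 1 * y))) \<partial>lborel)"
      by (rule nn_integral_cmult) measurable
    also have "(\<integral>\<^sup>+y. ennreal (indicator {0<..} y * (y powr (\<alpha> $ i + 1 - 1) * exp (- 1 * y))) \<partial>lborel) = ennreal (Gamma (\<alpha> $ i + 1) / 1 powr (\<alpha> $ i + 1))"
      by (rule nn_integral_Gamma) (use a in auto)
    finally show "(\<integral>\<^sup>+y. ennreal (indicator {0<..} y * (laguerre_weight (\<alpha> $ i) y * 1)) \<partial>lborel) = 1"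
      using G by (simp add: ennreal_mult'[symmetric])
  qed
  finally show "emeasure (laguerre_measure \<alpha>) (space (laguerre_measure \<alpha>)) = 1" by simp
qed

text \<open>A generator whose members have negligible boundary within the orthant. A kernel
  concentrating at its starting point settles membership in an open box unless it starts on a face,
  so the exceptional starting points form a null set.\<close>

definition orthant_boxes :: "(real ^ 'd) set set" where
  "orthant_boxes = range (\<lambda>(a, b). orthant \<inter> box a b)"

lemma tendsto_laguerre_laplace: "((\<lambda>t. laguerre_laplace a \<sigma> t x) \<longlongrightarrow> exp (- \<sigma> * x)) (at_right 0)"
proof -
  have "((\<lambda>t. laguerre_laplace a \<sigma> t x) \<longlongrightarrow> (1 + \<sigma> * (1 - exp (- 0))) powr (- a - 1)
     * exp (- (exp (- 0) * \<sigma> * x / (1 + \<sigma> * (1 - exp (- 0)))))) (at_right 0)"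
    unfolding laguerre_laplace_def by (intro tendsto_intros) auto
  then show ?thesis by simp
qed

text \<open>Points to the right of \<open>x\<close> are the unfavourable ones, since
  \<open>exp (- y)\<close> flattens there; to the left the gap is larger because
  \<open>exp e - 1 \<ge> 1 - exp (- e)\<close>. The lower bound does not depend on
  \<open>y\<close>.\<close>

lemma exp_minus_separated:
  fixes x y e :: real
  assumes "e \<le> \<bar>y - x\<bar>" and e: "0 < e"
  shows "exp (- x) * (1 - exp (- e)) \<le> \<bar>exp (- y) - exp (- x)\<bar>"
proof (cases "x \<le> y")
  case True
  then have "exp (- y) \<le> exp (- x + - e)" using assms by (subst exp_le_cancel_iff) simp
  then show ?thesis unfolding exp_add by (simp add: right_diff_distrib)
next
  case False
  then have "exp (- x + e) \<le> exp (- y)" using assms by (subst exp_le_cancel_iff) simp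
  then have "exp (- x) * exp e \<le> exp (- y)" unfolding exp_add .
  moreover have "exp (- x) * (2 - exp (- e)) \<le> exp (- x) * exp e"
  proof (rule mult_left_mono)
    have "1 + - e \<le> exp (- e)" "1 + e \<le> exp e" by (rule exp_ge_add_one_self)+
    then show "2 - exp (- e) \<le> exp e" by linarith
  qed simp
  ultimately show ?thesis by (simp add: algebra_simps)
qed

text \<open>In the coordinate \<open>exp (- y)\<close> the second moment about the starting point is a combination of three Laplace
  transforms, so concentration needs no moments of the kernel itself.\<close>

lemma laguerre_kernel_second_moment:
  fixes \<alpha> :: "real ^ 'd"
  assumes \<alpha>: "\<And>i. -1 < \<alpha> $ i" and x: "x \<in> orthant" and meas: "\<And>t. laguerre_kernel \<alpha> t x \<in> borel_measurable (laguerre_measure \<alpha>)"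
  shows "((\<lambda>t. \<integral>\<^sup>+y. ennreal (laguerre_kernel \<alpha> t x y * (exp (- (y $ j)) - exp (- (x $ j)))\<^sup>2) \<partial>laguerre_measure \<alpha>) \<longlongrightarrow> 0) (at_right 0)"
proof -
  let ?M = "laguerre_measure \<alpha>" and ?c = "exp (- (x $ j))"
  let ?L = "\<lambda>\<sigma> t. laguerre_laplace (\<alpha> $ j) \<sigma> t (x $ j)"
  define V where "V t = (\<integral>\<^sup>+y. ennreal (laguerre_kernel \<alpha> t x y * (exp (- (y $ j)) - ?c)\<^sup>2) \<partial>?M)" for t
  have [measurable]: "(\<lambda>y. y $ j) \<in> borel_measurable ?M"
    by (rule measurable_laguerre_coordinate[where \<alpha>=\<alpha>]) (rule measurable_ident_sets[OF refl])
  note [measurable] = meas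
  have V: "V t = ennreal (?L 2 t + ?c\<^sup>2 * ?L 0 t - 2 * ?c * ?L 1 t)" if t: "0 < t" for t
  proof -
    have nn: "0 \<le> laguerre_kernel \<alpha> t x y" if "y \<in> orthant" for y
      by (rule laguerre_kernel_nonneg[OF \<alpha> t x that])
    have lap: "(\<integral>\<^sup>+y. ennreal (laguerre_kernel \<alpha> t x y * exp (- \<sigma> * y $ j)) \<partial>?M) = ennreal (?L \<sigma> t)" if "0 \<le> \<sigma>" for \<sigma>
      by (rule laguerre_kernel_laplace[OF \<alpha> t x that])
    \<comment> \<open>The square is expanded with the mixed term moved to the left-hand side, since
      extended nonnegative numbers do not allow cancelling a subtraction; finiteness of
      \<open>V t\<close> is extracted afterwards.\<close>
    have "V t + ennreal (2 * ?c) * ennreal (?L 1 t) =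
      (\<integral>\<^sup>+y. ennreal (laguerre_kernel \<alpha> t x y * (exp (- (y $ j)) - ?c)\<^sup>2) + ennreal (2 * ?c) * ennreal (laguerre_kernel \<alpha> t x y * exp (- 1 * y $ j)) \<partial>?M)"
      unfolding V_def lap[OF zero_le_one, symmetric]
      by (subst nn_integral_add, measurable, subst nn_integral_cmult) simp_all
    also have "\<dots> = (\<integral>\<^sup>+y. ennreal (laguerre_kernel \<alpha> t x y * exp (- 2 * y $ j)) + ennreal (?c\<^sup>2) * ennreal (laguerre_kernel \<alpha> t x y * exp (- 0 * y $ j)) \<partial>?M)"
    proof (intro nn_integral_cong)
      fix y assume "y \<in> space ?M"
      then have y: "0 \<le> laguerre_kernel \<alpha> t x y" using nn by simp
      have e: "exp (- 2 * y $ j) = exp (- (y $ j)) * exp (- (y $ j))" by (simp flip: exp_add)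
      have "laguerre_kernel \<alpha> t x y * (exp (- (y $ j)) - ?c)\<^sup>2 + 2 * ?c * (laguerre_kernel \<alpha> t x y * exp (- 1 * y $ j))
        = laguerre_kernel \<alpha> t x y * exp (- 2 * y $ j) + ?c\<^sup>2 * (laguerre_kernel \<alpha> t x y * exp (- 0 * y $ j))"
        unfolding e by (simp add: power2_eq_square algebra_simps)
      then show "ennreal (laguerre_kernel \<alpha> t x y * (exp (- (y $ j)) - ?c)\<^sup>2) + ennreal (2 * ?c) * ennreal (laguerre_kernel \<alpha> t x y * exp (- 1 * y $ j))
         = ennreal (laguerre_kernel \<alpha> t x y * exp (- 2 * y $ j)) + ennreal (?c\<^sup>2) * ennreal (laguerre_kernel \<alpha> t x y * exp (- 0 * y $ j))"
        using y by (simp add: ennreal_mult'[symmetric] ennreal_plus[symmetric] del: ennreal_plus)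
    qed
    also have "\<dots> = ennreal (?L 2 t) + ennreal (?c\<^sup>2) * ennreal (?L 0 t)"
    proof -
      have "(\<integral>\<^sup>+y. ennreal (laguerre_kernel \<alpha> t x y * exp (- 2 * y $ j)) + ennreal (?c\<^sup>2) * ennreal (laguerre_kernel \<alpha> t x y * exp (- 0 * y $ j)) \<partial>?M)
        = (\<integral>\<^sup>+y. ennreal (laguerre_kernel \<alpha> t x y * exp (- 2 * y $ j)) \<partial>?M) + ennreal (?c\<^sup>2) * (\<integral>\<^sup>+y. ennreal (laguerre_kernel \<alpha> t x y * exp (- 0 * y $ j)) \<partial>?M)"
        by (subst nn_integral_add, measurable, subst nn_integral_cmult) simp_all
      then show ?thesis unfolding lap[OF order_refl] lap[of 2, simplified] by (simp add: lap[of 2, simplified])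
    qed
    finally have eq: "V t + ennreal (2 * ?c * ?L 1 t) = ennreal (?L 2 t + ?c\<^sup>2 * ?L 0 t)"
      by (simp add: ennreal_mult'[symmetric] ennreal_plus[symmetric] laguerre_laplace_nonneg del: ennreal_plus)
    then have "V t \<noteq> top" by (metis ennreal_add_eq_top ennreal_neq_top)
    then obtain v where v: "V t = ennreal v" "0 \<le> v" by (cases "V t") auto
    have nn: "0 \<le> 2 * ?c * ?L 1 t" "0 \<le> ?L 2 t + ?c\<^sup>2 * ?L 0 t" by (auto simp: laguerre_laplace_nonneg)
    have "ennreal (v + 2 * ?c * ?L 1 t) = ennreal (?L 2 t + ?c\<^sup>2 * ?L 0 t)"
      using eq v nn by simp
    then have "v + 2 * ?c * ?L 1 t = ?L 2 t + ?c\<^sup>2 * ?L 0 t" using v nn by (subst (asm) ennreal_inj) auto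
    then show ?thesis using v by (simp add: algebra_simps)
  qed
  have "((\<lambda>t. ennreal (?L 2 t + ?c\<^sup>2 * ?L 0 t - 2 * ?c * ?L 1 t)) \<longlongrightarrow> ennreal (exp (- 2 * x $ j) + ?c\<^sup>2 * exp (- 0 * x $ j) - 2 * ?c * exp (- 1 * x $ j))) (at_right 0)"
    by (intro tendsto_ennrealI tendsto_intros tendsto_laguerre_laplace)
  also have "exp (- 2 * x $ j) + ?c\<^sup>2 * exp (- 0 * x $ j) - 2 * ?c * exp (- 1 * x $ j) = 0"
    using exp_add[of "- (x $ j)" "- (x $ j)"] by (simp add: power2_eq_square)
  finally have "((\<lambda>t. ennreal (?L 2 t + ?c\<^sup>2 * ?L 0 t - 2 * ?c * ?L 1 t)) \<longlongrightarrow> 0) (at_right 0)" by simp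
  moreover have "\<forall>\<^sub>F t in at_right 0. ennreal (?L 2 t + ?c\<^sup>2 * ?L 0 t - 2 * ?c * ?L 1 t) = V t"
    using eventually_at_right_less[of "0::real"] by eventually_elim (simp add: V)
  ultimately show ?thesis unfolding V_def[symmetric] by (rule Lim_transform_eventually)
qed

text \<open>Chebyshev's inequality in the coordinates \<open>exp (- y)\<close>: at each point of
  \<open>D\<close> some coordinate contributes at least \<open>d j\<close> to a second moment.
  Summing over all \<open>j\<close> avoids having to choose that coordinate measurably.\<close>

lemma laguerre_kernel_concentrate:
  fixes \<alpha> :: "real ^ 'd"
  assumes \<alpha>: "\<And>i. -1 < \<alpha> $ i" and x: "x \<in> orthant" and meas: "\<And>t. laguerre_kernel \<alpha> t x \<in> borel_measurable (laguerre_measure \<alpha>)"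
    and e: "0 < e" and D: "\<And>y. y \<in> D \<Longrightarrow> \<exists>j. e \<le> \<bar>y $ j - x $ j\<bar>"
  shows "((\<lambda>t. \<integral>\<^sup>+y. ennreal (laguerre_kernel \<alpha> t x y) * indicator D y \<partial>laguerre_measure \<alpha>) \<longlongrightarrow> 0) (at_right 0)"
proof -
  let ?M = "laguerre_measure \<alpha>"
  define d where "d j = (exp (- (x $ j)) * (1 - exp (- e)))\<^sup>2" for j
  have d: "0 < d j" for j using e by (simp add: d_def)
  let ?V = "\<lambda>j t. \<integral>\<^sup>+y. ennreal (laguerre_kernel \<alpha> t x y * (exp (- (y $ j)) - exp (- (x $ j)))\<^sup>2) \<partial>?M"
  have [measurable]: "(\<lambda>y. y $ j) \<in> borel_measurable ?M" for j
    by (rule measurable_laguerre_coordinate[where \<alpha>=\<alpha>]) (rule measurable_ident_sets[OF refl])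
  note [measurable] = meas
  have "((\<lambda>t. \<Sum>j\<in>UNIV. ennreal (1 / d j) * ?V j t) \<longlongrightarrow> (\<Sum>j\<in>(UNIV :: 'd set). ennreal (1 / d j) * 0)) (at_right 0)"
    by (intro tendsto_sum ennreal_tendsto_cmult laguerre_kernel_second_moment[OF \<alpha> x meas]) auto
  then have lim: "((\<lambda>t. \<Sum>j\<in>UNIV. ennreal (1 / d j) * ?V j t) \<longlongrightarrow> 0) (at_right 0)" by simp
  show ?thesis
  proof (rule tendsto_sandwich[OF _ _ tendsto_const lim])
    show "\<forall>\<^sub>F t in at_right 0. (\<integral>\<^sup>+y. ennreal (laguerre_kernel \<alpha> t x y) * indicator D y \<partial>?M) \<le> (\<Sum>j\<in>UNIV. ennreal (1 / d j) * ?V j t)"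
      using eventually_at_right_less[of "0::real"]
    proof eventually_elim
      case (elim t)
      have "(\<integral>\<^sup>+y. ennreal (laguerre_kernel \<alpha> t x y) * indicator D y \<partial>?M)
        \<le> (\<integral>\<^sup>+y. (\<Sum>j\<in>UNIV. ennreal (1 / d j) * ennreal (laguerre_kernel \<alpha> t x y * (exp (- (y $ j)) - exp (- (x $ j)))\<^sup>2)) \<partial>?M)"
      proof (intro nn_integral_mono)
        fix y assume "y \<in> space ?M"
        then have nn: "0 \<le> laguerre_kernel \<alpha> t x y" using laguerre_kernel_nonneg[OF \<alpha> elim x] by simp
        show "ennreal (laguerre_kernel \<alpha> t x y) * indicator D y \<le> (\<Sum>j\<in>UNIV. ennreal (1 / d j) * ennreal (laguerre_kernel \<alpha> t x y * (exp (- (y $ j)) - exp (- (x $ j)))\<^sup>2))"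
        proof (cases "y \<in> D")
          case True
          then obtain j where j: "e \<le> \<bar>y $ j - x $ j\<bar>" using D by blast
          have "d j \<le> (exp (- (y $ j)) - exp (- (x $ j)))\<^sup>2"
            unfolding d_def using exp_minus_separated[OF j e] e
            by (subst abs_le_square_iff[symmetric]) (simp add: abs_mult)
          then have "1 \<le> 1 / d j * (exp (- (y $ j)) - exp (- (x $ j)))\<^sup>2" using d[of j] by (simp add: field_simps)
          from mult_left_mono[OF this nn]
          have "ennreal (laguerre_kernel \<alpha> t x y) \<le> ennreal (1 / d j) * ennreal (laguerre_kernel \<alpha> t x y * (exp (- (y $ j)) - exp (- (x $ j)))\<^sup>2)"
            using nn d[of j] by (simp add: ennreal_mult'[symmetric] mult_ac)
          also have "\<dots> \<le> (\<Sum>j\<in>UNIV. ennreal (1 / d j) * ennreal (laguerre_kernel \<alpha> t x y * (exp (- (y $ j)) - exp (- (x $ j)))\<^sup>2))"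
            by (rule member_le_sum) auto
          finally show ?thesis using True by simp
        qed simp
      qed
      also have "\<dots> = (\<Sum>j\<in>UNIV. ennreal (1 / d j) * ?V j t)"
        by (subst nn_integral_sum, measurable) (intro sum.cong refl nn_integral_cmult, measurable)
      finally show ?case .
    qed
  qed simp
qed

lemma box_separation:
  fixes x :: "real ^ 'd"
  assumes "x \<notin> cbox a b - box a b"
  obtains e where "0 < e" "\<And>y. (y \<in> box a b) \<noteq> (x \<in> box a b) \<Longrightarrow> \<exists>j. e \<le> \<bar>y $ j - x $ j\<bar>"
proof -
  define U where "U = (if x \<in> box a b then box a b else - cbox a b)"
  have "open U" "x \<in> U" using assms by (auto simp: U_def open_Compl)
  then obtain r where r: "0 < r" "ball x r \<subseteq> U" by (auto simp: open_contains_ball)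
  \<comment> \<open>The norm is at most the sum of the absolute coordinates, so coordinates all
    below \<open>r\<close> divided by the dimension stay within the ball of radius
    \<open>r\<close>.\<close>
  define e where "e = r / real CARD('d)"
  have e: "0 < e" using r by (simp add: e_def)
  have "\<exists>j. e \<le> \<bar>y $ j - x $ j\<bar>" if y: "(y \<in> box a b) \<noteq> (x \<in> box a b)" for y
  proof (rule ccontr)
    assume "\<not> ?thesis"
    then have "\<bar>(y - x) $ j\<bar> < e" for j by (auto simp: not_le)
    then have "(\<Sum>j\<in>UNIV. \<bar>(y - x) $ j\<bar>) < (\<Sum>j\<in>(UNIV :: 'd set). e)" by (intro sum_strict_mono) auto
    then have "norm (y - x) < r" using norm_le_l1_cart[of "y - x"] by (simp add: e_def)
    then have "y \<in> U" using r(2) by (auto simp: dist_norm norm_minus_commute)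
    then show False using y box_subset_cbox[of a b] by (auto simp: U_def split: if_splits)
  qed
  then show ?thesis using e that by blast
qed

lemma measurable_laguerre_kernel:
  fixes \<alpha> :: "real ^ 'd"
  shows "(\<lambda>(s, x, y). laguerre_kernel \<alpha> s x y) \<in> borel_measurable (borel \<Otimes>\<^sub>M laguerre_measure \<alpha> \<Otimes>\<^sub>M laguerre_measure \<alpha>)"
proof -
  have [measurable]: "(\<lambda>z. fst (snd z) $ i) \<in> borel_measurable (borel \<Otimes>\<^sub>M laguerre_measure \<alpha> \<Otimes>\<^sub>M laguerre_measure \<alpha>)"
    "(\<lambda>z. snd (snd z) $ i) \<in> borel_measurable (borel \<Otimes>\<^sub>M laguerre_measure \<alpha> \<Otimes>\<^sub>M laguerre_measure \<alpha>)" for i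
    by (rule measurable_laguerre_coordinate[where \<alpha>=\<alpha>], rule measurable_compose[OF measurable_snd measurable_fst],
        rule measurable_laguerre_coordinate[where \<alpha>=\<alpha>], rule measurable_compose[OF measurable_snd measurable_snd])
  show ?thesis unfolding laguerre_kernel_eq_prod split_beta' by measurable
qed

lemma orthant_boxes_generate:
  fixes \<alpha> :: "real ^ 'a"
  shows "sets (laguerre_measure \<alpha>) = sigma_sets orthant orthant_boxes"
proof -
  have "sets (laguerre_measure \<alpha>) = (\<inter>) orthant ` sigma_sets UNIV (range (\<lambda>(a, b). box a b))"
    unfolding sets_laguerre_measure sets_restrict_space borel_eq_box by (simp add: sets_measure_of)
  also have "\<dots> = sigma_sets orthant ((\<inter>) orthant ` range (\<lambda>(a, b). box a b))"
  proof (rule sigma_sets_Int)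
    have "sets (borel :: (real ^ 'a) measure) = sigma_sets UNIV (range (\<lambda>(a, b). box a b))"
      by (subst borel_eq_box) (simp add: sets_measure_of)
    then show "orthant \<in> sigma_sets UNIV (range (\<lambda>(a, b). box a b :: (real ^ 'a) set))"
      using orthant_sets by (rule subst)
  qed simp
  also have "(\<inter>) orthant ` range (\<lambda>(a, b). box a b) = orthant_boxes"
    by (auto simp: orthant_boxes_def)
  finally show ?thesis .
qed

lemma Int_stable_orthant_boxes: "Int_stable (orthant_boxes :: (real ^ 'd) set set)"
proof (rule Int_stableI)
  fix A B :: "(real ^ 'd) set" assume "A \<in> orthant_boxes" "B \<in> orthant_boxes"
  then obtain a b c d where AB: "A = orthant \<inter> box a b" "B = orthant \<inter> box c d" by (auto simp: orthant_boxes_def)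
  obtain u v where "box a b \<inter> box c d = box u v" by (rule that[OF box_Int_box])
  then have "A \<inter> B = orthant \<inter> box u v" by (auto simp: AB)
  then show "A \<inter> B \<in> orthant_boxes" by (auto simp: orthant_boxes_def)
qed

lemma orthant_boxes_cover: "\<exists>A :: nat \<Rightarrow> (real ^ 'd) set. range A \<subseteq> orthant_boxes \<and> (\<Union>i. A i) = orthant"
proof (intro exI conjI)
  let ?A = "\<lambda>n::nat. orthant \<inter> box (- (real n *\<^sub>R One)) (real n *\<^sub>R One) :: (real ^ 'd) set"
  show "range ?A \<subseteq> orthant_boxes" by (auto simp: orthant_boxes_def)
  have "(\<Union>n. ?A n) = orthant \<inter> (\<Union>n::nat. box (- (real n *\<^sub>R One)) (real n *\<^sub>R One))" by auto
  then show "(\<Union>n. ?A n) = orthant" by (simp add: UN_box_eq_UNIV)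
qed

lemma AE_not_in_box_frontier: "AE x in laguerre_measure \<alpha>. x \<notin> cbox a b - box a b"
proof -
  have "cbox a b - box a b \<in> null_sets lborel"
    using negligible_frontier_interval[of a b] by (simp add: negligible_iff_null_sets null_sets_completion_iff)
  then have "AE x in lborel. x \<notin> cbox a b - box a b" by (rule AE_not_in)
  then have "AE x in restrict_space lborel orthant. x \<notin> cbox a b - box a b"
    by (subst AE_restrict_space_iff) auto
  then show ?thesis
    unfolding laguerre_measure_def
    by (subst AE_density) (auto intro!: measurable_restrict_space1 elim!: eventually_mono)
qed

lemma markov_kernel_laguerre:
  fixes \<alpha> :: "real ^ 'd"
  assumes \<alpha>: "\<And>i. -1 < \<alpha> $ i"
  shows "markov_kernel (laguerre_measure \<alpha>) (laguerre_kernel \<alpha>) orthant_boxes"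
proof -
  interpret prob_space "laguerre_measure \<alpha>" by (rule prob_space_laguerre_measure[OF \<alpha>])
  have meas: "laguerre_kernel \<alpha> t x \<in> borel_measurable (laguerre_measure \<alpha>)" if x: "x \<in> orthant" for t x
  proof -
    have "(\<lambda>y. (t, x, y)) \<in> measurable (laguerre_measure \<alpha>) (borel \<Otimes>\<^sub>M laguerre_measure \<alpha> \<Otimes>\<^sub>M laguerre_measure \<alpha>)"
      using x by (intro measurable_Pair measurable_const measurable_ident_sets[OF refl]) auto
    from measurable_compose[OF this measurable_laguerre_kernel] show ?thesis by simp
  qed
  show ?thesis
  proof
    show "(\<lambda>(s, x, y). laguerre_kernel \<alpha> s x y) \<in> borel_measurable (borel \<Otimes>\<^sub>M laguerre_measure \<alpha> \<Otimes>\<^sub>M laguerre_measure \<alpha>)"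
      by (rule measurable_laguerre_kernel)
  next
    fix s x y assume "0 < (s::real)" "x \<in> space (laguerre_measure \<alpha>)" "y \<in> space (laguerre_measure \<alpha>)"
    then show "0 \<le> laguerre_kernel \<alpha> s x y" using laguerre_kernel_nonneg[OF \<alpha>] by simp
  next
    fix s :: real and x y
    show "laguerre_kernel \<alpha> s x y = laguerre_kernel \<alpha> s y x"
      unfolding laguerre_kernel_eq_prod by (intro prod.cong refl laguerre_kernel1_sym)
  next
    fix s x assume "0 < (s::real)" "x \<in> space (laguerre_measure \<alpha>)"
    then show "(\<integral>\<^sup>+y. ennreal (laguerre_kernel \<alpha> s x y) \<partial>laguerre_measure \<alpha>) = 1"
      using laguerre_kernel_laplace[OF \<alpha>, of s x 0] by (simp add: laguerre_laplace_def)
  next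
    fix s t x z assume "0 < (s::real)" "0 < (t::real)" "x \<in> space (laguerre_measure \<alpha>)" "z \<in> space (laguerre_measure \<alpha>)"
    then show "(\<integral>\<^sup>+y. ennreal (laguerre_kernel \<alpha> s x y) * ennreal (laguerre_kernel \<alpha> t y z) \<partial>laguerre_measure \<alpha>) = ennreal (laguerre_kernel \<alpha> (s + t) x z)"
      using laguerre_kernel_chapman[OF \<alpha>] by simp
  next
    show "orthant_boxes \<subseteq> Pow (space (laguerre_measure \<alpha>))" by (auto simp: orthant_boxes_def)
    show "sets (laguerre_measure \<alpha>) = sigma_sets (space (laguerre_measure \<alpha>)) orthant_boxes"
      by (simp add: orthant_boxes_generate)
    show "\<exists>A :: nat \<Rightarrow> (real ^ 'd) set. range A \<subseteq> orthant_boxes \<and> (\<Union>i. A i) = space (laguerre_measure \<alpha>)"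
      by (simp add: orthant_boxes_cover)
  next
    fix B :: "(real ^ 'd) set" assume "B \<in> orthant_boxes"
    then obtain a b where B: "B = orthant \<inter> box a b" by (auto simp: orthant_boxes_def)
    show "AE x in laguerre_measure \<alpha>. ((\<lambda>s. \<integral>\<^sup>+y. ennreal (laguerre_kernel \<alpha> s x y) *
      indicator {y \<in> space (laguerre_measure \<alpha>). (y \<in> B) \<noteq> (x \<in> B)} y \<partial>laguerre_measure \<alpha>) \<longlongrightarrow> 0) (at_right 0)"
      using AE_not_in_box_frontier[of a b \<alpha>] AE_space
    proof eventually_elim
      case (elim x)
      then have x: "x \<in> orthant" by simp
      from box_separation[OF elim(1)] obtain e where
        e: "0 < e" "\<And>y. (y \<in> box a b) \<noteq> (x \<in> box a b) \<Longrightarrow> \<exists>j. e \<le> \<bar>y $ j - x $ j\<bar>" by blast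
      show ?case
        by (rule laguerre_kernel_concentrate[OF \<alpha> x meas[OF x] e(1)]) (use e(2) x in \<open>auto simp: B\<close>)
    qed
  qed (rule Int_stable_orthant_boxes)
qed

section \<open>Boundedness of the Bessel Laguerre fractional derivative\<close>

lemma lip_order_eq_1: "0 < \<beta> \<Longrightarrow> \<beta> < 1 \<Longrightarrow> lip_order \<beta> = 1"
  unfolding lip_order_def
proof (rule Least_equality)
  fix n assume "0 < \<beta>" "\<beta> < real n"
  then show "1 \<le> n" by (cases n) auto
qed simp

theorem theorem4p3:
  fixes \<alpha> :: "real ^ 'd" and l \<beta> :: real
  assumes "\<And>i. - 1 / 2 < \<alpha> $ i"
    and "0 < l" and "l < \<beta>" and "\<beta> < 1"
  shows "\<exists>C. \<forall>f \<in> laguerre_Lip \<alpha> \<beta>.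
    (AE x in laguerre_measure \<alpha>.
       set_integrable lborel {0<..} (bessel_deriv_integrand \<alpha> l f x)) \<and>
    bessel_deriv \<alpha> l f \<in> laguerre_Lip \<alpha> (\<beta> - l) \<and>
    laguerre_Lip_norm \<alpha> (\<beta> - l) (bessel_deriv \<alpha> l f) \<le> C * laguerre_Lip_norm \<alpha> \<beta> f"
proof -
  let ?M = "laguerre_measure \<alpha>"
  have \<alpha>: "-1 < \<alpha> $ i" for i using assms(1)[of i] by simp
  interpret markov_kernel ?M "laguerre_kernel \<alpha>" orthant_boxes
    by (rule markov_kernel_laguerre[OF \<alpha>])
  have b: "0 < \<beta>" "0 < \<beta> - l" "\<beta> - l < 1" using assms by auto
  note order = lip_order_eq_1[OF b(1) assms(4)] lip_order_eq_1[OF b(2,3)]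
  have poisson: "poisson_laguerre \<alpha> t f x = P t f x" for t f x
    unfolding poisson_laguerre_def P_def T_def laguerre_semigroup_def set_lebesgue_integral_def levy_def
    by (intro Bochner_Integration.integral_cong refl) (simp add: indicator_def)
  have integrand: "bessel_deriv_integrand \<alpha> l f x t = bessel_integrand l f x t" for f x t
    by (simp add: bessel_deriv_integrand_def bessel_integrand_def poisson)
  then have integrand': "bessel_deriv_integrand \<alpha> l f x = bessel_integrand l f x" for f x
    by (rule ext)
  define c where "c = 1 / bessel_const l"
  have deriv: "bessel_deriv \<alpha> l f = (\<lambda>x. c * bessel l f x)" for f
    by (simp add: fun_eq_iff bessel_deriv_def bessel_def integrand c_def)
  have pd0: "poisson_deriv \<alpha> 0 t f x = P t f x" for t f x
    by (simp add: poisson_deriv_def poisson)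
  have pd1: "poisson_deriv \<alpha> 1 t f x = P' t f x" if "bdd B f" "0 < t" "x \<in> orthant" for B t f x
    using DERIV_imp_deriv[OF P_has_derivative[OF that(1,2)]] that(3) by (simp add: poisson_deriv_def poisson)
  have norm_nonneg: "0 \<le> Linf_norm ?M f" for f
  proof -
    have "esssup ?M (\<lambda>x. 0 :: ereal) \<le> esssup ?M (\<lambda>x. ereal \<bar>f x\<bar>)" by (rule esssup_mono) auto
    moreover have "esssup ?M (\<lambda>x. 0 :: ereal) = 0"
      by (rule esssup_const) (use emeasure_space_1 in simp)
    ultimately show ?thesis by (simp add: Linf_norm_def)
  qed
  have norm_le: "Linf_norm ?M f \<le> ereal B" if "f \<in> borel_measurable ?M" "AE x in ?M. \<bar>f x\<bar> \<le> B" for f B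
    unfolding Linf_norm_def using that by (intro esssup_I) auto
  have norm_AE: "AE x in ?M. \<bar>f x\<bar> \<le> B" if "Linf_norm ?M f \<le> ereal B" for f B
  proof -
    have "AE x in ?M. ereal \<bar>f x\<bar> \<le> Linf_norm ?M f" unfolding Linf_norm_def by (rule esssup_AE)
    then show ?thesis
    proof eventually_elim
      case (elim x)
      then have "ereal \<bar>f x\<bar> \<le> ereal B" using that by (rule order_trans)
      then show ?case by simp
    qed
  qed
  have lip_nonneg: "0 \<le> A" if "lip_bound \<alpha> \<gamma> f A" for \<gamma> f A
  proof -
    \<comment> \<open>At \<open>t = 1\<close> the power is one, so nonnegativity of the norm passes
      to \<open>A\<close>. This also bounds from below the sets whose infimum is the Lipschitz
      constant.\<close>
    have "0 \<le> ereal (A * 1 powr (- real (lip_order \<gamma>) + \<gamma>))"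
      using that norm_nonneg order_trans unfolding lip_bound_def by (metis zero_less_one)
    then show ?thesis by simp
  qed
  define H where "H = (34 + 16 / \<beta> + 24) * (1 / (1 - l) + 1 / (\<beta> - l) + 1 / l)"
  have H: "0 \<le> H" using assms by (simp add: H_def)
  \<comment> \<open>The factor 2 arises because the target norm adds a sup norm and a Lipschitz
    constant, each at most \<open>\<bar>c\<bar> * H * (A + B)\<close>.\<close>
  define C where "C = 2 * \<bar>c\<bar> * H"
  have C: "0 \<le> C" using H by (simp add: C_def)
  show ?thesis
  proof (intro exI[of _ C] ballI)
    fix f assume f: "f \<in> laguerre_Lip \<alpha> \<beta>"
    define B where "B = real_of_ereal (Linf_norm ?M f)"
    define g where "g = bessel_deriv \<alpha> l f"
    have fM: "f \<in> borel_measurable ?M" and fin: "Linf_norm ?M f < \<infinity>"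
      using f by (auto simp: laguerre_Lip_def Linf_def)
    have B: "Linf_norm ?M f = ereal B" "0 \<le> B"
      using fin norm_nonneg[of f] unfolding B_def by (cases "Linf_norm ?M f"; simp)+
    have bf: "bdd B f" using fM B norm_AE[of f B] by (simp add: bdd_def)
    have lip: "\<forall>t>0. AE x in ?M. \<bar>P' t f x\<bar> \<le> A * t powr (\<beta> - 1)" if A: "lip_bound \<alpha> \<beta> f A" for A
    proof (intro allI impI)
      fix t :: real assume t: "0 < t"
      have "Linf_norm ?M (poisson_deriv \<alpha> 1 t f) \<le> ereal (A * t powr (- 1 + \<beta>))"
        using A t unfolding lip_bound_def order by simp
      from norm_AE[OF this] AE_space show "AE x in ?M. \<bar>P' t f x\<bar> \<le> A * t powr (\<beta> - 1)"
        by eventually_elim (use pd1[OF bf t] in \<open>simp add: add.commute\<close>)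
    qed
    obtain A0 where A0: "lip_bound \<alpha> \<beta> f A0" using f by (auto simp: laguerre_Lip_def)
    have gb: "bdd (\<bar>c\<bar> * (H * (A + B))) g" and gl: "lip_bound \<alpha> (\<beta> - l) g (\<bar>c\<bar> * (H * (A + B)))"
      if A: "lip_bound \<alpha> \<beta> f A" for A
    proof -
      note bb = bessel_bounded[OF bf lip_nonneg[OF A] assms(2-4) lip[OF A], folded H_def]
      have m: "bessel l f \<in> borel_measurable ?M" using bb(1) by (simp add: bdd_def)
      have le: "\<bar>c * r\<bar> \<le> \<bar>c\<bar> * K" if "\<bar>r\<bar> \<le> K" for r K
        using that by (simp add: abs_mult mult_left_mono)
      show gb: "bdd (\<bar>c\<bar> * (H * (A + B))) g"
        using bb(1) m unfolding bdd_def g_def deriv by (auto elim!: eventually_mono intro: le)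
      have P'g: "P' t g x = c * P' t (bessel l f) x" for t x
      proof -
        have "T s g x = c * T s (bessel l f) x" for s
          unfolding g_def deriv T_def integral_mult_right_zero[symmetric] by (simp only: mult.left_commute)
        then show ?thesis unfolding P'_def by (simp only: mult.assoc integral_mult_right_zero)
      qed
      show "lip_bound \<alpha> (\<beta> - l) g (\<bar>c\<bar> * (H * (A + B)))"
        unfolding lip_bound_def order
      proof (intro allI impI norm_le)
        fix t :: real assume t: "0 < t"
        have eq: "poisson_deriv \<alpha> 1 t g x = P' t g x" if "x \<in> space ?M" for x
          using pd1[OF gb t] that by simp
        have "P' t g \<in> borel_measurable ?M" using bdd_measurable[OF gb] by measurable
        then show "poisson_deriv \<alpha> 1 t g \<in> borel_measurable ?M"
          by (subst measurable_cong[OF eq]) auto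
        show "AE x in ?M. \<bar>poisson_deriv \<alpha> 1 t g x\<bar> \<le> \<bar>c\<bar> * (H * (A + B)) * t powr (- real 1 + (\<beta> - l))"
        proof (rule AE_I2)
          fix x assume x: "x \<in> space ?M"
          have "\<bar>P' t (bessel l f) x\<bar> \<le> H * (A + B) * t powr (- real 1 + (\<beta> - l))"
            using bb(2)[OF t x] by (simp add: algebra_simps)
          from le[OF this] show "\<bar>poisson_deriv \<alpha> 1 t g x\<bar> \<le> \<bar>c\<bar> * (H * (A + B)) * t powr (- real 1 + (\<beta> - l))"
            unfolding eq[OF x] P'g by (simp add: mult.assoc)
        qed
      qed
    qed
    have int: "AE x in ?M. set_integrable lborel {0<..} (bessel_deriv_integrand \<alpha> l f x)"
      using P_bessel(3)[OF bf lip_nonneg[OF A0] assms(2,3) b(1) assms(4) lip[OF A0]]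
      unfolding integrand' .
    have gnorm: "Linf_norm ?M g \<le> ereal (\<bar>c\<bar> * (H * (A + B)))" if "lip_bound \<alpha> \<beta> f A" for A
      using gb[OF that] by (intro norm_le) (auto simp: bdd_def)
    have gLip: "g \<in> laguerre_Lip \<alpha> (\<beta> - l)"
      unfolding laguerre_Lip_def order
    proof (intro CollectI conjI ballI allI impI)
      show "g \<in> Linf ?M" using gnorm[OF A0] bdd_measurable[OF gb[OF A0]] unfolding Linf_def by auto
      show "\<exists>A. lip_bound \<alpha> (\<beta> - l) g A" using gl[OF A0] by blast
      fix x :: "real ^ 'd" and k :: nat and t :: real assume x: "x \<in> orthant" and k: "k < 1" and t: "0 < t"
      have "((\<lambda>t. P t g x) has_real_derivative P' t g x) (at t)"
        by (rule P_has_derivative[OF gb[OF A0] t]) (use x in simp)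
      then show "(\<lambda>s. poisson_deriv \<alpha> k s g x) differentiable at t"
        using k by (auto simp: pd0 real_differentiable_def)
    qed
    have "laguerre_Lip_norm \<alpha> (\<beta> - l) g \<le> C * laguerre_Lip_norm \<alpha> \<beta> f"
    proof -
      have bdd: "bdd_below {A. lip_bound \<alpha> \<gamma> h A}" for \<gamma> h
        by (rule bdd_belowI[of _ 0]) (use lip_nonneg in blast)
      have "laguerre_Lip_norm \<alpha> (\<beta> - l) g \<le> C * (A + B)" if A: "lip_bound \<alpha> \<beta> f A" for A
      proof -
        have "real_of_ereal (Linf_norm ?M g) \<le> \<bar>c\<bar> * (H * (A + B))"
          using gnorm[OF A] norm_nonneg[of g] by (cases "Linf_norm ?M g") auto
        moreover have "laguerre_Lip_const \<alpha> (\<beta> - l) g \<le> \<bar>c\<bar> * (H * (A + B))"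
          unfolding laguerre_Lip_const_def using gl[OF A] by (intro cInf_lower bdd) auto
        ultimately show ?thesis by (simp add: laguerre_Lip_norm_def C_def)
      qed
      note le = this
      show ?thesis
      \<comment> \<open>The value of \<open>bessel_const l\<close> is not computed, so
        \<open>c = 0\<close> is not excluded; the case is separated before dividing by
        \<open>C\<close>.\<close>
      proof (cases "C = 0")
        case True
        then show ?thesis using le[OF A0] by simp
      next
        case False
        then have C: "0 < C" using C by simp
        \<comment> \<open>The estimate holds for every admissible \<open>A\<close>; solving it for
          \<open>A\<close> makes the left-hand side a lower bound of the admissible constants, so
          the infimum need not be shown to be attained.\<close>
        have "laguerre_Lip_norm \<alpha> (\<beta> - l) g / C - B \<le> laguerre_Lip_const \<alpha> \<beta> f"
          unfolding laguerre_Lip_const_def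
        proof (rule cInf_greatest)
          show "{A. lip_bound \<alpha> \<beta> f A} \<noteq> {}" using A0 by blast
          fix A assume "A \<in> {A. lip_bound \<alpha> \<beta> f A}"
          then show "laguerre_Lip_norm \<alpha> (\<beta> - l) g / C - B \<le> A" using le[of A] C by (simp add: field_simps)
        qed
        then show ?thesis using C by (simp add: laguerre_Lip_norm_def[of \<alpha> \<beta> f] B_def[symmetric] field_simps)
      qed
    qed
    with int gLip show "(AE x in ?M. set_integrable lborel {0<..} (bessel_deriv_integrand \<alpha> l f x)) \<and>
      bessel_deriv \<alpha> l f \<in> laguerre_Lip \<alpha> (\<beta> - l) \<and>
      laguerre_Lip_norm \<alpha> (\<beta> - l) (bessel_deriv \<alpha> l f) \<le> C * laguerre_Lip_norm \<alpha> \<beta> f"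
      unfolding g_def by blast
  qed
qed

end
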